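(* For any constant $\delta\in(0,1/2]$ and any $n$ and $m=\Theta(n^{1/(1-\delta)})$, there is no algorithm for maintaining the dominator tree of a flow graph with $n$ vertices and $m$ edges under edge deletions (respectively, under edge insertions) that supports queries of the form ``is $x$ the parent of $y$ in the dominator tree?'' and that uses polynomial preprocessing time, total update time $u(m,n)=(mn)^{1-\epsilon}$ and query time $q(m)=m^{\delta-\epsilon}$ for some constant $\epsilon>0$, unless the OMv conjecture fails.
   Context: A flow graph is a directed graph with a start vertex $s$; $w$ dominates $v$ if every path from $s$ to $v$ contains $w$, and the dominator tree has root $s$ and gives each reachable $v\neq s$ as parent its immediate dominator (the dominator of $v$ other than $v$ dominated by all other dominators of $v$ other than $v$). The OMv (online Boolean matrix-vector multiplication) problem: given an $n\times n$ Boolean matrix $M$ to preprocess, then Boolean vectors $v^{(1)},\dots,v^{(n)}$ arriving one at a time, output $Mv^{(t)}$ (Boolean product) before seeing $v^{(t+1)}$. The OMv conjecture states that no algorithm solves this correctly (with high probability) in total time $O(n^{3-\epsilon})$ for any constant $\epsilon>0$. *)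

theory Defs
  imports
    "HOL-Probability.Probability"
    "HOL-Probability.Product_PMF"
    "HOL-Library.Landau_Symbols"
    "Graph_Theory.Pair_Digraph"
begin

section \<open>Flow graphs and dominator trees\<close>

definition flow_graph :: "'a pair_pre_digraph \<Rightarrow> 'a \<Rightarrow> bool" where
  "flow_graph G s \<longleftrightarrow> pair_digraph G \<and> s \<in> pverts G"

text \<open>The name \<open>dominates\<close> is taken by adjacency in \<open>Graph_Theory\<close>, hence \<open>dom_by\<close>:
  \<open>dom_by G s w v\<close> says that \<open>w\<close> dominates \<open>v\<close>.\<close>

definition dom_by :: "'a pair_pre_digraph \<Rightarrow> 'a \<Rightarrow> 'a \<Rightarrow> 'a \<Rightarrow> bool" where
  "dom_by G s w v \<longleftrightarrow>
     (\<forall>p. pre_digraph.apath (with_proj G) s p v \<longrightarrow>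
            w \<in> set (pre_digraph.awalk_verts (with_proj G) s p))"

definition immediate_dominator :: "'a pair_pre_digraph \<Rightarrow> 'a \<Rightarrow> 'a \<Rightarrow> 'a \<Rightarrow> bool" where
  "immediate_dominator G s w v \<longleftrightarrow>
     dom_by G s w v \<and> w \<noteq> v \<and> (\<forall>d. dom_by G s d v \<and> d \<noteq> v \<longrightarrow> dom_by G s d w)"

text \<open>The arcs are directed from parent to child.\<close>

definition dominator_tree :: "'a pair_pre_digraph \<Rightarrow> 'a \<Rightarrow> 'a pair_pre_digraph" where
  "dominator_tree G s =
     \<lparr> pverts = {v. reachable (with_proj G) s v},
       parcs = {(w, v). reachable (with_proj G) s v \<and> v \<noteq> s \<and> immediate_dominator G s w v} \<rparr>"

definition dom_tree_parent :: "'a pair_pre_digraph \<Rightarrow> 'a \<Rightarrow> 'a \<Rightarrow> 'a \<Rightarrow> bool" where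
  "dom_tree_parent G s x y \<longleftrightarrow> (x, y) \<in> parcs (dominator_tree G s)"


section \<open>Randomized word RAM\<close>

datatype arith = Add | Sub | Mul | Div | Mod | Less | Equal | And | Or | Xor | Shl | Shr

fun arith_op :: "arith \<Rightarrow> nat \<Rightarrow> nat \<Rightarrow> nat" where
  "arith_op Add a b = a + b"
| "arith_op Sub a b = a - b"
| "arith_op Mul a b = a * b"
| "arith_op Div a b = a div b"
| "arith_op Mod a b = a mod b"
| "arith_op Less a b = of_bool (a < b)"
| "arith_op Equal a b = of_bool (a = b)"
| "arith_op And a b = semiring_bit_operations_class.and a b"
| "arith_op Or a b = semiring_bit_operations_class.or a b"
| "arith_op Xor a b = semiring_bit_operations_class.xor a b"
| "arith_op Shl a b = push_bit b a"
| "arith_op Shr a b = drop_bit b a"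

text \<open>Natural-number arguments are register names, except for the literal in \<open>Const\<close>.
  \<open>Load x y\<close> and \<open>Store x y\<close> are \<open>x := mem[y]\<close> and \<open>mem[x] := y\<close>;
  \<open>Input\<close>, \<open>Output\<close> and \<open>Coin\<close> access a read-only input array, a write-only
  output array and an array of independent fair random bits. Random access to the bits adds no power
  over drawing them one by one: a drawn bit can be kept in memory under its address.\<close>

datatype com =
    Skip
  | Const nat nat
  | Arith arith nat nat nat
  | Load nat nat
  | Store nat nat
  | Input nat nat
  | Output nat nat
  | Coin nat nat
  | Seq com com
  | If nat com com
  | While nat com

record state =
  reg :: "nat \<Rightarrow> nat"
  mem :: "nat \<Rightarrow> nat"
  outp :: "nat \<Rightarrow> nat"

definition set_reg :: "nat \<Rightarrow> nat \<Rightarrow> state \<Rightarrow> state" where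
  "set_reg x a \<sigma> = \<sigma>\<lparr>reg := (reg \<sigma>)(x := a)\<rparr>"

text \<open>\<open>exec B coin inp c \<sigma> t \<sigma>'\<close>: started in \<open>\<sigma>\<close>, the program \<open>c\<close> halts after exactly \<open>t\<close>
  steps in \<open>\<sigma>'\<close>, and every value computed and every address used is at most \<open>B\<close>. There is no
  rule for an overflow, so such an execution is stuck. The bound matters: with unit-cost
  arithmetic on unbounded numbers, the OMv problem has a fast solution by packing
  whole columns into single registers.\<close>

inductive exec :: "nat \<Rightarrow> (nat \<Rightarrow> bool) \<Rightarrow> (nat \<Rightarrow> nat) \<Rightarrow> com \<Rightarrow> state \<Rightarrow> nat \<Rightarrow> state \<Rightarrow> bool"
  for B :: nat and coin :: "nat \<Rightarrow> bool" and inp :: "nat \<Rightarrow> nat" where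
  Skip: "exec B coin inp Skip \<sigma> 1 \<sigma>"
| Const: "k \<le> B \<Longrightarrow> exec B coin inp (Const x k) \<sigma> 1 (set_reg x k \<sigma>)"
| Arith: "a = arith_op f (reg \<sigma> y) (reg \<sigma> z) \<Longrightarrow> a \<le> B \<Longrightarrow>
    exec B coin inp (Arith f x y z) \<sigma> 1 (set_reg x a \<sigma>)"
| Load: "reg \<sigma> y \<le> B \<Longrightarrow> exec B coin inp (Load x y) \<sigma> 1 (set_reg x (mem \<sigma> (reg \<sigma> y)) \<sigma>)"
| Store: "reg \<sigma> x \<le> B \<Longrightarrow>
    exec B coin inp (Store x y) \<sigma> 1 (\<sigma>\<lparr>mem := (mem \<sigma>)(reg \<sigma> x := reg \<sigma> y)\<rparr>)"
| Input: "reg \<sigma> y \<le> B \<Longrightarrow> inp (reg \<sigma> y) \<le> B \<Longrightarrow>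
    exec B coin inp (Input x y) \<sigma> 1 (set_reg x (inp (reg \<sigma> y)) \<sigma>)"
| Output: "reg \<sigma> x \<le> B \<Longrightarrow>
    exec B coin inp (Output x y) \<sigma> 1 (\<sigma>\<lparr>outp := (outp \<sigma>)(reg \<sigma> x := reg \<sigma> y)\<rparr>)"
| Coin: "reg \<sigma> y \<le> B \<Longrightarrow>
    exec B coin inp (Coin x y) \<sigma> 1 (set_reg x (of_bool (coin (reg \<sigma> y))) \<sigma>)"
| Seq: "exec B coin inp c1 \<sigma> t1 \<sigma>1 \<Longrightarrow> exec B coin inp c2 \<sigma>1 t2 \<sigma>2 \<Longrightarrow>
    exec B coin inp (Seq c1 c2) \<sigma> (t1 + t2) \<sigma>2"
| IfTrue: "reg \<sigma> x \<noteq> 0 \<Longrightarrow> exec B coin inp c1 \<sigma> t \<sigma>' \<Longrightarrow>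
    exec B coin inp (If x c1 c2) \<sigma> (t + 1) \<sigma>'"
| IfFalse: "reg \<sigma> x = 0 \<Longrightarrow> exec B coin inp c2 \<sigma> t \<sigma>' \<Longrightarrow>
    exec B coin inp (If x c1 c2) \<sigma> (t + 1) \<sigma>'"
| WhileFalse: "reg \<sigma> x = 0 \<Longrightarrow> exec B coin inp (While x c) \<sigma> 1 \<sigma>"
| WhileTrue: "reg \<sigma> x \<noteq> 0 \<Longrightarrow> exec B coin inp c \<sigma> t1 \<sigma>1 \<Longrightarrow>
    exec B coin inp (While x c) \<sigma>1 t2 \<sigma>2 \<Longrightarrow>
    exec B coin inp (While x c) \<sigma> (t1 + t2 + 1) \<sigma>2"

text \<open>An online computation is a sequence of calls, each running a program on an input that is
  hidden from the earlier calls. Only the memory (and the random bits) persist between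
  calls; registers and output start at zero. Each call yields its running time and output.\<close>

inductive serve :: "nat \<Rightarrow> (nat \<Rightarrow> bool) \<Rightarrow> (nat \<Rightarrow> nat) \<Rightarrow>
    (com \<times> (nat \<Rightarrow> nat)) list \<Rightarrow> (nat \<times> (nat \<Rightarrow> nat)) list \<Rightarrow> bool"
  for B :: nat and coin :: "nat \<Rightarrow> bool" where
  Nil: "serve B coin \<mu> [] []"
| Cons: "exec B coin inp c \<lparr>reg = (\<lambda>_. 0), mem = \<mu>, outp = (\<lambda>_. 0)\<rparr> t \<sigma> \<Longrightarrow>
    serve B coin (mem \<sigma>) calls rs \<Longrightarrow>
    serve B coin \<mu> ((c, inp) # calls) ((t, outp \<sigma>) # rs)"

text \<open>Words of \<open>O(log n)\<close> bits: all values are polynomially bounded.\<close>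

definition word_bound :: "nat \<Rightarrow> nat \<Rightarrow> nat" where
  "word_bound c n = (n + 2) ^ c"

definition coins :: "nat \<Rightarrow> (nat \<Rightarrow> bool) pmf" where
  "coins B = Pi_pmf {..B} False (\<lambda>_. bernoulli_pmf (1/2))"


section \<open>Online Boolean matrix-vector multiplication\<close>

record omv_alg =
  omv_preprocess :: com
  omv_round :: com

definition matrix_input :: "nat \<Rightarrow> (nat \<Rightarrow> nat \<Rightarrow> bool) \<Rightarrow> nat \<Rightarrow> nat" where
  "matrix_input n M a =
     (if a = 0 then n
      else if a \<le> n * n then of_bool (M ((a - 1) div n) ((a - 1) mod n))
      else 0)"

definition vector_input :: "nat \<Rightarrow> (nat \<Rightarrow> bool) \<Rightarrow> nat \<Rightarrow> nat" where
  "vector_input n v a = of_bool (a < n \<and> v a)"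

definition omv_calls :: "omv_alg \<Rightarrow> nat \<Rightarrow> (nat \<Rightarrow> nat \<Rightarrow> bool) \<Rightarrow> (nat \<Rightarrow> bool) list \<Rightarrow>
    (com \<times> (nat \<Rightarrow> nat)) list" where
  "omv_calls A n M vs =
     (omv_preprocess A, matrix_input n M) # map (\<lambda>v. (omv_round A, vector_input n v)) vs"

definition bool_mat_vec :: "nat \<Rightarrow> (nat \<Rightarrow> nat \<Rightarrow> bool) \<Rightarrow> (nat \<Rightarrow> bool) \<Rightarrow> nat \<Rightarrow> bool" where
  "bool_mat_vec n M v i \<longleftrightarrow> (\<exists>j<n. M i j \<and> v j)"

text \<open>In a list \<open>rs\<close> of results, entry \<open>0\<close> belongs to the preprocessing and entry \<open>Suc i\<close>
  to the \<open>i\<close>-th request.\<close>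

definition omv_correct :: "nat \<Rightarrow> (nat \<Rightarrow> nat \<Rightarrow> bool) \<Rightarrow> (nat \<Rightarrow> bool) list \<Rightarrow>
    (nat \<times> (nat \<Rightarrow> nat)) list \<Rightarrow> bool" where
  "omv_correct n M vs rs \<longleftrightarrow>
     (\<forall>t<n. \<forall>i<n. snd (rs ! Suc t) i = of_bool (bool_mat_vec n M (vs ! t) i))"

text \<open>The time bound holds for all outcomes of the coins; the output is correct with probability
  at least \<open>1 - 1/n\<close>.\<close>

definition solves_OMv :: "real \<Rightarrow> omv_alg \<Rightarrow> bool" where
  "solves_OMv \<epsilon> A \<longleftrightarrow>
     (\<exists>c N :: nat. \<exists>C :: real. \<forall>n\<ge>1. \<forall>M vs. length vs = n \<longrightarrow>
        (\<forall>coin. \<exists>rs. serve (word_bound c n) coin (\<lambda>_. 0) (omv_calls A n M vs) rs \<and>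
           (n \<ge> N \<longrightarrow> real (sum_list (map fst rs)) \<le> C * real n powr (3 - \<epsilon>))) \<and>
        measure_pmf.prob (coins (word_bound c n))
          {coin. \<exists>rs. serve (word_bound c n) coin (\<lambda>_. 0) (omv_calls A n M vs) rs \<and>
                      omv_correct n M vs rs} \<ge> 1 - 1 / real n)"

definition OMv_conjecture :: bool where
  "OMv_conjecture \<longleftrightarrow> (\<forall>\<epsilon>>0. \<not> (\<exists>A. solves_OMv \<epsilon> A))"


section \<open>Partially dynamic dominator trees\<close>

datatype mode = Decremental | Incremental

datatype request = is_update: Update nat nat | is_query: Query nat nat

record dom_alg =
  dom_preprocess :: com
  dom_update :: com
  dom_query :: com

definition nat_graph :: "nat \<Rightarrow> (nat \<times> nat) set \<Rightarrow> nat pair_pre_digraph" where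
  "nat_graph n E = \<lparr> pverts = {..<n}, parcs = E \<rparr>"

fun apply_request :: "mode \<Rightarrow> request \<Rightarrow> (nat \<times> nat) set \<Rightarrow> (nat \<times> nat) set" where
  "apply_request Decremental (Update u v) E = E - {(u, v)}"
| "apply_request Incremental (Update u v) E = insert (u, v) E"
| "apply_request _ (Query x y) E = E"

text \<open>An edge is deleted only when present and inserted only when absent, and the number of edges
  never exceeds \<open>m\<close>.\<close>

fun admissible :: "mode \<Rightarrow> nat \<Rightarrow> nat \<Rightarrow> (nat \<times> nat) set \<Rightarrow> request \<Rightarrow> bool" where
  "admissible Decremental n m E (Update u v) \<longleftrightarrow> (u, v) \<in> E"
| "admissible Incremental n m E (Update u v) \<longleftrightarrow>
     u < n \<and> v < n \<and> u \<noteq> v \<and> (u, v) \<notin> E \<and> card E < m"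
| "admissible _ n m E (Query x y) \<longleftrightarrow> x < n \<and> y < n"

definition edges_after :: "mode \<Rightarrow> (nat \<times> nat) set \<Rightarrow> request list \<Rightarrow> (nat \<times> nat) set" where
  "edges_after md E reqs = fold (apply_request md) reqs E"

definition instance_of :: "mode \<Rightarrow> nat \<Rightarrow> nat \<Rightarrow> nat \<Rightarrow> (nat \<times> nat) set \<Rightarrow> request list \<Rightarrow> bool" where
  "instance_of md n m s E reqs \<longleftrightarrow>
     flow_graph (nat_graph n E) s \<and> card E \<le> m \<and>
     (\<forall>i<length reqs. admissible md n m (edges_after md E (take i reqs)) (reqs ! i))"

text \<open>Number of vertices, start vertex, then the adjacency matrix row by row.\<close>

definition graph_input :: "nat \<Rightarrow> nat \<Rightarrow> (nat \<times> nat) set \<Rightarrow> nat \<Rightarrow> nat" where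
  "graph_input n s E a =
     (if a = 0 then n
      else if a = 1 then s
      else if a < n * n + 2 then of_bool (((a - 2) div n, (a - 2) mod n) \<in> E)
      else 0)"

definition pair_input :: "nat \<Rightarrow> nat \<Rightarrow> nat \<Rightarrow> nat" where
  "pair_input x y a = (if a = 0 then x else if a = 1 then y else 0)"

fun request_call :: "dom_alg \<Rightarrow> request \<Rightarrow> com \<times> (nat \<Rightarrow> nat)" where
  "request_call A (Update u v) = (dom_update A, pair_input u v)"
| "request_call A (Query x y) = (dom_query A, pair_input x y)"

definition dom_calls :: "dom_alg \<Rightarrow> nat \<Rightarrow> nat \<Rightarrow> (nat \<times> nat) set \<Rightarrow> request list \<Rightarrow>
    (com \<times> (nat \<Rightarrow> nat)) list" where
  "dom_calls A n s E reqs =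
     (dom_preprocess A, graph_input n s E) # map (request_call A) reqs"

definition preprocessing_time :: "(nat \<times> (nat \<Rightarrow> nat)) list \<Rightarrow> nat" where
  "preprocessing_time rs = fst (rs ! 0)"

definition total_update_time :: "request list \<Rightarrow> (nat \<times> (nat \<Rightarrow> nat)) list \<Rightarrow> nat" where
  "total_update_time reqs rs =
     (\<Sum>i | i < length reqs \<and> is_update (reqs ! i). fst (rs ! Suc i))"

definition max_query_time_le :: "request list \<Rightarrow> (nat \<times> (nat \<Rightarrow> nat)) list \<Rightarrow> real \<Rightarrow> bool" where
  "max_query_time_le reqs rs T \<longleftrightarrow>
     (\<forall>i<length reqs. is_query (reqs ! i) \<longrightarrow> real (fst (rs ! Suc i)) \<le> T)"

text \<open>Time bounds hold for all outcomes of the coins. Each query in a fixed request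
  sequence is answered correctly with probability at least \<open>1 - 1/n\<close>; this also covers
  algorithms for which all answers are simultaneously correct with that probability, in particular
  deterministic ones.\<close>

definition maintains_dominator_tree :: "mode \<Rightarrow> (nat \<Rightarrow> nat) \<Rightarrow> real \<Rightarrow> real \<Rightarrow> dom_alg \<Rightarrow> bool" where
  "maintains_dominator_tree md m \<delta> \<epsilon> A \<longleftrightarrow>
     (\<exists>c k N :: nat. \<exists>C :: real. \<forall>n s E reqs. instance_of md n (m n) s E reqs \<longrightarrow>
        (\<forall>coin. \<exists>rs. serve (word_bound c n) coin (\<lambda>_. 0) (dom_calls A n s E reqs) rs \<and>
           (n \<ge> N \<longrightarrow>
              real (preprocessing_time rs) \<le> C * real n ^ k \<and>
              real (total_update_time reqs rs) \<le> C * (real (m n) * real n) powr (1 - \<epsilon>) \<and>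
              max_query_time_le reqs rs (C * real (m n) powr (\<delta> - \<epsilon>)))) \<and>
        (\<forall>i<length reqs. \<forall>x y. reqs ! i = Query x y \<longrightarrow>
           measure_pmf.prob (coins (word_bound c n))
             {coin. \<exists>rs. serve (word_bound c n) coin (\<lambda>_. 0) (dom_calls A n s E reqs) rs \<and>
                snd (rs ! Suc i) 0 =
                  of_bool (dom_tree_parent (nat_graph n (edges_after md E (take i reqs))) s x y)}
             \<ge> 1 - 1 / real n))"

end

theory Submission
  imports Defs "HOL-Real_Asymp.Real_Asymp"
begin

text \<open>
  Let \<open>g\<close> be about \<open>n powr (1/Q)\<close> for a large constant \<open>Q\<close>, and cut the \<open>n \<times> n\<close> matrix into blocks of
  height \<open>h = g ^ P\<close> and width \<open>w = g ^ R\<close>, where \<open>P\<close> is large and \<open>R\<close> is the largest integer below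
  \<open>P * \<delta> / (1 - \<delta>)\<close>. For a block, \<open>h\<close> rounds of vectors form an epoch, which becomes one instance of the
  dynamic problem with \<open>O(h)\<close> vertices and \<open>O(h * w)\<close> edges: every round has its own vertex on a path
  leaving the start vertex, joined by dynamic edges to the columns in its vector, while the columns are
  joined to the rows by the ones of the block. The end of the path is joined to all rows. As long as the
  preceding path vertices have no edges to columns, the vertex of the current round is the parent of a
  row in the dominator tree exactly if the row has a one in common with the vector. The rounds therefore
  move along the path away from the start vertex under deletions, and towards it under insertions.

  An epoch takes \<open>O(h * w)\<close> updates and \<open>h\<^sup>2\<close> queries. The assumed time bounds gain a factor \<open>g\<close> over
  \<open>h\<^sup>2 * w\<close>, which sums up to \<open>O(n\<^sup>3 / g)\<close> over all blocks and epochs. The preprocessed data structure of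
  a block serves all its epochs, since its memory can be rewound for free. The error probability is
  reduced by majority votes among constantly many copies with separate random bits.
\<close>

section \<open>Executing programs\<close>

\<comment> \<open>The exponents come from \<open>\<beta> = 1 / (1 - \<delta>)\<close>. A gadget has
  about \<open>h\<close> vertices, so it may have about \<open>h powr \<beta>\<close> edges. Since
  \<open>\<beta> * \<delta> = \<beta> - 1\<close>, a width \<open>w\<close> just below
  \<open>h powr (\<beta> - 1)\<close> balances both time bounds: without \<open>\<epsilon>\<close>,
  the updates and the \<open>h\<^sup>2\<close> queries each cost about \<open>h\<^sup>2 * w\<close>.
  The \<open>\<epsilon>\<close> saves at least two factors \<open>g\<close>; one pays for rounding
  \<open>R\<close> down, the other is the gain. All sizes are powers of one integer \<open>g\<close>
  because the program computes with integers only. The algorithm is assumed correct for fixed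
  request sequences. This is enough, as the requests depend on the matrix and the vectors alone and
  never on earlier answers. A single answer may fail with probability \<open>1 / n'\<close>, where
  \<open>n'\<close> is much smaller than a large \<open>n\<close>, while the answers that must all
  be right are polynomially many in \<open>n\<close>; hence the votes. Copies use disjoint slices of
  the coins, whereas blocks and epochs share them, which the final union bound over all answers
  tolerates.\<close>
inductive_simps exec_Skip_iff: "exec B coin inp Skip \<sigma> t \<sigma>'"
inductive_simps exec_Const_iff: "exec B coin inp (Const x k) \<sigma> t \<sigma>'"
inductive_simps exec_Arith_iff: "exec B coin inp (Arith f x y z) \<sigma> t \<sigma>'"
inductive_simps exec_Load_iff: "exec B coin inp (Load x y) \<sigma> t \<sigma>'"
inductive_simps exec_Store_iff: "exec B coin inp (Store x y) \<sigma> t \<sigma>'"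
inductive_simps exec_Input_iff: "exec B coin inp (Input x y) \<sigma> t \<sigma>'"
inductive_simps exec_Output_iff: "exec B coin inp (Output x y) \<sigma> t \<sigma>'"
inductive_simps exec_Coin_iff: "exec B coin inp (Coin x y) \<sigma> t \<sigma>'"
inductive_simps exec_Seq_iff: "exec B coin inp (Seq c1 c2) \<sigma> t \<sigma>'"
inductive_simps exec_If_iff: "exec B coin inp (If x c1 c2) \<sigma> t \<sigma>'"

inductive_cases exec_WhileE: "exec B coin inp (While x c) \<sigma> t \<sigma>'"

text \<open>Determinism makes the time, memory and output of a call functions of its coins, memory
  and input. The function \<open>results\<close> and all probability statements about it rest on
  this.\<close>

lemma exec_deterministic:
  "exec B coin inp c \<sigma> t \<sigma>' \<Longrightarrow> exec B coin inp c \<sigma> u \<tau> \<Longrightarrow> u = t \<and> \<tau> = \<sigma>'"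
proof (induction arbitrary: u \<tau> rule: exec.induct)
  case (Seq c1 \<sigma> t1 \<sigma>1 c2 t2 \<sigma>2)
  from Seq.prems obtain u1 u2 \<tau>1 where u: "exec B coin inp c1 \<sigma> u1 \<tau>1" "exec B coin inp c2 \<tau>1 u2 \<tau>" "u = u1 + u2"
    unfolding exec_Seq_iff by auto
  have "u1 = t1 \<and> \<tau>1 = \<sigma>1" by (rule Seq.IH(1)[OF u(1)])
  then have "u2 = t2 \<and> \<tau> = \<sigma>2" using u(2) by (intro Seq.IH(2)) simp
  with \<open>u1 = t1 \<and> _\<close> u(3) show ?case by simp
next
  case (IfTrue \<sigma> x c1 t \<sigma>' c2)
  from IfTrue.prems IfTrue.hyps(1) have "exec B coin inp c1 \<sigma> (u - 1) \<tau>" "1 \<le> u" by (auto simp: exec_If_iff)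
  with IfTrue.IH show ?case by fastforce
next
  case (IfFalse \<sigma> x c2 t \<sigma>' c1)
  from IfFalse.prems IfFalse.hyps(1) have "exec B coin inp c2 \<sigma> (u - 1) \<tau>" "1 \<le> u" by (auto simp: exec_If_iff)
  with IfFalse.IH show ?case by fastforce
next
  case (WhileFalse \<sigma> x c)
  from WhileFalse.prems show ?case by (rule exec_WhileE) (use WhileFalse in auto)
next
  case (WhileTrue \<sigma> x c t1 \<sigma>1 t2 \<sigma>2)
  from WhileTrue.prems obtain u1 u2 \<tau>1 where u: "exec B coin inp c \<sigma> u1 \<tau>1"
    "exec B coin inp (While x c) \<tau>1 u2 \<tau>" "u = u1 + u2 + 1"
    by (rule exec_WhileE) (use WhileTrue.hyps(1) in auto)
  have "u1 = t1 \<and> \<tau>1 = \<sigma>1" by (rule WhileTrue.IH(1)[OF u(1)])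
  then have "u2 = t2 \<and> \<tau> = \<sigma>2" using u(2) by (intro WhileTrue.IH(2)) simp
  with \<open>u1 = t1 \<and> _\<close> u(3) show ?case by simp
qed (auto simp: exec_Skip_iff exec_Const_iff exec_Arith_iff exec_Load_iff exec_Store_iff
  exec_Input_iff exec_Output_iff exec_Coin_iff)

text \<open>A weakest precondition for total correctness whose postcondition also sees the running
  time. With \<open>runs_simps\<close> the simplifier executes straight-line code
  symbolically.\<close>

definition runs :: "nat \<Rightarrow> (nat \<Rightarrow> bool) \<Rightarrow> (nat \<Rightarrow> nat) \<Rightarrow> com \<Rightarrow> state \<Rightarrow> (nat \<Rightarrow> state \<Rightarrow> bool) \<Rightarrow> bool" where
  "runs B coin inp c \<sigma> Q \<longleftrightarrow> (\<exists>t \<sigma>'. exec B coin inp c \<sigma> t \<sigma>' \<and> Q t \<sigma>')"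

lemma runs_mono: "runs B coin inp c \<sigma> Q \<Longrightarrow> (\<And>t \<sigma>'. Q t \<sigma>' \<Longrightarrow> Q' t \<sigma>') \<Longrightarrow> runs B coin inp c \<sigma> Q'"
  unfolding runs_def by blast

lemma runs_Skip: "runs B coin inp Skip \<sigma> Q \<longleftrightarrow> Q 1 \<sigma>"
  unfolding runs_def by (auto simp: exec_Skip_iff)

lemma runs_Const: "runs B coin inp (Const x k) \<sigma> Q \<longleftrightarrow> k \<le> B \<and> Q 1 (set_reg x k \<sigma>)"
  unfolding runs_def by (auto simp: exec_Const_iff)

lemma runs_Arith:
  "runs B coin inp (Arith f x y z) \<sigma> Q \<longleftrightarrow>
     arith_op f (reg \<sigma> y) (reg \<sigma> z) \<le> B \<and> Q 1 (set_reg x (arith_op f (reg \<sigma> y) (reg \<sigma> z)) \<sigma>)"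
  unfolding runs_def by (auto simp: exec_Arith_iff)

lemma runs_Load:
  "runs B coin inp (Load x y) \<sigma> Q \<longleftrightarrow> reg \<sigma> y \<le> B \<and> Q 1 (set_reg x (mem \<sigma> (reg \<sigma> y)) \<sigma>)"
  unfolding runs_def by (auto simp: exec_Load_iff)

lemma runs_Store:
  "runs B coin inp (Store x y) \<sigma> Q \<longleftrightarrow>
     reg \<sigma> x \<le> B \<and> Q 1 (\<sigma>\<lparr>mem := (mem \<sigma>)(reg \<sigma> x := reg \<sigma> y)\<rparr>)"
  unfolding runs_def by (auto simp: exec_Store_iff)

lemma runs_Input:
  "runs B coin inp (Input x y) \<sigma> Q \<longleftrightarrow>
     reg \<sigma> y \<le> B \<and> inp (reg \<sigma> y) \<le> B \<and> Q 1 (set_reg x (inp (reg \<sigma> y)) \<sigma>)"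
  unfolding runs_def by (auto simp: exec_Input_iff)

lemma runs_Output:
  "runs B coin inp (Output x y) \<sigma> Q \<longleftrightarrow>
     reg \<sigma> x \<le> B \<and> Q 1 (\<sigma>\<lparr>outp := (outp \<sigma>)(reg \<sigma> x := reg \<sigma> y)\<rparr>)"
  unfolding runs_def by (auto simp: exec_Output_iff)

lemma runs_Coin:
  "runs B coin inp (Coin x y) \<sigma> Q \<longleftrightarrow>
     reg \<sigma> y \<le> B \<and> Q 1 (set_reg x (of_bool (coin (reg \<sigma> y))) \<sigma>)"
  unfolding runs_def by (auto simp: exec_Coin_iff)

lemma runs_Seq:
  "runs B coin inp (Seq c1 c2) \<sigma> Q \<longleftrightarrow>
     runs B coin inp c1 \<sigma> (\<lambda>t \<sigma>'. runs B coin inp c2 \<sigma>' (\<lambda>u. Q (t + u)))"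
  unfolding runs_def by (auto simp: exec_Seq_iff) blast

lemma runs_If:
  "runs B coin inp (If x c1 c2) \<sigma> Q \<longleftrightarrow>
     (if reg \<sigma> x \<noteq> 0 then runs B coin inp c1 \<sigma> (\<lambda>t. Q (t + 1)) else runs B coin inp c2 \<sigma> (\<lambda>t. Q (t + 1)))"
  unfolding runs_def by (auto simp: exec_If_iff)

lemma runs_While_False: "reg \<sigma> x = 0 \<Longrightarrow> Q 1 \<sigma> \<Longrightarrow> runs B coin inp (While x c) \<sigma> Q"
  unfolding runs_def by (blast intro: exec.WhileFalse)

lemma runs_While_True:
  assumes "reg \<sigma> x \<noteq> 0"
    and "runs B coin inp c \<sigma> (\<lambda>t \<sigma>'. runs B coin inp (While x c) \<sigma>' (\<lambda>u. Q (t + u + 1)))"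
  shows "runs B coin inp (While x c) \<sigma> Q"
  using assms unfolding runs_def by (blast intro: exec.WhileTrue)

fun seqs :: "com list \<Rightarrow> com" where
  "seqs [] = Skip"
| "seqs (c # cs) = Seq c (seqs cs)"

lemmas runs_simps = runs_Skip runs_Const runs_Arith runs_Load runs_Store runs_Input runs_Output
  runs_Coin runs_Seq runs_If

text \<open>The programs below use the registers in a stack discipline: a subprogram leaves the registers
  below its level \<open>L\<close> alone.\<close>

definition agree :: "nat \<Rightarrow> state \<Rightarrow> state \<Rightarrow> bool" where
  "agree L \<sigma> \<tau> \<longleftrightarrow> (\<forall>x<L. reg \<tau> x = reg \<sigma> x)"

lemma agree_refl: "agree L \<sigma> \<sigma>"
  by (simp add: agree_def)

lemma agree_trans: "agree L \<sigma> \<tau> \<Longrightarrow> agree L' \<tau> \<upsilon> \<Longrightarrow> L \<le> L' \<Longrightarrow> agree L \<sigma> \<upsilon>"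
  by (simp add: agree_def)

lemma agree_mono: "agree L \<sigma> \<tau> \<Longrightarrow> L' \<le> L \<Longrightarrow> agree L' \<sigma> \<tau>"
  by (simp add: agree_def)

text \<open>A counting loop with counter \<open>L\<close> and flag \<open>L + 1\<close>; registers \<open>0\<close> and \<open>1\<close> hold these numbers.\<close>

definition For :: "nat \<Rightarrow> nat \<Rightarrow> com \<Rightarrow> com" where
  "For L y c =
     seqs [Arith Add L 0 0, Arith Less (L + 1) L y,
       While (L + 1) (seqs [c, Arith Add L L 1, Arith Less (L + 1) L y])]"

text \<open>The potential \<open>\<Phi>\<close> bounds the running time.\<close>

lemma runs_For:
  fixes J :: "nat \<Rightarrow> (nat \<Rightarrow> nat) \<Rightarrow> (nat \<Rightarrow> nat) \<Rightarrow> bool" and \<Phi> :: "nat \<Rightarrow> nat"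
  assumes reg: "reg \<sigma> 0 = 0" "reg \<sigma> 1 = 1" "2 \<le> L" "y < L" "reg \<sigma> y \<le> B" "1 \<le> B"
    and init: "J 0 (mem \<sigma>) (outp \<sigma>)"
    and step: "\<And>j \<tau>. j < reg \<sigma> y \<Longrightarrow> agree L \<sigma> \<tau> \<Longrightarrow> reg \<tau> L = j \<Longrightarrow> J j (mem \<tau>) (outp \<tau>) \<Longrightarrow>
      runs B coin inp c \<tau> (\<lambda>t \<tau>'. t + \<Phi> j + 4 \<le> \<Phi> (Suc j) \<and> agree (L + 2) \<tau> \<tau>' \<and> J (Suc j) (mem \<tau>') (outp \<tau>'))"
  shows "runs B coin inp (For L y c) \<sigma> (\<lambda>t \<tau>. t + \<Phi> 0 \<le> \<Phi> (reg \<sigma> y) + 4 \<and> agree L \<sigma> \<tau> \<and>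
           J (reg \<sigma> y) (mem \<tau>) (outp \<tau>))"
proof -
  let ?N = "reg \<sigma> y"
  let ?body = "seqs [c, Arith Add L L 1, Arith Less (L + 1) L y]"
  \<comment> \<open>Besides the time of \<open>c\<close>, a pass costs 4: the increment, the
    comparison, the closing \<open>Skip\<close> of the body and the \<open>While\<close> step. This
    is the 4 in the assumption on \<open>\<Phi>\<close>.\<close>
  have loop: "runs B coin inp (While (L + 1) ?body) \<tau> (\<lambda>t \<tau>'. t + \<Phi> j \<le> \<Phi> ?N + 1 \<and> agree L \<sigma> \<tau>' \<and>
      J ?N (mem \<tau>') (outp \<tau>'))"
    if "j \<le> ?N" "agree L \<sigma> \<tau>" "reg \<tau> L = j" "reg \<tau> (L + 1) = of_bool (j < ?N)" "J j (mem \<tau>) (outp \<tau>)"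
    for j \<tau>
    using that
  proof (induction "?N - j" arbitrary: j \<tau>)
    case 0
    then show ?case by (intro runs_While_False) auto
  next
    case (Suc d)
    then have lt: "j < ?N" by simp
    have "runs B coin inp c \<tau> (\<lambda>t \<tau>'. runs B coin inp (seqs [Arith Add L L 1, Arith Less (L + 1) L y]) \<tau>'
        (\<lambda>u \<upsilon>. runs B coin inp (While (L + 1) ?body) \<upsilon>
          (\<lambda>v \<tau>''. t + u + v + 1 + \<Phi> j \<le> \<Phi> ?N + 1 \<and> agree L \<sigma> \<tau>'' \<and> J ?N (mem \<tau>'') (outp \<tau>''))))"
    proof (rule runs_mono[OF step[OF lt Suc.prems(2,3,5)]], elim conjE)
      fix t \<tau>' assume t: "t + \<Phi> j + 4 \<le> \<Phi> (Suc j)" and ag: "agree (L + 2) \<tau> \<tau>'"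
        and J: "J (Suc j) (mem \<tau>') (outp \<tau>')"
      have r: "reg \<tau>' L = j" "reg \<tau>' 1 = 1" "reg \<tau>' y = ?N" "\<And>x. x < L \<Longrightarrow> reg \<tau>' x = reg \<sigma> x"
        using ag Suc.prems reg by (auto simp: agree_def)
      have "runs B coin inp (While (L + 1) ?body) (set_reg (L + 1) (of_bool (Suc j < ?N)) (set_reg L (Suc j) \<tau>'))
          (\<lambda>v \<tau>''. v + \<Phi> (Suc j) \<le> \<Phi> ?N + 1 \<and> agree L \<sigma> \<tau>'' \<and> J ?N (mem \<tau>'') (outp \<tau>''))"
        by (rule Suc.hyps(1)) (use Suc.hyps(2) lt r J in \<open>auto simp: agree_def set_reg_def\<close>)
      then have "runs B coin inp (While (L + 1) ?body) (set_reg (L + 1) (of_bool (Suc j < ?N)) (set_reg L (Suc j) \<tau>'))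
          (\<lambda>v \<tau>''. t + 3 + v + 1 + \<Phi> j \<le> \<Phi> ?N + 1 \<and> agree L \<sigma> \<tau>'' \<and> J ?N (mem \<tau>'') (outp \<tau>''))"
        by (rule runs_mono) (use t in auto)
      then show "runs B coin inp (seqs [Arith Add L L 1, Arith Less (L + 1) L y]) \<tau>'
        (\<lambda>u \<upsilon>. runs B coin inp (While (L + 1) ?body) \<upsilon>
          (\<lambda>v \<tau>''. t + u + v + 1 + \<Phi> j \<le> \<Phi> ?N + 1 \<and> agree L \<sigma> \<tau>'' \<and> J ?N (mem \<tau>'') (outp \<tau>'')))"
        using lt r reg by (simp add: runs_simps set_reg_def eval_nat_numeral)
    qed
    then have "runs B coin inp ?body \<tau> (\<lambda>t \<tau>'. runs B coin inp (While (L + 1) ?body) \<tau>'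
          (\<lambda>v \<tau>''. t + v + 1 + \<Phi> j \<le> \<Phi> ?N + 1 \<and> agree L \<sigma> \<tau>'' \<and> J ?N (mem \<tau>'') (outp \<tau>'')))"
      by (simp add: runs_Seq)
    then show ?case
      by (rule runs_While_True[rotated]) (use Suc.prems lt in auto)
  qed
  have "runs B coin inp (While (L + 1) ?body) (set_reg (L + 1) (of_bool (0 < ?N)) (set_reg L 0 \<sigma>))
     (\<lambda>t \<tau>'. t + \<Phi> 0 \<le> \<Phi> ?N + 1 \<and> agree L \<sigma> \<tau>' \<and> J ?N (mem \<tau>') (outp \<tau>'))"
    by (rule loop) (use init in \<open>auto simp: agree_def set_reg_def\<close>)
  then have "runs B coin inp (While (L + 1) ?body) (set_reg (L + 1) (of_bool (0 < ?N)) (set_reg L 0 \<sigma>))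
     (\<lambda>t \<tau>'. Suc (Suc (Suc t)) + \<Phi> 0 \<le> \<Phi> ?N + 4 \<and> agree L \<sigma> \<tau>' \<and> J ?N (mem \<tau>') (outp \<tau>'))"
    by (rule runs_mono) auto
  then show ?thesis
    using reg unfolding For_def by (auto simp: runs_simps set_reg_def)
qed

primrec power_code :: "nat \<Rightarrow> nat \<Rightarrow> nat \<Rightarrow> com" where
  "power_code x y 0 = Const x 1"
| "power_code x y (Suc k) = Seq (power_code x y k) (Arith Mul x x y)"

text \<open>The lower bound on the base makes the powers increase, so every intermediate result fits
  as soon as the last one does.\<close>

lemma runs_power_code:
  assumes "reg \<sigma> y ^ k \<le> B" "x \<noteq> y" "1 \<le> reg \<sigma> y"
  shows "runs B coin inp (power_code x y k) \<sigma> (\<lambda>t \<tau>. t = k + 1 \<and> \<tau> = set_reg x (reg \<sigma> y ^ k) \<sigma>)"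
  using assms(1)
proof (induction k)
  case 0
  then show ?case by (simp add: runs_simps)
next
  case (Suc k)
  have le: "reg \<sigma> y ^ k \<le> B"
    using Suc.prems assms(3) by (meson le_SucI le_refl le_trans power_increasing)
  have *: "reg \<sigma> y ^ k * reg \<sigma> y \<le> B"
    using Suc.prems by (simp add: mult.commute)
  show ?case unfolding power_code.simps runs_Seq
  proof (rule runs_mono[OF Suc.IH[OF le]], elim conjE)
    fix t \<tau> assume "t = k + 1" "\<tau> = set_reg x (reg \<sigma> y ^ k) \<sigma>"
    then show "runs B coin inp (Arith Mul x x y) \<tau>
        (\<lambda>u \<tau>. t + u = Suc k + 1 \<and> \<tau> = set_reg x (reg \<sigma> y ^ Suc k) \<sigma>)"
      using * assms(2) by (simp add: runs_Arith) (simp add: set_reg_def mult.commute)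
  qed
qed

section \<open>Online computations as functions of the calls\<close>

definition init_state :: "(nat \<Rightarrow> nat) \<Rightarrow> state" where
  "init_state \<mu> = \<lparr>reg = (\<lambda>_. 0), mem = \<mu>, outp = (\<lambda>_. 0)\<rparr>"

type_synonym call = "com \<times> (nat \<Rightarrow> nat)"

definition halts :: "nat \<Rightarrow> (nat \<Rightarrow> bool) \<Rightarrow> (nat \<Rightarrow> nat) \<Rightarrow> call \<Rightarrow> bool" where
  "halts B coin \<mu> call \<longleftrightarrow> (\<exists>t \<sigma>. exec B coin (snd call) (fst call) (init_state \<mu>) t \<sigma>)"

text \<open>Meaningful only for calls that halt; \<open>halts_exec\<close> then recovers the
  execution.\<close>

definition call_result :: "nat \<Rightarrow> (nat \<Rightarrow> bool) \<Rightarrow> (nat \<Rightarrow> nat) \<Rightarrow> call \<Rightarrow> nat \<times> state" where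
  "call_result B coin \<mu> call =
     (SOME r. exec B coin (snd call) (fst call) (init_state \<mu>) (fst r) (snd r))"

definition call_time :: "nat \<Rightarrow> (nat \<Rightarrow> bool) \<Rightarrow> (nat \<Rightarrow> nat) \<Rightarrow> call \<Rightarrow> nat" where
  "call_time B coin \<mu> call = fst (call_result B coin \<mu> call)"

definition call_mem :: "nat \<Rightarrow> (nat \<Rightarrow> bool) \<Rightarrow> (nat \<Rightarrow> nat) \<Rightarrow> call \<Rightarrow> nat \<Rightarrow> nat" where
  "call_mem B coin \<mu> call = mem (snd (call_result B coin \<mu> call))"

definition call_out :: "nat \<Rightarrow> (nat \<Rightarrow> bool) \<Rightarrow> (nat \<Rightarrow> nat) \<Rightarrow> call \<Rightarrow> nat \<Rightarrow> nat" where
  "call_out B coin \<mu> call = outp (snd (call_result B coin \<mu> call))"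

lemma call_result_eqI:
  assumes "exec B coin (snd call) (fst call) (init_state \<mu>) t \<sigma>"
  shows "call_result B coin \<mu> call = (t, \<sigma>)"
  unfolding call_result_def
proof (rule some_equality)
  show "exec B coin (snd call) (fst call) (init_state \<mu>) (fst (t, \<sigma>)) (snd (t, \<sigma>))"
    using assms by simp
next
  fix r assume "exec B coin (snd call) (fst call) (init_state \<mu>) (fst r) (snd r)"
  from exec_deterministic[OF assms this] show "r = (t, \<sigma>)" by (simp add: prod_eq_iff)
qed

lemma halts_exec:
  assumes "halts B coin \<mu> call"
  obtains \<sigma> where "exec B coin (snd call) (fst call) (init_state \<mu>) (call_time B coin \<mu> call) \<sigma>"
    "mem \<sigma> = call_mem B coin \<mu> call" "outp \<sigma> = call_out B coin \<mu> call"
proof -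
  from assms obtain t \<sigma> where e: "exec B coin (snd call) (fst call) (init_state \<mu>) t \<sigma>"
    unfolding halts_def by blast
  then show ?thesis
    by (intro that[of \<sigma>]) (simp_all add: call_time_def call_mem_def call_out_def call_result_eqI)
qed

fun mem_after :: "nat \<Rightarrow> (nat \<Rightarrow> bool) \<Rightarrow> (nat \<Rightarrow> nat) \<Rightarrow> call list \<Rightarrow> nat \<Rightarrow> nat" where
  "mem_after B coin \<mu> [] = \<mu>"
| "mem_after B coin \<mu> (call # calls) = mem_after B coin (call_mem B coin \<mu> call) calls"

fun results :: "nat \<Rightarrow> (nat \<Rightarrow> bool) \<Rightarrow> (nat \<Rightarrow> nat) \<Rightarrow> call list \<Rightarrow> (nat \<times> (nat \<Rightarrow> nat)) list" where
  "results B coin \<mu> [] = []"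
| "results B coin \<mu> (call # calls) =
     (call_time B coin \<mu> call, call_out B coin \<mu> call) # results B coin (call_mem B coin \<mu> call) calls"

fun all_halt :: "nat \<Rightarrow> (nat \<Rightarrow> bool) \<Rightarrow> (nat \<Rightarrow> nat) \<Rightarrow> call list \<Rightarrow> bool" where
  "all_halt B coin \<mu> [] \<longleftrightarrow> True"
| "all_halt B coin \<mu> (call # calls) \<longleftrightarrow>
     halts B coin \<mu> call \<and> all_halt B coin (call_mem B coin \<mu> call) calls"

lemma mem_after_append:
  "mem_after B coin \<mu> (xs @ ys) = mem_after B coin (mem_after B coin \<mu> xs) ys"
  by (induction xs arbitrary: \<mu>) auto

lemma results_append:
  "results B coin \<mu> (xs @ ys) = results B coin \<mu> xs @ results B coin (mem_after B coin \<mu> xs) ys"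
  by (induction xs arbitrary: \<mu>) auto

lemma all_halt_append:
  "all_halt B coin \<mu> (xs @ ys) \<longleftrightarrow> all_halt B coin \<mu> xs \<and> all_halt B coin (mem_after B coin \<mu> xs) ys"
  by (induction xs arbitrary: \<mu>) auto

lemma length_results: "length (results B coin \<mu> calls) = length calls"
  by (induction calls arbitrary: \<mu>) auto

inductive_cases serve_NilE: "serve B coin \<mu> [] rs"
inductive_cases serve_ConsE: "serve B coin \<mu> (call # calls) rs"

text \<open>By determinism, statements about some \<open>rs\<close> become statements about the
  function \<open>results\<close> together with halting.\<close>

lemma serve_iff: "serve B coin \<mu> calls rs \<longleftrightarrow> rs = results B coin \<mu> calls \<and> all_halt B coin \<mu> calls"
proof (induction calls arbitrary: \<mu> rs)
  case Nil
  then show ?case by (auto elim: serve_NilE intro: serve.intros)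
next
  case (Cons call calls)
  obtain c inp where call: "call = (c, inp)" by (cases call)
  show ?case
  proof
    assume "serve B coin \<mu> (call # calls) rs"
    then obtain t \<sigma> rs' where "exec B coin inp c (init_state \<mu>) t \<sigma>" "serve B coin (mem \<sigma>) calls rs'"
      "rs = (t, outp \<sigma>) # rs'"
      unfolding call init_state_def by (rule serve_ConsE) auto
    moreover from this(1) have "call_result B coin \<mu> call = (t, \<sigma>)"
      by (simp add: call_result_eqI call)
    ultimately show "rs = results B coin \<mu> (call # calls) \<and> all_halt B coin \<mu> (call # calls)"
      using Cons.IH[of "mem \<sigma>" rs']
      by (auto simp: call_time_def call_mem_def call_out_def halts_def call)
  next
    assume r: "rs = results B coin \<mu> (call # calls) \<and> all_halt B coin \<mu> (call # calls)"
    then have "halts B coin \<mu> call" by simp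
    then obtain \<sigma> where s: "exec B coin (snd call) (fst call) (init_state \<mu>) (call_time B coin \<mu> call) \<sigma>"
      "mem \<sigma> = call_mem B coin \<mu> call" "outp \<sigma> = call_out B coin \<mu> call"
      by (rule halts_exec)
    have "serve B coin (mem \<sigma>) calls (results B coin (call_mem B coin \<mu> call) calls)"
      using Cons.IH r s(2) by simp
    from serve.Cons[OF s(1)[unfolded init_state_def] this]
    show "serve B coin \<mu> (call # calls) rs"
      using r s(3) by (simp add: call)
  qed
qed

lemma ex_serve_iff:
  "(\<exists>rs. serve B coin \<mu> calls rs \<and> P rs) \<longleftrightarrow> all_halt B coin \<mu> calls \<and> P (results B coin \<mu> calls)"
  by (auto simp: serve_iff)

definition total_time :: "nat \<Rightarrow> (nat \<Rightarrow> bool) \<Rightarrow> call list \<Rightarrow> nat" where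
  "total_time B coin calls = sum_list (map fst (results B coin (\<lambda>_. 0) calls))"

lemma total_time_Nil: "total_time B coin [] = 0"
  by (simp add: total_time_def)

lemma total_time_snoc:
  "total_time B coin (calls @ [call]) =
     total_time B coin calls + call_time B coin (mem_after B coin (\<lambda>_. 0) calls) call"
  by (simp add: total_time_def results_append)

lemma total_time_append_ge: "total_time B coin xs \<le> total_time B coin (xs @ ys)"
  by (simp add: total_time_def results_append)

section \<open>Simulating a program on a shared memory\<close>

text \<open>The memory of the simulated program is an overlay at address \<open>reg 32\<close> over a base at
  address \<open>reg 33\<close>. Cells hold the successor of the simulated value, and an overlay cell containing
  zero refers to the base. A fresh overlay therefore rewinds the simulated memory to the base at no
  cost. Registers \<open>34\<close> and \<open>35\<close> hold the addresses of the random bits and of the input, register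
  \<open>50\<close> collects the output at address zero, and register \<open>x\<close> of the simulated program is \<open>x + 60\<close>.\<close>

fun simulate :: "com \<Rightarrow> com" where
  "simulate Skip = Skip"
| "simulate (Const x k) = Const (x + 60) k"
| "simulate (Arith f x y z) = Arith f (x + 60) (y + 60) (z + 60)"
| "simulate (Load x y) = seqs [Arith Add 51 32 (y + 60), Load 52 51,
     If 52 Skip (seqs [Arith Add 51 33 (y + 60), Load 52 51]), Arith Sub (x + 60) 52 1]"
| "simulate (Store x y) = seqs [Arith Add 51 32 (x + 60), Arith Add 52 (y + 60) 1, Store 51 52]"
| "simulate (Input x y) = seqs [Arith Add 51 35 (y + 60), Load (x + 60) 51]"
| "simulate (Output x y) = If (x + 60) Skip (Arith Add 50 (y + 60) 0)"
| "simulate (Coin x y) = seqs [Arith Add 51 34 (y + 60), Coin (x + 60) 51]"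
| "simulate (Seq c d) = Seq (simulate c) (simulate d)"
| "simulate (If x c d) = If (x + 60) (simulate c) (simulate d)"
| "simulate (While x c) = While (x + 60) (simulate c)"

fun reg_bound :: "com \<Rightarrow> nat" where
  "reg_bound Skip = 0"
| "reg_bound (Const x k) = Suc x"
| "reg_bound (Arith f x y z) = Suc (max x (max y z))"
| "reg_bound (Load x y) = Suc (max x y)"
| "reg_bound (Store x y) = Suc (max x y)"
| "reg_bound (Input x y) = Suc (max x y)"
| "reg_bound (Output x y) = Suc (max x y)"
| "reg_bound (Coin x y) = Suc (max x y)"
| "reg_bound (Seq c d) = max (reg_bound c) (reg_bound d)"
| "reg_bound (If x c d) = max (Suc x) (max (reg_bound c) (reg_bound d))"
| "reg_bound (While x c) = max (Suc x) (reg_bound c)"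

text \<open>On natural numbers \<open>0 - 1 = 0\<close>, so memory that was never written stands for
  the all-zero memory from which a simulated computation starts.\<close>

definition overlay :: "(nat \<Rightarrow> nat) \<Rightarrow> nat \<Rightarrow> nat \<Rightarrow> nat \<Rightarrow> nat" where
  "overlay \<mu> a b i = (if \<mu> (a + i) \<noteq> 0 then \<mu> (a + i) else \<mu> (b + i)) - 1"

definition simulates :: "nat \<Rightarrow> nat \<Rightarrow> state \<Rightarrow> state \<Rightarrow> state \<Rightarrow> bool" where
  "simulates V m \<tau>0 \<sigma> \<tau> \<longleftrightarrow>
     (\<forall>x<m. reg \<tau> (x + 60) = reg \<sigma> x \<and> reg \<sigma> x \<le> V) \<and>
     (\<forall>a\<le>V. overlay (mem \<tau>) (reg \<tau>0 32) (reg \<tau>0 33) a = mem \<sigma> a \<and> mem \<sigma> a \<le> V) \<and>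
     (\<forall>a. a < reg \<tau>0 32 \<or> reg \<tau>0 32 + V < a \<longrightarrow> mem \<tau> a = mem \<tau>0 a) \<and>
     agree 50 \<tau>0 \<tau> \<and> outp \<tau> = outp \<tau>0 \<and> reg \<tau> 50 = outp \<sigma> 0"

text \<open>The simulated program respects the word bound \<open>V\<close>, so its accesses stay
  inside windows of \<open>V + 1\<close> cells, and the invariant that registers and cells are at
  most \<open>V\<close> keeps the successor encoding within \<open>B\<close>. The factor 8 is the
  cost of a \<open>Load\<close> that misses the overlay. The case of equal overlay and base
  addresses serves the preprocessing, which writes the base itself.\<close>

lemma runs_simulate:
  assumes e: "exec V coin' inp' c \<sigma> t \<sigma>'" and rb: "reg_bound c \<le> m" and sim: "simulates V m \<tau>0 \<sigma> \<tau>"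
    and V: "1 \<le> V" "V + 1 \<le> B" "reg \<tau>0 32 + V \<le> B" "reg \<tau>0 33 + V \<le> B" "reg \<tau>0 34 + V \<le> B"
      "reg \<tau>0 35 + V \<le> B"
    and one: "reg \<tau>0 0 = 0" "reg \<tau>0 1 = 1"
    and sep: "reg \<tau>0 33 = reg \<tau>0 32 \<or> reg \<tau>0 32 + V < reg \<tau>0 33 \<or> reg \<tau>0 33 + V < reg \<tau>0 32"
      "reg \<tau>0 32 + V < reg \<tau>0 35 \<or> reg \<tau>0 35 + V < reg \<tau>0 32"
    and inp: "\<And>a. a \<le> V \<Longrightarrow> mem \<tau>0 (reg \<tau>0 35 + a) = inp' a"
    and coin: "\<And>a. a \<le> V \<Longrightarrow> coin (reg \<tau>0 34 + a) = coin' a"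
  shows "runs B coin inp (simulate c) \<tau> (\<lambda>u \<tau>'. u \<le> 8 * t \<and> simulates V m \<tau>0 \<sigma>' \<tau>')"
  using e rb sim
proof (induction arbitrary: \<tau> rule: exec.induct)
  case (Skip \<sigma>)
  then show ?case by (simp add: runs_simps)
next
  case (Const k x \<sigma>)
  then show ?case using V by (auto simp: runs_simps simulates_def agree_def set_reg_def)
next
  case (Arith a f \<sigma> y z x)
  then show ?case using V by (auto simp: runs_simps simulates_def agree_def set_reg_def)
next
  case (Load \<sigma> y x)
  then have r: "reg \<tau> (y + 60) = reg \<sigma> y" "reg \<tau> 32 = reg \<tau>0 32" "reg \<tau> 33 = reg \<tau>0 33" "reg \<tau> 1 = 1"
    using one by (auto simp: simulates_def agree_def)
  have v: "overlay (mem \<tau>) (reg \<tau>0 32) (reg \<tau>0 33) (reg \<sigma> y) = mem \<sigma> (reg \<sigma> y)" "mem \<sigma> (reg \<sigma> y) \<le> V"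
    using Load by (auto simp: simulates_def)
  have b: "reg \<tau>0 32 + reg \<sigma> y \<le> B" "reg \<tau>0 33 + reg \<sigma> y \<le> B" "mem \<sigma> (reg \<sigma> y) \<le> B"
    using Load.hyps V v by auto
  define \<tau>' where "\<tau>' = (if mem \<tau> (reg \<tau>0 32 + reg \<sigma> y) \<noteq> 0
    then set_reg (x + 60) (mem \<sigma> (reg \<sigma> y)) (set_reg 52 (mem \<tau> (reg \<tau>0 32 + reg \<sigma> y)) (set_reg 51 (reg \<tau>0 32 + reg \<sigma> y) \<tau>))
    else set_reg (x + 60) (mem \<sigma> (reg \<sigma> y)) (set_reg 52 (mem \<tau> (reg \<tau>0 33 + reg \<sigma> y)) (set_reg 51 (reg \<tau>0 33 + reg \<sigma> y)
       (set_reg 52 0 (set_reg 51 (reg \<tau>0 32 + reg \<sigma> y) \<tau>)))))"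
  have "simulates V m \<tau>0 (set_reg x (mem \<sigma> (reg \<sigma> y)) \<sigma>) \<tau>'"
    using Load v unfolding simulates_def \<tau>'_def by (auto simp: agree_def set_reg_def)
  moreover have "runs B coin inp (simulate (Load x y)) \<tau> (\<lambda>u \<upsilon>. u \<le> 8 \<and> \<upsilon> = \<tau>')"
    using r v b unfolding \<tau>'_def by (auto simp: runs_simps set_reg_def overlay_def)
  ultimately show ?case by (auto elim!: runs_mono)
next
  case (Store \<sigma> x y)
  then have r: "reg \<tau> (x + 60) = reg \<sigma> x" "reg \<tau> (y + 60) = reg \<sigma> y" "reg \<sigma> y \<le> V" "reg \<tau> 32 = reg \<tau>0 32" "reg \<tau> 1 = 1"
    using one by (auto simp: simulates_def agree_def)
  \<comment> \<open>The stored successor is nonzero, so this cell hides the base from now on; by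
    \<open>sep\<close> the write affects no other simulated cell.\<close>
  have ov: "overlay ((mem \<tau>)(reg \<tau>0 32 + reg \<sigma> x := Suc (reg \<sigma> y))) (reg \<tau>0 32) (reg \<tau>0 33) a =
     (if a = reg \<sigma> x then reg \<sigma> y else overlay (mem \<tau>) (reg \<tau>0 32) (reg \<tau>0 33) a)" if "a \<le> V" for a
    using sep(1) that Store.hyps by (auto simp: overlay_def)
  have b: "reg \<tau>0 32 + reg \<sigma> x \<le> B" "Suc (reg \<sigma> y) \<le> B"
    using Store.hyps V r by auto
  define \<tau>' where "\<tau>' = (set_reg 52 (Suc (reg \<sigma> y)) (set_reg 51 (reg \<tau>0 32 + reg \<sigma> x) \<tau>))
    \<lparr>mem := (mem \<tau>)(reg \<tau>0 32 + reg \<sigma> x := Suc (reg \<sigma> y))\<rparr>"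
  have "simulates V m \<tau>0 (\<sigma>\<lparr>mem := (mem \<sigma>)(reg \<sigma> x := reg \<sigma> y)\<rparr>) \<tau>'"
    using Store.prems Store.hyps r unfolding simulates_def \<tau>'_def by (auto simp: agree_def set_reg_def ov) (use Store.hyps in linarith)
  moreover have "runs B coin inp (simulate (Store x y)) \<tau> (\<lambda>u \<upsilon>. u \<le> 8 \<and> \<upsilon> = \<tau>')"
    using r b unfolding \<tau>'_def by (auto simp: runs_simps set_reg_def)
  ultimately show ?case by (auto elim!: runs_mono)
next
  case (Input \<sigma> y x)
  then have r: "reg \<tau> (y + 60) = reg \<sigma> y" "reg \<tau> 35 = reg \<tau>0 35"
    by (auto simp: simulates_def agree_def)
  have b: "reg \<tau>0 35 + reg \<sigma> y \<le> B" using Input.hyps V by auto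
  have "reg \<tau>0 35 + reg \<sigma> y < reg \<tau>0 32 \<or> reg \<tau>0 32 + V < reg \<tau>0 35 + reg \<sigma> y"
    using sep(2) Input.hyps by auto
  then have "mem \<tau> (reg \<tau>0 35 + reg \<sigma> y) = inp' (reg \<sigma> y)"
    using Input inp[OF Input.hyps(1)] unfolding simulates_def by auto
  then show ?case using b r Input
    by (auto simp: runs_simps set_reg_def simulates_def agree_def)
next
  case (Output \<sigma> x y)
  then have r: "reg \<tau> (x + 60) = reg \<sigma> x" "reg \<tau> (y + 60) = reg \<sigma> y" "reg \<sigma> y \<le> V" "reg \<tau> 0 = 0"
    using one by (auto simp: simulates_def agree_def)
  moreover have "reg \<sigma> y \<le> B" using r V by simp
  ultimately show ?case using Output
    by (auto simp: runs_simps set_reg_def simulates_def agree_def)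
next
  case (Coin \<sigma> y x)
  then have r: "reg \<tau> (y + 60) = reg \<sigma> y" "reg \<tau> 34 = reg \<tau>0 34"
    by (auto simp: simulates_def agree_def)
  have "reg \<tau>0 34 + reg \<sigma> y \<le> B" using Coin.hyps V by auto
  then show ?case using V(1) r Coin coin[OF Coin.hyps(1)]
    by (auto simp: runs_simps set_reg_def simulates_def agree_def)
next
  case (Seq c1 \<sigma> t1 \<sigma>1 c2 t2 \<sigma>2)
  have "runs B coin inp (simulate c1) \<tau> (\<lambda>u \<tau>'. u \<le> 8 * t1 \<and> simulates V m \<tau>0 \<sigma>1 \<tau>')"
    using Seq by auto
  then show ?case unfolding simulate.simps runs_Seq
  proof (rule runs_mono, elim conjE)
    fix u \<tau>' assume u: "u \<le> 8 * t1" and "simulates V m \<tau>0 \<sigma>1 \<tau>'"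
    then have "runs B coin inp (simulate c2) \<tau>' (\<lambda>u \<tau>'. u \<le> 8 * t2 \<and> simulates V m \<tau>0 \<sigma>2 \<tau>')"
      using Seq by auto
    then show "runs B coin inp (simulate c2) \<tau>' (\<lambda>v \<tau>'. u + v \<le> 8 * (t1 + t2) \<and> simulates V m \<tau>0 \<sigma>2 \<tau>')"
      by (rule runs_mono) (use u in auto)
  qed
next
  case (IfTrue \<sigma> x c1 t \<sigma>' c2)
  then have "runs B coin inp (simulate c1) \<tau> (\<lambda>u \<tau>'. u \<le> 8 * t \<and> simulates V m \<tau>0 \<sigma>' \<tau>')"
    by auto
  then have "runs B coin inp (simulate c1) \<tau> (\<lambda>u \<tau>'. u + 1 \<le> 8 * (t + 1) \<and> simulates V m \<tau>0 \<sigma>' \<tau>')"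
    by (rule runs_mono) auto
  moreover have "reg \<tau> (x + 60) = reg \<sigma> x" using IfTrue by (auto simp: simulates_def)
  ultimately show ?case using IfTrue.hyps(1) by (simp add: runs_If)
next
  case (IfFalse \<sigma> x c2 t \<sigma>' c1)
  then have "runs B coin inp (simulate c2) \<tau> (\<lambda>u \<tau>'. u \<le> 8 * t \<and> simulates V m \<tau>0 \<sigma>' \<tau>')"
    by auto
  then have "runs B coin inp (simulate c2) \<tau> (\<lambda>u \<tau>'. u + 1 \<le> 8 * (t + 1) \<and> simulates V m \<tau>0 \<sigma>' \<tau>')"
    by (rule runs_mono) auto
  moreover have "reg \<tau> (x + 60) = reg \<sigma> x" using IfFalse by (auto simp: simulates_def)
  ultimately show ?case using IfFalse.hyps(1) by (simp add: runs_If)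
next
  case (WhileFalse \<sigma> x c)
  then have "reg \<tau> (x + 60) = reg \<sigma> x" by (auto simp: simulates_def)
  then show ?case unfolding simulate.simps by (intro runs_While_False) (use WhileFalse in auto)
next
  case (WhileTrue \<sigma> x c t1 \<sigma>1 t2 \<sigma>2)
  have x: "reg \<tau> (x + 60) = reg \<sigma> x" using WhileTrue by (auto simp: simulates_def)
  have "runs B coin inp (simulate c) \<tau> (\<lambda>u \<tau>'. u \<le> 8 * t1 \<and> simulates V m \<tau>0 \<sigma>1 \<tau>')"
    using WhileTrue by auto
  then have "runs B coin inp (simulate c) \<tau> (\<lambda>u \<tau>'. runs B coin inp (While (x + 60) (simulate c)) \<tau>'
      (\<lambda>v \<tau>'. u + v + 1 \<le> 8 * (t1 + t2 + 1) \<and> simulates V m \<tau>0 \<sigma>2 \<tau>'))"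
  proof (rule runs_mono, elim conjE)
    fix u \<tau>' assume u: "u \<le> 8 * t1" and "simulates V m \<tau>0 \<sigma>1 \<tau>'"
    then have "runs B coin inp (simulate (While x c)) \<tau>' (\<lambda>u \<tau>'. u \<le> 8 * t2 \<and> simulates V m \<tau>0 \<sigma>2 \<tau>')"
      using WhileTrue by auto
    then show "runs B coin inp (While (x + 60) (simulate c)) \<tau>'
        (\<lambda>v \<tau>'. u + v + 1 \<le> 8 * (t1 + t2 + 1) \<and> simulates V m \<tau>0 \<sigma>2 \<tau>')"
      unfolding simulate.simps by (rule runs_mono) (use u in auto)
  qed
  then show ?case unfolding simulate.simps
    by (intro runs_While_True) (use x WhileTrue.hyps(1) in auto)
qed

text \<open>A simulated call must start with zero registers, but the values of the previous
  simulated call are still there. The program is fixed, so clearing the registers that occur in it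
  takes constant time.\<close>

primrec clear_code :: "nat \<Rightarrow> com" where
  "clear_code 0 = Const 50 0"
| "clear_code (Suc m) = Seq (clear_code m) (Const (m + 60) 0)"

lemma runs_clear_code:
  "runs B coin inp (clear_code m) \<tau> (\<lambda>t \<tau>'. t = m + 1 \<and> agree 50 \<tau> \<tau>' \<and> mem \<tau>' = mem \<tau> \<and>
     outp \<tau>' = outp \<tau> \<and> reg \<tau>' 50 = 0 \<and> (\<forall>x<m. reg \<tau>' (x + 60) = 0))"
proof (induction m)
  case 0
  then show ?case by (simp add: runs_simps set_reg_def agree_def)
next
  case (Suc m)
  show ?case unfolding clear_code.simps runs_Seq
    by (rule runs_mono[OF Suc.IH]) (auto simp: runs_Const set_reg_def agree_def less_Suc_eq)
qed

definition simulate_call :: "com \<Rightarrow> com" where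
  "simulate_call c = Seq (clear_code (reg_bound c)) (simulate c)"

lemma runs_simulate_call:
  assumes h: "halts V coin' \<mu> (c, inp')"
    and mem: "\<And>a. a \<le> V \<Longrightarrow> overlay (mem \<tau>) (reg \<tau> 32) (reg \<tau> 33) a = \<mu> a"
      "\<And>a. a \<le> V \<Longrightarrow> \<mu> a \<le> V"
    and V: "1 \<le> V" "V + 1 \<le> B" "reg \<tau> 32 + V \<le> B" "reg \<tau> 33 + V \<le> B" "reg \<tau> 34 + V \<le> B"
      "reg \<tau> 35 + V \<le> B"
    and one: "reg \<tau> 0 = 0" "reg \<tau> 1 = 1"
    and sep: "reg \<tau> 33 = reg \<tau> 32 \<or> reg \<tau> 32 + V < reg \<tau> 33 \<or> reg \<tau> 33 + V < reg \<tau> 32"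
      "reg \<tau> 32 + V < reg \<tau> 35 \<or> reg \<tau> 35 + V < reg \<tau> 32"
    and inp: "\<And>a. a \<le> V \<Longrightarrow> mem \<tau> (reg \<tau> 35 + a) = inp' a"
    and coin: "\<And>a. a \<le> V \<Longrightarrow> coin (reg \<tau> 34 + a) = coin' a"
  shows "runs B coin inp (simulate_call c) \<tau> (\<lambda>t \<tau>'.
      t \<le> 8 * call_time V coin' \<mu> (c, inp') + reg_bound c + 1 \<and>
      (\<forall>a\<le>V. overlay (mem \<tau>') (reg \<tau> 32) (reg \<tau> 33) a = call_mem V coin' \<mu> (c, inp') a \<and>
        call_mem V coin' \<mu> (c, inp') a \<le> V) \<and>
      (\<forall>a. a < reg \<tau> 32 \<or> reg \<tau> 32 + V < a \<longrightarrow> mem \<tau>' a = mem \<tau> a) \<and>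
      agree 50 \<tau> \<tau>' \<and> outp \<tau>' = outp \<tau> \<and> reg \<tau>' 50 = call_out V coin' \<mu> (c, inp') 0)"
proof -
  let ?m = "reg_bound c"
  from h obtain \<sigma> where s: "exec V coin' inp' c (init_state \<mu>) (call_time V coin' \<mu> (c, inp')) \<sigma>"
    "mem \<sigma> = call_mem V coin' \<mu> (c, inp')" "outp \<sigma> = call_out V coin' \<mu> (c, inp')"
    by (rule halts_exec) auto
  show ?thesis
    unfolding simulate_call_def runs_Seq
  proof (rule runs_mono[OF runs_clear_code], elim conjE)
    fix t \<tau>1 assume t: "t = ?m + 1" "agree 50 \<tau> \<tau>1" "mem \<tau>1 = mem \<tau>" "outp \<tau>1 = outp \<tau>"
      "reg \<tau>1 50 = 0" "\<forall>x<?m. reg \<tau>1 (x + 60) = 0"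
    have sim: "simulates V ?m \<tau> (init_state \<mu>) \<tau>1"
      using t mem by (auto simp: simulates_def init_state_def)
    have "runs B coin inp (simulate c) \<tau>1
      (\<lambda>u \<tau>'. u \<le> 8 * call_time V coin' \<mu> (c, inp') \<and> simulates V ?m \<tau> \<sigma> \<tau>')"
      by (rule runs_simulate[OF s(1) order_refl sim V one sep inp coin])
    then show "runs B coin inp (simulate c) \<tau>1 (\<lambda>u \<tau>'.
      t + u \<le> 8 * call_time V coin' \<mu> (c, inp') + ?m + 1 \<and>
      (\<forall>a\<le>V. overlay (mem \<tau>') (reg \<tau> 32) (reg \<tau> 33) a = call_mem V coin' \<mu> (c, inp') a \<and>
        call_mem V coin' \<mu> (c, inp') a \<le> V) \<and>
      (\<forall>a. a < reg \<tau> 32 \<or> reg \<tau> 32 + V < a \<longrightarrow> mem \<tau>' a = mem \<tau> a) \<and>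
      agree 50 \<tau> \<tau>' \<and> outp \<tau>' = outp \<tau> \<and> reg \<tau>' 50 = call_out V coin' \<mu> (c, inp') 0)"
      by (rule runs_mono) (use t s in \<open>auto simp: simulates_def\<close>)
  qed
qed

section \<open>Dominators\<close>

lemma pcas_zip_tl:
  "vs \<noteq> [] \<Longrightarrow> pcas (hd vs) (zip vs (tl vs)) (last vs) \<and> pawalk_verts (hd vs) (zip vs (tl vs)) = vs"
proof (induction vs)
  case (Cons x vs)
  then show ?case by (cases vs) auto
qed simp

lemma apath_of_vertices:
  assumes "vs \<noteq> []" "distinct vs" "hd vs \<in> pverts G" "successively (\<lambda>x y. (x, y) \<in> parcs G) vs"
  shows "pre_digraph.apath (with_proj G) (hd vs) (zip vs (tl vs)) (last vs)"
    and "pre_digraph.awalk_verts (with_proj G) (hd vs) (zip vs (tl vs)) = vs"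
proof -
  have "set (zip vs (tl vs)) \<subseteq> parcs G"
    using assms(4)
  proof (induction vs)
    case (Cons x vs)
    then show ?case by (cases vs) auto
  qed simp
  then show "pre_digraph.apath (with_proj G) (hd vs) (zip vs (tl vs)) (last vs)"
    using assms pcas_zip_tl[OF assms(1)]
    by (simp add: pre_digraph.apath_def pre_digraph.awalk_def cas_with_proj_eq awalk_verts_with_proj_eq)
  show "pre_digraph.awalk_verts (with_proj G) (hd vs) (zip vs (tl vs)) = vs"
    using pcas_zip_tl[OF assms(1)] by (simp add: awalk_verts_with_proj_eq)
qed

text \<open>The interface for refuting domination: a path may be given by its vertices instead of
  its arcs.\<close>

lemma dom_by_path:
  assumes "dom_by G s w v" "vs \<noteq> []" "distinct vs" "hd vs = s" "last vs = v" "s \<in> pverts G"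
    "successively (\<lambda>x y. (x, y) \<in> parcs G) vs"
  shows "w \<in> set vs"
proof -
  have "hd vs \<in> pverts G" using assms(4,6) by simp
  note apath_of_vertices[OF assms(2,3) this assms(7)]
  with assms(1) show ?thesis
    unfolding dom_by_def assms(4,5) by (metis (no_types))
qed

lemma dom_by_refl: "dom_by G s v v"
proof -
  have "pcas s p v \<Longrightarrow> v \<in> set (pawalk_verts s p)" for p
    by (induction p arbitrary: s) auto
  then show ?thesis
    by (simp add: dom_by_def pre_digraph.apath_def pre_digraph.awalk_def cas_with_proj_eq
      awalk_verts_with_proj_eq)
qed

text \<open>A vertex set not containing \<open>s\<close> that can only be entered from \<open>w\<close>
  witnesses that \<open>w\<close> dominates its elements.\<close>

lemma dom_by_cut:
  assumes "s \<notin> X" "v \<in> X" and enter: "\<And>x y. (x, y) \<in> parcs G \<Longrightarrow> x \<notin> X \<Longrightarrow> y \<in> X \<Longrightarrow> x = w"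
  shows "dom_by G s w v"
  unfolding dom_by_def
proof (intro allI impI)
  fix p assume "pre_digraph.apath (with_proj G) s p v"
  then have "set p \<subseteq> parcs G" "pcas s p v"
    by (simp_all add: pre_digraph.apath_def pre_digraph.awalk_def cas_with_proj_eq)
  then have "w \<in> set (pawalk_verts s p)"
    using assms(1)
  proof (induction p arbitrary: s)
    case Nil
    then show ?case using assms(2) by simp
  next
    case (Cons e p)
    show ?case
    proof (cases "snd e \<in> X")
      case True
      then show ?thesis using Cons.prems enter[of "fst e" "snd e"] by auto
    next
      case False
      then show ?thesis using Cons.IH[of "snd e"] Cons.prems by auto
    qed
  qed
  then show "w \<in> set (pre_digraph.awalk_verts (with_proj G) s p)"
    by (simp add: awalk_verts_with_proj_eq)
qed

text \<open>The gadget: a path \<open>0, \<dots>, h\<close> from the start vertex, columns \<open>h + 1 + j\<close> for \<open>j < w\<close>, and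
  rows \<open>h + 1 + w + i\<close> for \<open>i < h\<close>. The arcs \<open>D\<close> from the path to the columns vary.\<close>

definition gadget_arcs :: "nat \<Rightarrow> nat \<Rightarrow> (nat \<Rightarrow> nat \<Rightarrow> bool) \<Rightarrow> (nat \<times> nat) set" where
  "gadget_arcs h w M =
     {(x, y). x < h \<and> y = x + 1} \<union> {(x, y). x = h \<and> h + 1 + w \<le> y \<and> y < h + 1 + w + h} \<union>
     {(x, y). \<exists>i j. i < h \<and> j < w \<and> M i j \<and> x = h + 1 + j \<and> y = h + 1 + w + i}"

definition port_arcs :: "nat \<Rightarrow> nat \<Rightarrow> (nat \<times> nat) set" where
  "port_arcs h w = {(x, y). x < h \<and> h < y \<and> y < h + 1 + w}"

lemma successively_upt_Suc:
  assumes "\<And>x. x < k \<Longrightarrow> P x (Suc x)"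
  shows "successively P [0..<Suc k]"
  using assms
proof (induction k)
  case (Suc k)
  have 1: "successively P [0..<Suc k]" by (rule Suc.IH) (rule Suc.prems, erule less_SucI)
  have 2: "P k (Suc k)" by (rule Suc.prems) simp
  have 3: "last [0..<Suc k] = k" by simp
  have "successively P ([0..<Suc k] @ [Suc k])"
    unfolding successively_append_iff 3 using 1 2
    by (simp only: list.sel successively.simps simp_thms)
  moreover have "[0..<Suc (Suc k)] = [0..<Suc k] @ [Suc k]" by simp
  ultimately show ?case by (simp only:)
next
  case 0
  have "[0..<Suc 0] = [0]" by simp
  then show ?case by (simp only: successively.simps)
qed

text \<open>Each path vertex up to \<open>c\<close> dominates everything beyond it, because earlier
  vertices have only their path arc. If the row and the vector share a one, the route through that
  column and the route along the whole path meet only in vertices up to \<open>c\<close> and in the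
  row, so \<open>c\<close> is the closest dominator. Otherwise the routes that leave the path at
  \<open>c\<close> miss the row, and \<open>c + 1\<close> is a closer dominator.\<close>

lemma dom_tree_parent_gadget:
  assumes c: "c < h" and i: "i < h"
    and D: "D \<subseteq> {(x, y) \<in> port_arcs h w. c \<le> x}" and v: "\<And>j. j < w \<Longrightarrow> (c, h + 1 + j) \<in> D \<longleftrightarrow> v j"
    and n: "n = h + 1 + w + h"
  shows "dom_tree_parent (nat_graph n (gadget_arcs h w M \<union> D)) 0 c (h + 1 + w + i) \<longleftrightarrow> (\<exists>j<w. M i j \<and> v j)"
proof -
  define E where "E = gadget_arcs h w M \<union> D"
  define G where "G = nat_graph n E"
  let ?a = "h + 1 + w + i"
  let ?P = "\<lambda>x y. (x, y) \<in> parcs G"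
  have G: "parcs G = E" "pverts G = {..<n}" by (simp_all add: nat_graph_def G_def)
  have path_arc: "(x, Suc x) \<in> E" if "x < h" for x
    using that by (auto simp: E_def gadget_arcs_def)
  have end_arc: "(h, ?a) \<in> E"
    using i by (auto simp: E_def gadget_arcs_def)
  have chain: "successively ?P [0..<Suc k]" if "k \<le> h" for k
    by (rule successively_upt_Suc) (use that path_arc G in auto)
  have arc: "(x < h \<and> y = x + 1) \<or> (x = h \<and> h + 1 + w \<le> y \<and> y < n) \<or>
      (\<exists>i j. i < h \<and> j < w \<and> M i j \<and> x = h + 1 + j \<and> y = h + 1 + w + i) \<or>
      (c \<le> x \<and> x < h \<and> h < y \<and> y < h + 1 + w \<and> (x, y) \<in> D)" if "(x, y) \<in> E" for x y
    using that D n by (auto simp: E_def gadget_arcs_def port_arcs_def)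
  have hd0: "hd ([0..<Suc k] @ ys) = 0" for k and ys :: "nat list"
    by (simp add: hd_append)
  have p1: "successively ?P ([0..<Suc h] @ [?a])"
    unfolding successively_append_iff using chain[of h] end_arc G by simp
  have bound: "x < n \<and> y < n" if "(x, y) \<in> E" for x y
    using arc[OF that] n by auto
  have wf: "wf_digraph (with_proj G)"
    by unfold_locales (use bound G in auto)
  have reach: "reachable (with_proj G) 0 ?a"
  proof -
    have "pre_digraph.apath (with_proj G) (hd ([0..<Suc h] @ [?a]))
        (zip ([0..<Suc h] @ [?a]) (tl ([0..<Suc h] @ [?a]))) (last ([0..<Suc h] @ [?a]))"
      by (rule apath_of_vertices(1)) (use p1 n in \<open>auto simp: G hd0 simp del: upt_Suc\<close>)
    then show ?thesis
      unfolding hd0 wf_digraph.reachable_awalk[OF wf] pre_digraph.apath_def by auto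
  qed
  have dom: "dom_by G 0 d y" if "d \<le> c" "d < y" for d y
  proof (rule dom_by_cut[of 0 "{x. d < x}"])
    fix x y assume "(x, y) \<in> parcs G" "x \<notin> {x. d < x}" "y \<in> {x. d < x}"
    then have "(x, y) \<in> E" "x \<le> d" "d < y" by (simp_all add: G)
    from arc[OF this(1)] this(2,3) that c show "x = d" by (elim disjE exE conjE) simp_all
  qed (use that in auto)
  have "dom_tree_parent G 0 c ?a \<longleftrightarrow> (\<exists>j<w. M i j \<and> v j)"
  proof
    assume "dom_tree_parent G 0 c ?a"
    then have imm: "immediate_dominator G 0 c ?a"
      by (simp add: dom_tree_parent_def dominator_tree_def)
    show "\<exists>j<w. M i j \<and> v j"
    proof (rule ccontr)
      assume no: "\<not> (\<exists>j<w. M i j \<and> v j)"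
      \<comment> \<open>All vertices beyond \<open>c + 1\<close> except those to which a bypass of
        \<open>c + 1\<close> can lead: the columns joined to \<open>c\<close> and the rows joined to
        such columns. What remains can only be entered from \<open>c + 1\<close>.\<close>
      let ?X = "{x. c + 1 < x} - {y. \<exists>j<w. v j \<and> y = h + 1 + j} - {y. \<exists>i<h. \<exists>j<w. M i j \<and> v j \<and> y = h + 1 + w + i}"
      have "dom_by G 0 (c + 1) ?a"
      proof (rule dom_by_cut[of 0 ?X])
        show "?a \<in> ?X" using no c i by auto
      next
        fix x y assume xy: "(x, y) \<in> parcs G" "x \<notin> ?X" "y \<in> ?X"
        have small: "x \<le> c + 1" if "x \<le> h" using that xy(2) by auto
        have "(x, y) \<in> E" using xy(1) G by simp
        from arc[OF this] show "x = c + 1"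
        proof (elim disjE conjE exE)
          assume "x < h" "y = x + 1"
          then show ?thesis using small xy(3) by auto
        next
          assume "x = h"
          then show ?thesis using small c by auto
        next
          fix i j assume "i < h" "j < w" "M i j" "x = h + 1 + j" "y = h + 1 + w + i"
          then show ?thesis using xy(2,3) c by auto
        next
          assume *: "c \<le> x" "x < h" "h < y" "y < h + 1 + w" "(x, y) \<in> D"
          define j where "j = y - (h + 1)"
          have j: "j < w" "y = h + 1 + j" using * by (auto simp: j_def)
          have "x \<noteq> c" using v[OF j(1)] * j xy(3) by auto
          then show ?thesis using * small by auto
        qed
      qed auto
      moreover have "c + 1 \<noteq> ?a" using c by simp
      ultimately have d: "dom_by G 0 (c + 1) c"
        using imm unfolding immediate_dominator_def by blast
      have "c + 1 \<in> set [0..<Suc c]"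
        by (rule dom_by_path[OF d]) (use chain[of c] c n hd0[of c "[]"] in \<open>auto simp: G simp del: upt_Suc\<close>)
      then show False by simp
    qed
  next
    assume "\<exists>j<w. M i j \<and> v j"
    then obtain j where j: "j < w" "M i j" "v j" by blast
    let ?b = "h + 1 + j"
    have "(c, ?b) \<in> E" "(?b, ?a) \<in> E"
      using v[OF j(1)] j i by (auto simp: E_def gadget_arcs_def)
    then have "successively ?P ([0..<Suc c] @ [?b, ?a])"
      unfolding successively_append_iff using chain[of c] c G by simp
    then have s1: "d \<in> set ([0..<Suc c] @ [?b, ?a])" if "dom_by G 0 d ?a" for d
      by (intro dom_by_path[OF that]) (use c j n in \<open>auto simp: G hd0 simp del: upt_Suc\<close>)
    have s2: "d \<in> set ([0..<Suc h] @ [?a])" if "dom_by G 0 d ?a" for d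
      by (intro dom_by_path[OF that]) (use p1 n in \<open>auto simp: G hd0 simp del: upt_Suc\<close>)
    have "dom_by G 0 d c" if d: "dom_by G 0 d ?a" "d \<noteq> ?a" for d
    proof -
      have "d \<le> c \<or> d = ?b" using s1[OF d(1)] d(2) by simp linarith
      moreover have "d \<noteq> ?b" using s2[OF d(1)] d(2) by simp linarith
      ultimately have "d \<le> c" by blast
      then show ?thesis using dom[of d c] dom_by_refl[of G 0 c] by (cases "d = c") simp_all
    qed
    moreover have "dom_by G 0 c ?a" "c \<noteq> ?a" using dom[of c ?a] c by simp_all
    ultimately have "immediate_dominator G 0 c ?a"
      unfolding immediate_dominator_def by blast
    then show "dom_tree_parent G 0 c ?a"
      using reach by (simp add: dom_tree_parent_def dominator_tree_def)
  qed
  then show ?thesis by (simp add: G_def E_def)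
qed

section \<open>The request sequences\<close>

definition init_arcs :: "mode \<Rightarrow> nat \<Rightarrow> nat \<Rightarrow> (nat \<Rightarrow> nat \<Rightarrow> bool) \<Rightarrow> (nat \<times> nat) set" where
  "init_arcs md h w M = gadget_arcs h w M \<union> (case md of Decremental \<Rightarrow> port_arcs h w | Incremental \<Rightarrow> {})"

definition update_pairs :: "request list \<Rightarrow> (nat \<times> nat) set" where
  "update_pairs reqs = {(u, v). Update u v \<in> set reqs}"

lemma edges_after_snoc: "edges_after md E (reqs @ [q]) = apply_request md q (edges_after md E reqs)"
  by (simp add: edges_after_def)

text \<open>The updates of one instance go in one direction only, so their order is
  irrelevant.\<close>

lemma edges_after_eq:
  "edges_after md E reqs =
     (case md of Decremental \<Rightarrow> E - update_pairs reqs | Incremental \<Rightarrow> E \<union> update_pairs reqs)"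
proof (induction reqs rule: rev_induct)
  case Nil
  then show ?case by (cases md) (simp_all add: edges_after_def update_pairs_def)
next
  case (snoc q reqs)
  then show ?case
    by (cases md; cases q) (auto simp: edges_after_snoc update_pairs_def)
qed

lemma gadget_port_disjoint: "gadget_arcs h w M \<inter> port_arcs h w = {}"
  by (auto simp: gadget_arcs_def port_arcs_def)

lemma finite_arcs: "finite (gadget_arcs h w M \<union> port_arcs h w)"
  by (rule finite_subset[of _ "{..h + 1 + w + h} \<times> {..h + 1 + w + h}"])
    (auto simp: gadget_arcs_def port_arcs_def)

lemma card_arcs: "card (gadget_arcs h w M \<union> port_arcs h w) \<le> 2 * h + 2 * (h * w)"
proof -
  let ?A = "(\<lambda>x. (x, x + 1)) ` {..<h}"
  let ?B = "(\<lambda>i. (h, h + 1 + w + i)) ` {..<h}"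
  let ?C = "(\<lambda>(i, j). (h + 1 + j, h + 1 + w + i)) ` ({..<h} \<times> {..<w})"
  let ?D = "(\<lambda>(i, j). (i, h + 1 + j)) ` ({..<h} \<times> {..<w})"
  have "gadget_arcs h w M \<union> port_arcs h w \<subseteq> ?A \<union> (?B \<union> (?C \<union> ?D))"
  proof
    fix e assume e: "e \<in> gadget_arcs h w M \<union> port_arcs h w"
    obtain x y where xy: "e = (x, y)" by (cases e)
    consider "x < h" "y = x + 1" | "x = h" "h + 1 + w \<le> y" "y < h + 1 + w + h"
      | i j where "i < h" "j < w" "x = h + 1 + j" "y = h + 1 + w + i" | "x < h" "h < y" "y < h + 1 + w"
      using e unfolding xy gadget_arcs_def port_arcs_def by auto
    then show "e \<in> ?A \<union> (?B \<union> (?C \<union> ?D))"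
    proof cases
      case 2
      then have "e = (\<lambda>i. (h, h + 1 + w + i)) (y - (h + 1 + w))" "y - (h + 1 + w) < h" by (auto simp: xy)
      then show ?thesis by blast
    next
      case 4
      then have "e = (\<lambda>(i, j). (i, h + 1 + j)) (x, y - (h + 1))" "y - (h + 1) < w" by (auto simp: xy)
      with 4 show ?thesis by blast
    qed (auto simp: xy)
  qed
  then have "card (gadget_arcs h w M \<union> port_arcs h w) \<le> card (?A \<union> (?B \<union> (?C \<union> ?D)))"
    by (intro card_mono) auto
  also have "\<dots> \<le> card ?A + (card ?B + (card ?C + card ?D))"
    by (meson add_left_mono card_Un_le le_trans)
  also have "\<dots> \<le> h + (h + (h * w + h * w))"
    by (intro add_mono order_trans[OF card_image_le]) simp_all
  finally show ?thesis by simp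
qed

text \<open>Distinctness makes every deletion hit a present arc and every insertion an absent one.
  Under insertions all arcs stay inside a fixed set of at most \<open>m\<close> arcs, and the absent
  arc makes the inclusion strict; this gives the required \<open>card E < m\<close>.\<close>

lemma instance_of_gadget:
  assumes n: "n = h + 1 + w + h" and m: "2 * h + 2 * (h * w) \<le> m"
    and d: "distinct (filter is_update reqs)" and u: "update_pairs reqs \<subseteq> port_arcs h w"
    and q: "\<And>x y. Query x y \<in> set reqs \<Longrightarrow> x < n \<and> y < n"
  shows "instance_of md n m 0 (init_arcs md h w M) reqs"
proof -
  let ?F = "gadget_arcs h w M \<union> port_arcs h w"
  have cardF: "card ?F \<le> m" using card_arcs m le_trans by blast
  have sub: "init_arcs md h w M \<subseteq> ?F" by (auto simp: init_arcs_def split: mode.splits)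
  have sub2: "edges_after md (init_arcs md h w M) reqs' \<subseteq> ?F" if "set reqs' \<subseteq> set reqs" for reqs'
    using sub u that by (auto simp: edges_after_eq update_pairs_def split: mode.splits)
  have "flow_graph (nat_graph n (init_arcs md h w M)) 0"
    unfolding flow_graph_def
  proof
    show "pair_digraph (nat_graph n (init_arcs md h w M))"
      using n finite_subset[OF sub finite_arcs]
      by unfold_locales (use sub in \<open>auto simp: nat_graph_def gadget_arcs_def port_arcs_def\<close>)
  qed (simp add: nat_graph_def n)
  moreover have "card (init_arcs md h w M) \<le> m"
    using card_mono[OF finite_arcs sub] cardF by simp
  moreover have "admissible md n m (edges_after md (init_arcs md h w M) (take i reqs)) (reqs ! i)"
    if i: "i < length reqs" for i
  proof (cases "reqs ! i")
    case (Query x y)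
    then show ?thesis using q[of x y] nth_mem[OF i] by (cases md) auto
  next
    case (Update x y)
    have split: "reqs = take i reqs @ Update x y # drop (Suc i) reqs"
      using id_take_nth_drop[OF i] Update by simp
    have "Update x y \<notin> set (take i reqs)"
    proof
      assume "Update x y \<in> set (take i reqs)"
      then have "\<not> distinct (filter is_update (take i reqs @ Update x y # drop (Suc i) reqs))"
        by auto
      then show False using d split by simp
    qed
    then have new: "(x, y) \<notin> update_pairs (take i reqs)" by (simp add: update_pairs_def)
    have "Update x y \<in> set reqs" using nth_mem[OF i] Update by simp
    then have port: "(x, y) \<in> port_arcs h w" using u by (auto simp: update_pairs_def)
    then have xy: "x < n" "y < n" "x \<noteq> y" using n by (auto simp: port_arcs_def)
    show ?thesis
    proof (cases md)
      case Decremental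
      then show ?thesis using new port Update by (auto simp: edges_after_eq init_arcs_def)
    next
      case Incremental
      let ?E = "edges_after md (init_arcs md h w M) (take i reqs)"
      have "(x, y) \<notin> gadget_arcs h w M" using port gadget_port_disjoint by blast
      then have nin: "(x, y) \<notin> ?E" using new Incremental by (simp add: edges_after_eq init_arcs_def)
      have "?E \<subseteq> ?F" by (rule sub2[OF set_take_subset])
      moreover have "(x, y) \<in> ?F" using port by simp
      ultimately have "?E \<subset> ?F" using nin by (intro psubsetI) metis+
      then have "card ?E < card ?F" by (rule psubset_card_mono[OF finite_arcs])
      then show ?thesis using nin xy cardF Update Incremental by simp
    qed
  qed
  ultimately show ?thesis unfolding instance_of_def by blast
qed

definition port :: "mode \<Rightarrow> nat \<Rightarrow> nat \<Rightarrow> nat" where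
  "port md h r = (case md of Decremental \<Rightarrow> r | Incremental \<Rightarrow> h - 1 - r)"

text \<open>A round first updates the arcs of its port for the columns whose vector entry is
  \<open>flag1\<close>, and after the queries those for the entry \<open>flag2\<close> (none if insertions are made).\<close>

definition flag1 :: "mode \<Rightarrow> nat" where
  "flag1 md = (case md of Decremental \<Rightarrow> 0 | Incremental \<Rightarrow> 1)"

definition flag2 :: "mode \<Rightarrow> nat" where
  "flag2 md = (case md of Decremental \<Rightarrow> 1 | Incremental \<Rightarrow> 2)"

definition update_reqs :: "nat \<Rightarrow> nat \<Rightarrow> (nat \<Rightarrow> bool) \<Rightarrow> nat \<Rightarrow> nat \<Rightarrow> request list" where
  "update_reqs h c v f k = map (\<lambda>j. Update c (h + 1 + j)) (filter (\<lambda>j. of_bool (v j) = f) [0..<k])"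

definition query_reqs :: "nat \<Rightarrow> nat \<Rightarrow> nat \<Rightarrow> nat \<Rightarrow> request list" where
  "query_reqs h w c k = map (\<lambda>i. Query c (h + 1 + w + i)) [0..<k]"

definition round_reqs :: "mode \<Rightarrow> nat \<Rightarrow> nat \<Rightarrow> (nat \<Rightarrow> bool) \<Rightarrow> nat \<Rightarrow> request list" where
  "round_reqs md h w v r = update_reqs h (port md h r) v (flag1 md) w @ query_reqs h w (port md h r) h @
     update_reqs h (port md h r) v (flag2 md) w"

definition epoch_reqs :: "mode \<Rightarrow> nat \<Rightarrow> nat \<Rightarrow> (nat \<Rightarrow> nat \<Rightarrow> bool) \<Rightarrow> nat \<Rightarrow> request list" where
  "epoch_reqs md h w vs k = concat (map (\<lambda>r. round_reqs md h w (vs r) r) [0..<k])"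

lemma epoch_reqs_Suc: "epoch_reqs md h w vs (Suc k) = epoch_reqs md h w vs k @ round_reqs md h w (vs k) k"
  by (simp add: epoch_reqs_def)

lemma flag_cases: "flag1 md \<noteq> flag2 md" "md = Decremental \<Longrightarrow> of_bool b = flag1 md \<or> of_bool b = flag2 md"
  by (auto simp: flag1_def flag2_def split: mode.splits)

lemma update_pairs_append: "update_pairs (xs @ ys) = update_pairs xs \<union> update_pairs ys"
  by (auto simp: update_pairs_def)

lemma update_pairs_update_reqs:
  "update_pairs (update_reqs h c v f k) = {(x, y). x = c \<and> (\<exists>j<k. of_bool (v j) = f \<and> y = h + 1 + j)}"
  by (auto simp: update_pairs_def update_reqs_def)

lemma update_pairs_query_reqs: "update_pairs (query_reqs h w c k) = {}"
  by (auto simp: update_pairs_def query_reqs_def)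

lemma update_pairs_round_reqs:
  "update_pairs (round_reqs md h w v r) = {(x, y). x = port md h r \<and>
     (\<exists>j<w. (of_bool (v j) = flag1 md \<or> of_bool (v j) = flag2 md) \<and> y = h + 1 + j)}"
  by (auto simp: round_reqs_def update_pairs_append update_pairs_update_reqs update_pairs_query_reqs)

lemma update_pairs_epoch_reqs:
  "update_pairs (epoch_reqs md h w vs k) = (\<Union>r<k. update_pairs (round_reqs md h w (vs r) r))"
  by (induction k) (simp_all add: epoch_reqs_def update_pairs_append lessThan_Suc Un_commute,
    simp add: update_pairs_def)

lemma port_inj: "r < h \<Longrightarrow> r' < h \<Longrightarrow> port md h r = port md h r' \<longleftrightarrow> r = r'"
  by (auto simp: port_def split: mode.splits)

lemma port_less: "r < h \<Longrightarrow> port md h r < h"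
  by (auto simp: port_def split: mode.splits)

lemma filter_update_reqs: "filter is_update (update_reqs h c v f k) = update_reqs h c v f k"
  by (auto simp: update_reqs_def filter_map o_def)

lemma filter_query_reqs: "filter is_update (query_reqs h w c k) = []"
  by (auto simp: query_reqs_def)

lemma distinct_round_reqs: "distinct (filter is_update (round_reqs md h w v r))"
  using flag_cases(1)[of md]
  by (auto simp: round_reqs_def filter_update_reqs filter_query_reqs)
    (auto simp: update_reqs_def distinct_map inj_on_def)

lemma update_pairs_disjoint_distinct:
  assumes "update_pairs xs \<inter> update_pairs ys = {}"
  shows "set (filter is_update xs) \<inter> set (filter is_update ys) = {}"
proof -
  have False if "q \<in> set xs" "q \<in> set ys" "is_update q" for q
    using assms that by (cases q) (auto simp: update_pairs_def)
  then show ?thesis by auto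
qed

lemma distinct_epoch_reqs: "k \<le> h \<Longrightarrow> distinct (filter is_update (epoch_reqs md h w vs k))"
proof (induction k)
  case 0
  then show ?case by (simp add: epoch_reqs_def)
next
  case (Suc k)
  have "update_pairs (epoch_reqs md h w vs k) \<inter> update_pairs (round_reqs md h w (vs k) k) = {}"
  proof -
    have "port md h r \<noteq> port md h k" if "r < k" for r
      using port_inj[of r h k md] that Suc.prems by simp
    then show ?thesis by (fastforce simp: update_pairs_epoch_reqs update_pairs_round_reqs)
  qed
  from update_pairs_disjoint_distinct[OF this] show ?case
    using Suc distinct_round_reqs by (simp add: epoch_reqs_Suc)
qed

lemma Query_in_epoch_reqs:
  assumes "Query x y \<in> set (epoch_reqs md h w vs k)" "k \<le> h"
  shows "x < h \<and> y < h + 1 + w + h"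
proof -
  from assms(1) obtain r i where "r < k" "i < h" "x = port md h r" "y = h + 1 + w + i"
    by (auto simp: epoch_reqs_def round_reqs_def query_reqs_def update_reqs_def)
  then show ?thesis using port_less[of r h md] assms(2) by simp
qed

lemma update_pairs_epoch_subset:
  assumes "k \<le> h"
  shows "update_pairs (epoch_reqs md h w vs k) \<subseteq> port_arcs h w"
proof -
  have "(port md h r, h + 1 + j) \<in> port_arcs h w" if "r < k" "j < w" for r j
    using port_less[of r h md] that assms by (simp add: port_arcs_def)
  then show ?thesis by (auto simp: update_pairs_epoch_reqs update_pairs_round_reqs)
qed

lemma instance_of_epoch:
  assumes n: "n = h + 1 + w + h" and m: "2 * h + 2 * (h * w) \<le> m"
    and pre: "epoch_reqs md h w vs h = reqs @ ys"
  shows "instance_of md n m 0 (init_arcs md h w M) reqs"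
proof (rule instance_of_gadget[OF n m])
  have "distinct (filter is_update (epoch_reqs md h w vs h))" by (rule distinct_epoch_reqs) simp
  then show "distinct (filter is_update reqs)" by (simp add: pre)
  have "update_pairs (epoch_reqs md h w vs h) \<subseteq> port_arcs h w"
    by (rule update_pairs_epoch_subset) simp
  then show "update_pairs reqs \<subseteq> port_arcs h w" by (simp add: pre update_pairs_append)
next
  fix x y assume "Query x y \<in> set reqs"
  then have "Query x y \<in> set (epoch_reqs md h w vs h)" by (simp add: pre)
  from Query_in_epoch_reqs[OF this] show "x < n \<and> y < n" using n by simp
qed

text \<open>Under deletions the finished rounds have emptied all ports before the current one; under
  insertions they have filled only ports behind it. Both situations satisfy the assumption of
  \<open>dom_tree_parent_gadget\<close>, where the ports behind the current one may hold any
  arcs.\<close>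

lemma query_correct:
  assumes n: "n = h + 1 + w + h" and r: "r < h" and i: "i < h"
  shows "dom_tree_parent (nat_graph n (edges_after md (init_arcs md h w M)
      (epoch_reqs md h w vs r @ update_reqs h (port md h r) (vs r) (flag1 md) w @
       query_reqs h w (port md h r) k))) 0 (port md h r) (h + 1 + w + i)
    \<longleftrightarrow> (\<exists>j<w. M i j \<and> vs r j)"
proof -
  let ?c = "port md h r"
  let ?U = "update_pairs (epoch_reqs md h w vs r) \<union> update_pairs (update_reqs h ?c (vs r) (flag1 md) w)"
  define D where "D = (case md of Decremental \<Rightarrow> port_arcs h w - ?U | Incremental \<Rightarrow> ?U)"
  have edges: "edges_after md (init_arcs md h w M)
      (epoch_reqs md h w vs r @ update_reqs h ?c (vs r) (flag1 md) w @ query_reqs h w ?c k) =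
    gadget_arcs h w M \<union> D"
  proof -
    have "?U \<subseteq> port_arcs h w"
      using update_pairs_epoch_subset[of r h md w vs] r port_less[OF r, of md]
      by (auto simp: update_pairs_update_reqs port_arcs_def)
    then show ?thesis
      using gadget_port_disjoint[of h w M]
      by (cases md) (auto simp: edges_after_eq update_pairs_append update_pairs_query_reqs D_def init_arcs_def)
  qed
  have Dsub: "D \<subseteq> {(x, y) \<in> port_arcs h w. ?c \<le> x}"
  proof (cases md)
    case Decremental
    have "(x, y) \<in> ?U" if "(x, y) \<in> port_arcs h w" "x < r" for x y
    proof -
      define j where "j = y - (h + 1)"
      have "j < w" "y = h + 1 + j" using that by (auto simp: port_arcs_def j_def)
      then have "(x, y) \<in> update_pairs (round_reqs md h w (vs x) x)"
        using flag_cases(2)[OF Decremental, of "vs x j"]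
        by (auto simp: update_pairs_round_reqs Decremental port_def)
      then show ?thesis using that by (auto simp: update_pairs_epoch_reqs)
    qed
    then show ?thesis using Decremental unfolding D_def port_def
      by (fastforce simp: not_le[symmetric])
  next
    case Incremental
    then show ?thesis using r by (auto simp: D_def port_def update_pairs_epoch_reqs
        update_pairs_round_reqs update_pairs_update_reqs port_arcs_def)
  qed
  have Dv: "(?c, h + 1 + j) \<in> D \<longleftrightarrow> vs r j" if j: "j < w" for j
  proof -
    have *: "(?c, h + 1 + j) \<notin> update_pairs (epoch_reqs md h w vs r)"
    proof -
      have "?c \<noteq> port md h r'" if "r' < r" for r'
        using port_inj[of r h r' md] that r by simp
      then show ?thesis by (auto simp: update_pairs_epoch_reqs update_pairs_round_reqs)
    qed
    have "(?c, h + 1 + j) \<in> port_arcs h w" using port_less[OF r, of md] j by (auto simp: port_arcs_def)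
    then show ?thesis using * j
      by (cases md) (auto simp: D_def update_pairs_update_reqs flag1_def)
  qed
  show ?thesis unfolding edges
    by (rule dom_tree_parent_gadget[OF port_less[OF r] i Dsub Dv n])
qed

lemma length_query_epoch: "length (filter is_query (epoch_reqs md h w vs k)) = k * h"
proof (induction k)
  case (Suc k)
  have u: "length (filter is_query (update_reqs h c v f k)) = 0" for c v f k
    by (auto simp: update_reqs_def)
  have q: "length (filter is_query (query_reqs h w c k)) = k" for c k
    by (auto simp: query_reqs_def filter_map o_def)
  show ?case by (simp add: epoch_reqs_Suc round_reqs_def Suc u q del: length_0_conv)
qed (simp add: epoch_reqs_def)

section \<open>The reduction program\<close>

lemma reg_set_reg [simp]: "reg (set_reg x v \<sigma>) y = (if y = x then v else reg \<sigma> y)"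
  by (simp add: set_reg_def)

lemma mem_set_reg [simp]: "mem (set_reg x v \<sigma>) = mem \<sigma>"
  by (simp add: set_reg_def)

lemma outp_set_reg [simp]: "outp (set_reg x v \<sigma>) = outp \<sigma>"
  by (simp add: set_reg_def)

lemma agree_set_reg [simp]: "L \<le> x \<Longrightarrow> agree L \<sigma> (set_reg x v \<tau>) = agree L \<sigma> \<tau>"
  by (auto simp: agree_def)

lemma agree_mem_update [simp]: "agree L \<sigma> (\<tau>\<lparr>mem := \<mu>\<rparr>) = agree L \<sigma> \<tau>"
  by (simp add: agree_def)

lemma agree_outp_update [simp]: "agree L \<sigma> (\<tau>\<lparr>outp := \<mu>\<rparr>) = agree L \<sigma> \<tau>"
  by (simp add: agree_def)

lemma agreeD: "agree L \<sigma> \<tau> \<Longrightarrow> x < L \<Longrightarrow> reg \<tau> x = reg \<sigma> x"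
  by (simp add: agree_def)

text \<open>Registers: \<open>2\<close> holds \<open>n\<close>, \<open>3\<close> the block height \<open>h = g ^ P\<close> (also the number of rounds of an
  epoch), \<open>4\<close> the block width \<open>w = g ^ R\<close>, \<open>5\<close> the size of a memory region, \<open>6\<close> and \<open>7\<close> the number
  of blocks per block row and in total, \<open>8\<close> the number of copies of each instance, \<open>9\<close> and \<open>11\<close> the
  first column and row vertex, and \<open>12\<close> the number of vertices.\<close>

definition setup_code :: "nat \<Rightarrow> nat \<Rightarrow> nat \<Rightarrow> nat \<Rightarrow> com" where
  "setup_code P R ex K = seqs [power_code 3 10 P, power_code 4 10 R, power_code 5 10 ex,
     Arith Div 6 2 4, Arith Add 6 6 1, Arith Div 7 2 3, Arith Add 7 7 1, Arith Mul 7 7 6,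
     Const 8 K, Arith Add 13 8 1, Const 17 2, Arith Add 9 3 1, Arith Add 11 9 4, Arith Add 12 11 3]"

text \<open>Memory is cut into regions of \<open>W\<close> cells. Cells 0, 1 and 2 hold the round
  counter, \<open>n\<close> and \<open>g\<close>; the cells from \<open>W\<close> on hold the
  arguments of the current request. The remaining regions are numbered in mixed radix with the
  digits \<open>x\<close> (epoch), register 20 (block) and \<open>y\<close> (copy), and the 2 in
  register 17 skips the first two regions. Epoch digit 0 stands for preprocessed data, so epoch
  \<open>e\<close> uses the digit \<open>e + 1\<close>. Copy digit \<open>K\<close> holds the input
  graph under epoch digit 0 and the vote counters otherwise.\<close>

definition region_code :: "nat \<Rightarrow> nat \<Rightarrow> nat \<Rightarrow> com" where
  "region_code d x y = seqs [Arith Mul d x 7, Arith Add d d 20, Arith Mul d d 13, Arith Add d d y,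
     Arith Add d d 17, Arith Mul d d 5]"

text \<open>The current \<open>g\<close> is kept in memory cell 2 because the loop rule carries no
  register values from one iteration to the next. All \<open>n\<close> iterations are made, even
  after the search has settled.\<close>

definition search_code :: "nat \<Rightarrow> com" where
  "search_code Q = For 20 2 (seqs [Const 22 2, Load 25 22, Arith Add 25 25 1, power_code 23 25 Q,
     Arith Less 24 2 23, If 24 Skip (Store 22 25)])"

text \<open>Decodes a cell number into a pair of vertices in registers 32 and 33. Register 34 counts
  the kinds of arcs independent of the matrix that the pair fits; register 35 tells whether the pair
  leads from a column to a row, where the matrix decides.\<close>

definition cell_tests :: "mode \<Rightarrow> com" where
  "cell_tests md = seqs [Arith Div 32 30 12, Arith Mod 33 30 12,
     Arith Less 34 32 3, Arith Add 35 32 1, Arith Equal 35 33 35, Arith Mul 34 34 35,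
     Arith Equal 35 32 3, Arith Less 36 33 11, Arith Equal 36 36 0, Arith Mul 35 35 36, Arith Add 34 34 35,
     Arith Less 35 32 3, Arith Less 37 3 33, Arith Mul 35 35 37, Arith Less 37 33 11, Arith Mul 35 35 37,
     (case md of Decremental \<Rightarrow> Arith Add 34 34 35 | Incremental \<Rightarrow> Skip),
     Arith Less 35 3 32, Arith Less 37 32 11, Arith Mul 35 35 37, Arith Mul 35 35 36]"

definition cell_code :: "mode \<Rightarrow> com" where
  "cell_code md = Seq (cell_tests md) (seqs [
     If 35 (seqs [Arith Sub 37 33 11, Arith Add 37 37 23, Arith Mul 37 37 2, Arith Sub 38 32 9,
       Arith Add 38 38 24, Arith Add 37 37 38, Arith Add 37 37 1, Input 37 37, Arith Add 34 34 37]) Skip,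
     Arith Add 35 22 30, Arith Add 35 35 17, If 34 (Store 35 1) Skip])"

definition block_offsets :: com where
  "block_offsets = seqs [Arith Div 23 20 6, Arith Mul 23 23 3, Arith Mod 24 20 6, Arith Mul 24 24 4]"

text \<open>Overlay and base get the same address, so whatever the preprocessing writes becomes the
  base for all epochs.\<close>

definition copy_preprocess :: "dom_alg \<Rightarrow> com" where
  "copy_preprocess A = Seq (seqs [region_code 32 0 30, Arith Add 33 32 0, Arith Mul 34 30 5, Arith Add 35 22 0])
     (simulate_call (dom_preprocess A))"

definition block_preprocess :: "mode \<Rightarrow> dom_alg \<Rightarrow> com" where
  "block_preprocess md A = Seq (seqs [block_offsets, region_code 22 0 8, Store 22 12, Arith Mul 25 12 12])
     (Seq (For 30 25 (cell_code md)) (For 30 8 (copy_preprocess A)))"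

definition preprocess_code :: "mode \<Rightarrow> dom_alg \<Rightarrow> nat \<Rightarrow> nat \<Rightarrow> nat \<Rightarrow> nat \<Rightarrow> nat \<Rightarrow> nat \<Rightarrow> com" where
  "preprocess_code md A g0 P R Q ex K = Seq (seqs [Input 2 0, Const 1 1, Store 1 2, Const 10 g0, Const 22 2,
     Store 22 10]) (Seq (search_code Q) (Seq (seqs [Const 22 2, Load 10 22]) (Seq (setup_code P R ex K)
     (For 20 7 (block_preprocess md A)))))"

definition send_code :: "com \<Rightarrow> com" where
  "send_code c = seqs [Store 5 16, Arith Add 47 5 1, Store 47 46, simulate_call c]"

definition update_loop :: "dom_alg \<Rightarrow> nat \<Rightarrow> com" where
  "update_loop A f = For 40 4 (seqs [Arith Add 42 24 40, Input 43 42, Const 44 f, Arith Equal 45 43 44,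
     If 45 (Seq (Arith Add 46 9 40) (send_code (dom_update A))) Skip])"

definition query_loop :: "dom_alg \<Rightarrow> com" where
  "query_loop A = For 40 3 (seqs [Arith Add 46 11 40, send_code (dom_query A), Arith Equal 42 50 1,
     Arith Add 43 22 40, Load 44 43, Arith Add 44 44 42, Store 43 44])"

definition copy_round :: "mode \<Rightarrow> dom_alg \<Rightarrow> com" where
  "copy_round md A = Seq (seqs [region_code 32 14 30, region_code 33 0 30, Arith Mul 34 30 5, Arith Add 35 5 0])
     (Seq (update_loop A (flag1 md)) (Seq (query_loop A) (update_loop A (flag2 md))))"

text \<open>Only ones are written into the zero output, so the blocks of one block row accumulate
  the disjunction of their partial products.\<close>

definition output_code :: com where
  "output_code = seqs [Arith Add 43 22 30, Load 44 43, Arith Add 44 44 44, Arith Less 45 8 44,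
     If 45 (seqs [Arith Add 46 23 30, Output 46 1]) Skip]"

definition block_round :: "mode \<Rightarrow> dom_alg \<Rightarrow> com" where
  "block_round md A = Seq (seqs [block_offsets, region_code 22 14 8, Arith Mul 25 15 3, Arith Add 22 22 25])
     (Seq (For 30 8 (copy_round md A)) (For 30 3 output_code))"

definition port_code :: "mode \<Rightarrow> com" where
  "port_code md = (case md of Decremental \<Rightarrow> Arith Add 16 15 0
     | Incremental \<Rightarrow> seqs [Arith Sub 16 3 1, Arith Sub 16 16 15])"

text \<open>Registers do not survive between calls. All parameters are therefore recomputed from
  \<open>n\<close> and \<open>g\<close>, and the epoch and the round within it from the counter in
  cell 0.\<close>

definition round_code :: "mode \<Rightarrow> dom_alg \<Rightarrow> nat \<Rightarrow> nat \<Rightarrow> nat \<Rightarrow> nat \<Rightarrow> com" where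
  "round_code md A P R ex K = Seq (seqs [Const 1 1, Load 2 1, Const 22 2, Load 10 22])
     (Seq (setup_code P R ex K)
     (Seq (seqs [Load 18 0, Arith Div 14 18 3, Arith Add 14 14 1, Arith Mod 15 18 3, port_code md])
     (Seq (For 20 7 (block_round md A)) (seqs [Arith Add 18 18 1, Store 0 18]))))"

definition omv_of_dom :: "mode \<Rightarrow> dom_alg \<Rightarrow> nat \<Rightarrow> nat \<Rightarrow> nat \<Rightarrow> nat \<Rightarrow> nat \<Rightarrow> nat \<Rightarrow> omv_alg" where
  "omv_of_dom md A g0 P R Q ex K =
     \<lparr>omv_preprocess = preprocess_code md A g0 P R Q ex K, omv_round = round_code md A P R ex K\<rparr>"

text \<open>Starts at \<open>g0\<close> even if \<open>g0 ^ Q\<close> exceeds \<open>n\<close>.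
  Correct output is demanded for every \<open>n\<close>, and the algorithm is controlled on gadgets
  from \<open>g0\<close> on; only the time bound, demanded for large \<open>n\<close>, uses
  \<open>g ^ Q \<le> n\<close>.\<close>

primrec search :: "nat \<Rightarrow> nat \<Rightarrow> nat \<Rightarrow> nat \<Rightarrow> nat" where
  "search g0 Q n 0 = g0"
| "search g0 Q n (Suc j) = (let g = search g0 Q n j in if n < (g + 1) ^ Q then g else g + 1)"

definition upd3 :: "('a \<Rightarrow> 'b \<Rightarrow> 'c \<Rightarrow> 'd) \<Rightarrow> 'a \<Rightarrow> 'b \<Rightarrow> 'c \<Rightarrow> 'd \<Rightarrow> 'a \<Rightarrow> 'b \<Rightarrow> 'c \<Rightarrow> 'd" where
  "upd3 H e b k x = (\<lambda>e' b' k'. if e' = e \<and> b' = b \<and> k' = k then x else H e' b' k')"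

section \<open>Memory layout and invariants of one execution\<close>

lemma mult_add_div_nat: "i < m \<Longrightarrow> (x * m + i) div m = x" for x m i :: nat
  by simp

text \<open>Coins, matrix and vectors are fixed, so everything in this locale is deterministic.
  \<open>V\<close> bounds the words of the simulated algorithm and \<open>B\<close> those of the
  simulating program. \<open>halt\<close> covers all matrices and vectors because the blocks cut
  from the input can be arbitrary.\<close>

locale omv_run =
  fixes md :: mode and A :: dom_alg and V g0 P R Q ex K n B :: nat and coin :: "nat \<Rightarrow> bool"
    and M :: "nat \<Rightarrow> nat \<Rightarrow> bool" and vs :: "(nat \<Rightarrow> bool) list"
    and g h w W nb2 NB n' :: nat
  defines "g \<equiv> search g0 Q n n" and "h \<equiv> g ^ P" and "w \<equiv> g ^ R" and "W \<equiv> g ^ ex"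
    and "nb2 \<equiv> n div w + 1" and "NB \<equiv> (n div h + 1) * nb2" and "n' \<equiv> h + 1 + w + h"
  fixes region :: "nat \<Rightarrow> nat \<Rightarrow> nat \<Rightarrow> nat"
  defines "region \<equiv> \<lambda>e b k. ((e * NB + b) * (K + 1) + k + 2) * W"
  assumes g0: "1 \<le> g0" and Q: "1 \<le> Q" and K: "1 \<le> K" and n: "1 \<le> n" and V: "1 \<le> V" "V < W"
    and graph_size: "n' * n' + 2 \<le> W"
    and bound: "region (n + 1) NB K + W \<le> B" "(n + h) * n + n + w + 1 \<le> B" "(g + 1) ^ Q \<le> B" "g0 \<le> B"
    and halt: "\<And>coin' Mb v. all_halt V coin' (\<lambda>_. 0) (dom_calls A n' 0 (init_arcs md h w Mb) (epoch_reqs md h w v h))"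
begin

lemma search_mono: "j \<le> j' \<Longrightarrow> search g0 Q n j \<le> search g0 Q n j'"
  by (rule lift_Suc_mono_le) (simp_all add: Let_def)

lemma g_pos: "1 \<le> g"
  using search_mono[of 0 n] g0 by (simp add: g_def)

lemma h_pos: "1 \<le> h" and w_pos: "1 \<le> w"
  using g_pos by (simp_all add: h_def w_def)

lemma region_le:
  assumes "e \<le> n + 1" "b \<le> NB" "k \<le> K"
  shows "region e b k + W \<le> B"
proof -
  have "region e b k \<le> region (n + 1) NB K"
    using assms unfolding region_def by (intro mult_le_mono add_le_mono) auto
  then show ?thesis using bound(1) by simp
qed

lemma region_ge: "2 * W \<le> region e b k"
  by (simp add: region_def algebra_simps)

text \<open>Uniqueness of the digits in mixed radix. The epoch is the leading digit and may be any
  number.\<close>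

lemma region_eq_iff:
  assumes "region e b k + i = region e' b' k' + i'" "i < W" "i' < W" "b < NB" "b' < NB" "k \<le> K" "k' \<le> K"
  shows "e = e' \<and> b = b' \<and> k = k' \<and> i = i'"
proof -
  have d: "(region e b k + i) div W = (e * NB + b) * (K + 1) + k + 2"
    unfolding region_def using assms(2) by (intro mult_add_div_nat)
  have "(region e' b' k' + i') div W = (e' * NB + b') * (K + 1) + k' + 2"
    unfolding region_def using assms(3) by (intro mult_add_div_nat)
  then have "(e * NB + b) * (K + 1) + k + 2 = (e' * NB + b') * (K + 1) + k' + 2"
    using d unfolding assms(1) by metis
  then have 1: "(e * NB + b) * (K + 1) + k = (e' * NB + b') * (K + 1) + k'" by linarith
  have "((e * NB + b) * (K + 1) + k) div (K + 1) = e * NB + b"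
    using assms(6) by (intro mult_add_div_nat) linarith
  moreover have "((e' * NB + b') * (K + 1) + k') div (K + 1) = e' * NB + b'"
    using assms(7) by (intro mult_add_div_nat) linarith
  ultimately have 2: "e * NB + b = e' * NB + b'" using 1 by metis
  then have "(e * NB + b) div NB = (e' * NB + b') div NB" by simp
  then have "e = e'" using assms by simp
  with 1 2 assms(1) show ?thesis by (simp add: region_def)
qed

text \<open>Cut off beyond \<open>V\<close> so that, for random \<open>coin\<close>, it is
  distributed like \<open>coins V\<close>, the coins for which the algorithm is assumed
  correct.\<close>

definition coins_of :: "nat \<Rightarrow> nat \<Rightarrow> bool" where
  "coins_of k = (\<lambda>a. a \<le> V \<and> coin (k * W + a))"

definition memory :: "nat \<Rightarrow> call list \<Rightarrow> nat \<Rightarrow> nat" where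
  "memory k H = mem_after V (coins_of k) (\<lambda>_. 0) H"

text \<open>\<open>H e b k\<close> lists the calls made so far to copy \<open>k\<close> of the instance for block \<open>b\<close> in epoch \<open>e\<close>.\<close>

definition mem_inv :: "(nat \<Rightarrow> nat \<Rightarrow> nat \<Rightarrow> call list) \<Rightarrow> (nat \<Rightarrow> nat \<Rightarrow> nat \<Rightarrow> nat) \<Rightarrow> (nat \<Rightarrow> nat) \<Rightarrow> bool" where
  "mem_inv H C \<mu> \<longleftrightarrow>
     (\<forall>e b k. b < NB \<longrightarrow> k < K \<longrightarrow> (\<forall>a\<le>V. overlay \<mu> (region (Suc e) b k) (region 0 b k) a = memory k (H e b k) a \<and>
        memory k (H e b k) a \<le> V)) \<and>
     (\<forall>e b i. b < NB \<longrightarrow> i < h * h \<longrightarrow> \<mu> (region (Suc e) b K + i) = C e b i) \<and>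
     (\<forall>a. 2 \<le> a \<longrightarrow> a \<le> V \<longrightarrow> \<mu> (W + a) = 0)"

definition globals_mem :: "nat \<Rightarrow> (nat \<Rightarrow> nat) \<Rightarrow> bool" where
  "globals_mem t \<mu> \<longleftrightarrow> \<mu> 0 = t \<and> \<mu> 1 = n \<and> \<mu> 2 = g"

definition globals :: "state \<Rightarrow> bool" where
  "globals \<sigma> \<longleftrightarrow> reg \<sigma> 0 = 0 \<and> reg \<sigma> 1 = 1 \<and> reg \<sigma> 2 = n \<and> reg \<sigma> 3 = h \<and> reg \<sigma> 4 = w \<and> reg \<sigma> 5 = W \<and>
     reg \<sigma> 6 = nb2 \<and> reg \<sigma> 7 = NB \<and> reg \<sigma> 8 = K \<and> reg \<sigma> 9 = h + 1 \<and> reg \<sigma> 11 = h + 1 + w \<and>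
     reg \<sigma> 12 = n' \<and> reg \<sigma> 13 = K + 1 \<and> reg \<sigma> 17 = 2"

definition copy_regs :: "nat \<Rightarrow> nat \<Rightarrow> nat \<Rightarrow> state \<Rightarrow> bool" where
  "copy_regs e b k \<sigma> \<longleftrightarrow> reg \<sigma> 32 = region (Suc e) b k \<and> reg \<sigma> 33 = region 0 b k \<and> reg \<sigma> 34 = k * W \<and> reg \<sigma> 35 = W"

lemma globals_agree: "globals \<sigma> \<Longrightarrow> agree L \<sigma> \<tau> \<Longrightarrow> 20 \<le> L \<Longrightarrow> globals \<tau>"
  by (simp add: globals_def agree_def)

lemma copy_regs_agree: "copy_regs e b k \<sigma> \<Longrightarrow> agree L \<sigma> \<tau> \<Longrightarrow> 36 \<le> L \<Longrightarrow> copy_regs e b k \<tau>"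
  by (simp add: copy_regs_def agree_def)

lemma size_facts: "h * h < W" "3 \<le> W" "n' \<le> W" "h \<le> n'" "w \<le> n'" "W \<le> B" "2 * W \<le> B" "K + 2 \<le> B"
  "NB \<le> B" "n \<le> B" "1 \<le> B" "n' * n' \<le> B" "n' \<le> B" "h \<le> B" "w \<le> B" "K * W + W \<le> B"
proof -
  have hn: "h \<le> n'" "w \<le> n'" "1 \<le> n'" by (simp_all add: n'_def)
  have "h * h \<le> n' * n'" "n' * 1 \<le> n' * n'" by (intro mult_le_mono hn order_refl)+
  then show 1: "h * h < W" "n' \<le> W" using graph_size by linarith+
  have "1 * 1 \<le> n' * n'" by (intro mult_le_mono hn)
  then show 2: "3 \<le> W" using graph_size by linarith
  show "h \<le> n'" "w \<le> n'" by fact+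
  have "region 0 0 K + W \<le> B" by (rule region_le) simp_all
  then have rB: "(K + 2) * W + W \<le> B" by (simp add: region_def)
  have "(K + 2) * 1 \<le> (K + 2) * W" using 2 by (intro mult_le_mono) auto
  then have "K + 2 \<le> (K + 2) * W" by (simp only: mult_1_right)
  then show "K + 2 \<le> B" using rB by (meson add_leD1 le_trans)
  have "2 * W + K * W = (K + 2) * W" by (simp add: algebra_simps)
  then show 3: "W \<le> B" "2 * W \<le> B" "K * W + W \<le> B" using rB by linarith+
  show "1 \<le> B" "n' * n' \<le> B" "n' \<le> B" "h \<le> B" "w \<le> B" using 1 2 3 graph_size hn by linarith+
  show "n \<le> B" using bound(2) by linarith
  have "NB * 1 * 1 \<le> ((n + 1) * NB + NB) * (K + 1) * W" using 2 by (intro mult_le_mono) auto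
  also have "\<dots> \<le> region (n + 1) NB K" unfolding region_def by (intro mult_le_mono) auto
  finally show "NB \<le> B" using bound(1) by linarith
qed

text \<open>The call writes only into its own overlay and the two argument cells, so exactly one
  history grows. The cells behind the arguments are zero by the invariant, which completes the input
  array \<open>pair_input\<close>.\<close>

lemma runs_send:
  assumes gl: "globals \<sigma>" and cr: "copy_regs e b k \<sigma>" and b: "b < NB" and k: "k < K" and e: "e \<le> n"
    and inv: "mem_inv H C (mem \<sigma>)" and gm: "globals_mem t (mem \<sigma>)"
    and ha: "halts V (coins_of k) (memory k (H e b k)) (c, pair_input (reg \<sigma> 16) (reg \<sigma> 46))"
  shows "runs B coin inp (send_code c) \<sigma> (\<lambda>u \<tau>.
    u \<le> 8 * call_time V (coins_of k) (memory k (H e b k)) (c, pair_input (reg \<sigma> 16) (reg \<sigma> 46)) + reg_bound c + 5 \<and>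
    agree 47 \<sigma> \<tau> \<and> outp \<tau> = outp \<sigma> \<and> globals_mem t (mem \<tau>) \<and>
    mem_inv (upd3 H e b k (H e b k @ [(c, pair_input (reg \<sigma> 16) (reg \<sigma> 46))])) C (mem \<tau>) \<and>
    reg \<tau> 50 = call_out V (coins_of k) (memory k (H e b k)) (c, pair_input (reg \<sigma> 16) (reg \<sigma> 46)) 0)"
proof -
  let ?u = "reg \<sigma> 16" and ?v = "reg \<sigma> 46"
  let ?call = "(c, pair_input ?u ?v)"
  define \<mu> where "\<mu> = (mem \<sigma>)(W := ?u, Suc W := ?v)"
  define \<tau>0 where "\<tau>0 = (set_reg 47 (Suc W) \<sigma>)\<lparr>mem := \<mu>\<rparr>"
  have r: "reg \<sigma> 0 = 0" "reg \<sigma> 1 = 1" "reg \<sigma> 5 = W" "reg \<sigma> 32 = region (Suc e) b k" "reg \<sigma> 33 = region 0 b k"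
    "reg \<sigma> 34 = k * W" "reg \<sigma> 35 = W"
    using gl cr by (simp_all add: globals_def copy_regs_def)
  have \<mu>: "\<mu> (region e' b' k' + a) = mem \<sigma> (region e' b' k' + a)" for e' b' k' a
    using region_ge[of e' b' k'] size_facts(2) by (simp add: \<mu>_def)
  have ov: "overlay \<mu> (region e1 b1 k1) (region e2 b2 k2) a = overlay (mem \<sigma>) (region e1 b1 k1) (region e2 b2 k2) a"
    for e1 b1 k1 e2 b2 k2 a by (simp add: overlay_def \<mu>)
  have inv\<mu>: "mem_inv H C \<mu>"
    using inv by (simp add: mem_inv_def ov \<mu>) (simp add: \<mu>_def)
  have gm\<mu>: "globals_mem t \<mu>"
    using gm size_facts(2) by (simp add: globals_mem_def \<mu>_def)
  have pr: "\<mu> (W + a) = pair_input ?u ?v a" if "a \<le> V" for a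
  proof -
    consider "a = 0" | "a = 1" | "2 \<le> a" by linarith
    then show ?thesis
      by cases (use inv\<mu> that in \<open>auto simp: \<mu>_def pair_input_def mem_inv_def\<close>)
  qed
  have reg\<tau>: "reg \<tau>0 32 = region (Suc e) b k" "reg \<tau>0 33 = region 0 b k" "reg \<tau>0 34 = k * W" "reg \<tau>0 35 = W"
    "reg \<tau>0 0 = 0" "reg \<tau>0 1 = 1" "mem \<tau>0 = \<mu>"
    by (simp_all add: \<tau>0_def r r(2)[simplified])
  have rl: "region (Suc e) b k + W \<le> B" "region 0 b k + W \<le> B" by (rule region_le; use e b k in simp)+
  have kW: "k * W + W \<le> K * W + W" using k by (simp add: mult_le_mono)
  have far: "region e' b' k' + V < region e b k \<or> region e b k + V < region e' b' k'"
    if "(e', b', k') \<noteq> (e, b, k)" "b < NB" "b' < NB" "k \<le> K" "k' \<le> K" for e b k e' b' k'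
  proof (rule ccontr)
    assume "\<not> ?thesis"
    then have "\<exists>i\<le>V. \<exists>i'\<le>V. region e b k + i = region e' b' k' + i'"
      by (metis (no_types, opaque_lifting) add.commute le_Suc_ex nat_add_left_cancel_le not_less le_cases add_0_right le0)
    then show False using region_eq_iff[of e b k _ e' b' k'] that V(2) by (metis le_less_trans prod.inject)
  qed
  have sep: "region (Suc e) b k + V < region 0 b k \<or> region 0 b k + V < region (Suc e) b k"
    by (rule far) (use b k in auto)
  have main: "runs B coin inp (simulate_call c) \<tau>0 (\<lambda>u \<tau>.
      u \<le> 8 * call_time V (coins_of k) (memory k (H e b k)) ?call + reg_bound c + 1 \<and>
      (\<forall>a\<le>V. overlay (mem \<tau>) (reg \<tau>0 32) (reg \<tau>0 33) a = call_mem V (coins_of k) (memory k (H e b k)) ?call a \<and>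
        call_mem V (coins_of k) (memory k (H e b k)) ?call a \<le> V) \<and>
      (\<forall>a. a < reg \<tau>0 32 \<or> reg \<tau>0 32 + V < a \<longrightarrow> mem \<tau> a = mem \<tau>0 a) \<and>
      agree 50 \<tau>0 \<tau> \<and> outp \<tau> = outp \<tau>0 \<and> reg \<tau> 50 = call_out V (coins_of k) (memory k (H e b k)) ?call 0)"
  proof (rule runs_simulate_call[OF ha])
    show "overlay (mem \<tau>0) (reg \<tau>0 32) (reg \<tau>0 33) a = memory k (H e b k) a" "memory k (H e b k) a \<le> V" if "a \<le> V" for a
      using inv\<mu> b k that unfolding reg\<tau> mem_inv_def by blast+
    show "reg \<tau>0 33 = reg \<tau>0 32 \<or> reg \<tau>0 32 + V < reg \<tau>0 33 \<or> reg \<tau>0 33 + V < reg \<tau>0 32"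
      using sep unfolding reg\<tau> by blast
    show "reg \<tau>0 32 + V < reg \<tau>0 35 \<or> reg \<tau>0 35 + V < reg \<tau>0 32"
      using region_ge[of "Suc e" b k] V(2) unfolding reg\<tau> by linarith
    show "mem \<tau>0 (reg \<tau>0 35 + a) = pair_input ?u ?v a" if "a \<le> V" for a
      using pr[OF that] unfolding reg\<tau> .
    show "coin (reg \<tau>0 34 + a) = coins_of k a" if "a \<le> V" for a
      using that unfolding reg\<tau> by (simp add: coins_of_def)
    show "reg \<tau>0 32 + V \<le> B" "reg \<tau>0 33 + V \<le> B" "reg \<tau>0 34 + V \<le> B" "reg \<tau>0 35 + V \<le> B" "V + 1 \<le> B"
      using rl kW V(2) size_facts(6,7,16) unfolding reg\<tau> by linarith+
  qed (simp_all add: reg\<tau> reg\<tau>(6)[simplified] V(1)[simplified])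
  have "runs B coin inp (simulate_call c) \<tau>0 (\<lambda>u \<tau>.
    u + 4 \<le> 8 * call_time V (coins_of k) (memory k (H e b k)) ?call + reg_bound c + 5 \<and>
    agree 47 \<sigma> \<tau> \<and> outp \<tau> = outp \<sigma> \<and> globals_mem t (mem \<tau>) \<and>
    mem_inv (upd3 H e b k (H e b k @ [?call])) C (mem \<tau>) \<and>
    reg \<tau> 50 = call_out V (coins_of k) (memory k (H e b k)) ?call 0)"
  proof (rule runs_mono[OF main], elim conjE)
    fix u \<tau>
    assume u: "u \<le> 8 * call_time V (coins_of k) (memory k (H e b k)) ?call + reg_bound c + 1"
      and new: "\<forall>a\<le>V. overlay (mem \<tau>) (reg \<tau>0 32) (reg \<tau>0 33) a = call_mem V (coins_of k) (memory k (H e b k)) ?call a \<and>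
        call_mem V (coins_of k) (memory k (H e b k)) ?call a \<le> V"
      and old: "\<forall>a. a < reg \<tau>0 32 \<or> reg \<tau>0 32 + V < a \<longrightarrow> mem \<tau> a = mem \<tau>0 a"
      and rest: "agree 50 \<tau>0 \<tau>" "outp \<tau> = outp \<tau>0" "reg \<tau> 50 = call_out V (coins_of k) (memory k (H e b k)) ?call 0"
    have ag: "agree 47 \<sigma> \<tau>" using rest(1) by (auto simp: agree_def \<tau>0_def)
    have low: "mem \<tau> a = \<mu> a" if "a < 2 * W" for a
      using old that region_ge[of "Suc e" b k] by (simp add: reg\<tau>)
    have same: "mem \<tau> (region e' b' k' + a) = \<mu> (region e' b' k' + a)"
      if "(e', b', k') \<noteq> (Suc e, b, k)" "b' < NB" "k' \<le> K" "a < W" for e' b' k' a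
    proof -
      have "\<not> (region (Suc e) b k \<le> region e' b' k' + a \<and> region e' b' k' + a \<le> region (Suc e) b k + V)"
      proof
        assume *: "region (Suc e) b k \<le> region e' b' k' + a \<and> region e' b' k' + a \<le> region (Suc e) b k + V"
        then obtain i where "region e' b' k' + a = region (Suc e) b k + i" "i \<le> V"
          by (metis add_le_cancel_left le_Suc_ex)
        then show False using region_eq_iff[of e' b' k' a "Suc e" b k i] that b k V by auto
      qed
      then show ?thesis using old by (auto simp: reg\<tau>)
    qed
    have snoc: "memory k (H e b k @ [?call]) = call_mem V (coins_of k) (memory k (H e b k)) ?call"
      by (simp add: memory_def mem_after_append)
    have "mem_inv (upd3 H e b k (H e b k @ [?call])) C (mem \<tau>)"
      unfolding mem_inv_def
    proof (intro conjI allI impI)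
      fix e' b' k' a assume *: "b' < NB" "k' < K" "a \<le> V"
      have aW: "a < W" using * V by simp
      have "overlay (mem \<tau>) (region (Suc e') b' k') (region 0 b' k') a =
          memory k' (upd3 H e b k (H e b k @ [?call]) e' b' k') a \<and>
          memory k' (upd3 H e b k (H e b k @ [?call]) e' b' k') a \<le> V"
      proof (cases "(e', b', k') = (e, b, k)")
        case True
        then show ?thesis using new * by (simp add: upd3_def snoc reg\<tau>)
      next
        case False
        have "overlay (mem \<tau>) (region (Suc e') b' k') (region 0 b' k') a =
            overlay \<mu> (region (Suc e') b' k') (region 0 b' k') a"
          using same[of "Suc e'" b' k' a] same[of 0 b' k' a] False * aW by (auto simp: overlay_def)
        then show ?thesis using inv\<mu> * False by (auto simp: mem_inv_def upd3_def)
      qed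
      then show "overlay (mem \<tau>) (region (Suc e') b' k') (region 0 b' k') a =
          memory k' (upd3 H e b k (H e b k @ [?call]) e' b' k') a"
        "memory k' (upd3 H e b k (H e b k @ [?call]) e' b' k') a \<le> V" by simp_all
    next
      fix e' b' i assume "b' < NB" "i < h * h"
      then show "mem \<tau> (region (Suc e') b' K + i) = C e' b' i"
        using same[of "Suc e'" b' K i] inv\<mu> k size_facts(1) by (auto simp: mem_inv_def)
    next
      fix a assume "2 \<le> a" "a \<le> V"
      then show "mem \<tau> (W + a) = 0"
        using low[of "W + a"] inv\<mu> V by (auto simp: mem_inv_def)
    qed
    moreover have "globals_mem t (mem \<tau>)"
      using gm\<mu> low size_facts(2) by (simp add: globals_mem_def)
    ultimately show "u + 4 \<le> 8 * call_time V (coins_of k) (memory k (H e b k)) ?call + reg_bound c + 5 \<and>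
      agree 47 \<sigma> \<tau> \<and> outp \<tau> = outp \<sigma> \<and> globals_mem t (mem \<tau>) \<and>
      mem_inv (upd3 H e b k (H e b k @ [?call])) C (mem \<tau>) \<and>
      reg \<tau> 50 = call_out V (coins_of k) (memory k (H e b k)) ?call 0"
      using u rest ag by (simp add: \<tau>0_def)
  qed
  moreover have "Suc W \<le> B" using size_facts by simp
  ultimately show ?thesis
    using size_facts(6) unfolding send_code_def
    by (simp add: runs_simps r r(2)[simplified] \<tau>0_def \<mu>_def set_reg_def)
qed

lemma globalsD:
  assumes "globals \<sigma>"
  shows "reg \<sigma> 0 = 0" "reg \<sigma> (Suc 0) = 1" "reg \<sigma> 2 = n" "reg \<sigma> 3 = h" "reg \<sigma> 4 = w" "reg \<sigma> 5 = W"
    "reg \<sigma> 6 = nb2" "reg \<sigma> 7 = NB" "reg \<sigma> 8 = K" "reg \<sigma> 9 = h + 1" "reg \<sigma> 11 = h + 1 + w"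
    "reg \<sigma> 12 = n'" "reg \<sigma> 13 = K + 1" "reg \<sigma> 17 = 2"
  using assms by (simp_all add: globals_def)

lemma globals_set_reg: "18 \<le> x \<or> x = 10 \<or> x = 14 \<or> x = 15 \<or> x = 16 \<Longrightarrow> globals (set_reg x v \<sigma>) = globals \<sigma>"
  by (auto simp: globals_def)

lemma globals_upd: "globals (\<sigma>\<lparr>mem := \<mu>\<rparr>) = globals \<sigma>" "globals (\<sigma>\<lparr>outp := \<mu>\<rparr>) = globals \<sigma>"
  by (simp_all add: globals_def)

lemma copy_regs_set_reg: "36 \<le> x \<Longrightarrow> copy_regs e b k (set_reg x v \<sigma>) = copy_regs e b k \<sigma>"
  by (auto simp: copy_regs_def)

section \<open>Loops over columns and rows\<close>

abbreviation rc :: "request \<Rightarrow> call" where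
  "rc \<equiv> request_call A"

abbreviation tt :: "nat \<Rightarrow> call list \<Rightarrow> nat" where
  "tt k \<equiv> total_time V (coins_of k)"

abbreviation regs_bound :: nat where
  "regs_bound \<equiv> reg_bound (dom_preprocess A) + reg_bound (dom_update A) + reg_bound (dom_query A)"

lemma tt_snoc: "tt k (H @ [c]) = tt k H + call_time V (coins_of k) (memory k H) c"
  by (simp add: total_time_snoc memory_def)

lemma upd3_same: "upd3 F x y z (F x y z) = F"
  by (auto simp: upd3_def fun_eq_iff)

lemma update_reqs_Suc:
  "update_reqs h c v f (Suc j) = update_reqs h c v f j @ (if of_bool (v j) = f then [Update c (h + 1 + j)] else [])"
  by (simp add: update_reqs_def)

lemma query_reqs_Suc: "query_reqs h w c (Suc i) = query_reqs h w c i @ [Query c (h + 1 + w + i)]"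
  by (simp add: query_reqs_def)

lemma col_le: "b mod nb2 * w \<le> n"
proof -
  have "b mod nb2 \<le> n div w" by (metis Suc_eq_plus1 less_Suc_eq_le mod_less_divisor nb2_def zero_less_Suc)
  then have "b mod nb2 * w \<le> n div w * w" by (rule mult_le_mono1)
  also have "\<dots> \<le> n" by simp
  finally show ?thesis .
qed

lemma row_le: "b < NB \<Longrightarrow> b div nb2 * h \<le> n"
proof -
  assume "b < NB"
  then have "b div nb2 < n div h + 1" unfolding NB_def by (simp add: less_mult_imp_div_less)
  then have "b div nb2 \<le> n div h" by simp
  then have "b div nb2 * h \<le> n div h * h" by (rule mult_le_mono1)
  also have "\<dots> \<le> n" by simp
  finally show ?thesis .
qed

text \<open>The potential of the loop is eight times the simulated time of the history so far plus a
  constant per column. Bounds of this form telescope over loops and rounds, so that only the total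
  time of a whole epoch has to be known.\<close>

lemma runs_update_loop:
  assumes gl: "globals \<sigma>" and cr: "copy_regs e b k \<sigma>" and c: "reg \<sigma> 16 = c"
    and col: "reg \<sigma> 24 = b mod nb2 * w"
    and b: "b < NB" and k: "k < K" and e: "e \<le> n" and f: "f \<le> 2"
    and inv: "mem_inv H C (mem \<sigma>)" and gm: "globals_mem t (mem \<sigma>)"
    and inp: "\<And>j. j < w \<Longrightarrow> inp (b mod nb2 * w + j) = of_bool (v j)"
    and ha: "\<And>j. j < w \<Longrightarrow> of_bool (v j) = f \<Longrightarrow>
      halts V (coins_of k) (memory k (H e b k @ map rc (update_reqs h c v f j))) (rc (Update c (h + 1 + j)))"
  shows "runs B coin inp (update_loop A f) \<sigma> (\<lambda>u \<tau>.
    u + 8 * tt k (H e b k) \<le> 8 * tt k (H e b k @ map rc (update_reqs h c v f w)) + w * (regs_bound + 20) + 4 \<and>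
    agree 40 \<sigma> \<tau> \<and> outp \<tau> = outp \<sigma> \<and> globals_mem t (mem \<tau>) \<and>
    mem_inv (upd3 H e b k (H e b k @ map rc (update_reqs h c v f w))) C (mem \<tau>))"
proof -
  let ?H = "\<lambda>j. H e b k @ map rc (update_reqs h c v f j)"
  let ?J = "\<lambda>j \<mu> out. out = outp \<sigma> \<and> globals_mem t \<mu> \<and> mem_inv (upd3 H e b k (?H j)) C \<mu>"
  let ?\<Phi> = "\<lambda>j. 8 * tt k (?H j) + j * (regs_bound + 20)"
  have "runs B coin inp (update_loop A f) \<sigma> (\<lambda>u \<tau>. u + ?\<Phi> 0 \<le> ?\<Phi> (reg \<sigma> 4) + 4 \<and> agree 40 \<sigma> \<tau> \<and>
     ?J (reg \<sigma> 4) (mem \<tau>) (outp \<tau>))"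
    unfolding update_loop_def
  proof (rule runs_For)
    fix j \<tau>
    assume j: "j < reg \<sigma> 4" and ag: "agree 40 \<sigma> \<tau>" and rj: "reg \<tau> 40 = j" and J: "?J j (mem \<tau>) (outp \<tau>)"
    have jw: "j < w" using j gl by (simp add: globals_def)
    have gl': "globals \<tau>" by (rule globals_agree[OF gl ag]) simp
    have cr': "copy_regs e b k \<tau>" by (rule copy_regs_agree[OF cr ag]) simp
    have r: "reg \<tau> 24 = b mod nb2 * w" "reg \<tau> 16 = c" using agreeD[OF ag] col c by simp_all
    have bnd: "b mod nb2 * w + j \<le> B" "f \<le> B" "h + 1 + j \<le> B" "Suc 0 \<le> B"
      using col_le[of b] jw bound(2) f size_facts(2,6) size_facts(13) unfolding n'_def by linarith+
    show "runs B coin inp (seqs [Arith Add 42 24 40, Input 43 42, Const 44 f, Arith Equal 45 43 44,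
        If 45 (Seq (Arith Add 46 9 40) (send_code (dom_update A))) Skip]) \<tau>
      (\<lambda>u \<tau>'. u + ?\<Phi> j + 4 \<le> ?\<Phi> (Suc j) \<and> agree (40 + 2) \<tau> \<tau>' \<and> ?J (Suc j) (mem \<tau>') (outp \<tau>'))"
    proof (cases "of_bool (v j) = f")
      case False
      then show ?thesis
        using bnd J by (simp add: runs_simps r rj inp[OF jw] update_reqs_Suc agree_refl)
    next
      case True
      have Hs: "?H (Suc j) = ?H j @ [rc (Update c (h + 1 + j))]" using True by (simp add: update_reqs_Suc)
      have "runs B coin inp (send_code (dom_update A)) (set_reg 46 (h + 1 + j) (set_reg 45 1 (set_reg 44 f
          (set_reg 43 (of_bool (v j)) (set_reg 42 (b mod nb2 * w + j) \<tau>)))))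
        (\<lambda>u \<tau>'. u + ?\<Phi> j + 12 \<le> ?\<Phi> (Suc j) \<and> agree (40 + 2) \<tau> \<tau>' \<and> ?J (Suc j) (mem \<tau>') (outp \<tau>'))"
        (is "runs B coin inp _ ?\<tau> _")
      proof (rule runs_mono[OF runs_send[where e = e and b = b and k = k and H = "upd3 H e b k (?H j)" and C = C and t = t]])
        show "globals ?\<tau>" using gl' by (simp add: globals_set_reg)
        show "copy_regs e b k ?\<tau>" using cr' by (simp add: copy_regs_set_reg)
        show "mem_inv (upd3 H e b k (?H j)) C (mem ?\<tau>)" "globals_mem t (mem ?\<tau>)" using J by simp_all
        show "halts V (coins_of k) (memory k (upd3 H e b k (?H j) e b k)) (dom_update A, pair_input (reg ?\<tau> 16) (reg ?\<tau> 46))"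
          using ha[OF jw True] r by (simp add: upd3_def)
      next
        fix u \<tau>'
        let ?call = "(dom_update A, pair_input (reg ?\<tau> 16) (reg ?\<tau> 46))"
        assume *: "u \<le> 8 * call_time V (coins_of k) (memory k (upd3 H e b k (?H j) e b k)) ?call + reg_bound (dom_update A) + 5 \<and>
          agree 47 ?\<tau> \<tau>' \<and> outp \<tau>' = outp ?\<tau> \<and> globals_mem t (mem \<tau>') \<and>
          mem_inv (upd3 (upd3 H e b k (?H j)) e b k (upd3 H e b k (?H j) e b k @ [?call])) C (mem \<tau>') \<and>
          reg \<tau>' 50 = call_out V (coins_of k) (memory k (upd3 H e b k (?H j) e b k)) ?call 0"
        have call: "?call = rc (Update c (h + 1 + j))" using r by simp
        have H1: "upd3 H e b k (?H j) e b k = ?H j" by (simp add: upd3_def)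
        have H2: "upd3 (upd3 H e b k (?H j)) e b k (?H j @ [?call]) = upd3 H e b k (?H (Suc j))"
          unfolding Hs call by (auto simp: upd3_def fun_eq_iff)
        have "agree 42 \<tau> \<tau>'" using * by (auto simp: agree_def)
        moreover have "tt k (?H (Suc j)) = tt k (?H j) + call_time V (coins_of k) (memory k (?H j)) ?call"
          unfolding Hs tt_snoc call ..
        ultimately show "u + ?\<Phi> j + 12 \<le> ?\<Phi> (Suc j) \<and> agree (40 + 2) \<tau> \<tau>' \<and> ?J (Suc j) (mem \<tau>') (outp \<tau>')"
          using * J unfolding H1 H2 by simp
      qed (use b k e in auto)
      then have "runs B coin inp (send_code (dom_update A)) ?\<tau>
        (\<lambda>u \<tau>'. (u + 7) + ?\<Phi> j + 4 \<le> ?\<Phi> (Suc j) \<and> agree (40 + 2) \<tau> \<tau>' \<and> ?J (Suc j) (mem \<tau>') (outp \<tau>'))"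
        by (rule runs_mono) auto
      then show ?thesis
        using bnd True by (simp add: runs_simps r rj inp[OF jw] globalsD[OF gl'])
    qed
  next
    show "?J 0 (mem \<sigma>) (outp \<sigma>)" using inv gm by (simp add: update_reqs_def upd3_same)
  qed (use gl size_facts in \<open>simp_all add: globals_def\<close>)
  then show ?thesis
    by (rule runs_mono) (simp add: globalsD[OF gl] update_reqs_def)
qed

lemma mem_inv_store:
  assumes "mem_inv H C \<mu>" "b < NB" "i < h * h"
  shows "mem_inv H (upd3 C e b i x) (\<mu>(region (Suc e) b K + i := x))"
proof -
  have iW: "i < W" using assms(3) size_facts(1) by simp
  have ne: "region e' b' k' + a \<noteq> region (Suc e) b K + i" if "b' < NB" "k' < K" "a \<le> V" for e' b' k' a
  proof
    assume "region e' b' k' + a = region (Suc e) b K + i"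
    from region_eq_iff[OF this] that iW V assms(2) show False by auto
  qed
  have ne2: "region (Suc e') b' K + a = region (Suc e) b K + i \<longleftrightarrow> e' = e \<and> b' = b \<and> a = i" if "b' < NB" "a < h * h" for e' b' a
  proof
    assume "region (Suc e') b' K + a = region (Suc e) b K + i"
    from region_eq_iff[OF this] that iW size_facts(1) assms(2) show "e' = e \<and> b' = b \<and> a = i" by auto
  qed simp
  have ne3: "W + a \<noteq> region (Suc e) b K + i" if "a \<le> V" for a
    using region_ge[of "Suc e" b K] that V by linarith
  have ov: "overlay (\<mu>(region (Suc e) b K + i := x)) (region (Suc e') b' k') (region 0 b' k') a =
      overlay \<mu> (region (Suc e') b' k') (region 0 b' k') a" if "b' < NB" "k' < K" "a \<le> V" for e' b' k' a
    using that by (simp add: overlay_def ne)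
  show ?thesis
    using assms(1) unfolding mem_inv_def
    by (simp add: ov ne2 ne3 upd3_def)
qed

lemma globals_mem_store: "globals_mem t \<mu> \<Longrightarrow> globals_mem t (\<mu>(region e b k + i := x))"
  using region_ge[of e b k] size_facts(2) by (simp add: globals_mem_def)

definition answer :: "nat \<Rightarrow> call list \<Rightarrow> nat \<Rightarrow> nat \<Rightarrow> bool" where
  "answer k H c i \<longleftrightarrow> call_out V (coins_of k) (memory k (H @ map rc (query_reqs h w c i))) (rc (Query c (h + 1 + w + i))) 0 = 1"

lemma runs_query_loop:
  assumes gl: "globals \<sigma>" and cr: "copy_regs e b k \<sigma>" and c: "reg \<sigma> 16 = c"
    and cnt: "reg \<sigma> 22 = region (Suc e) b K + r * h"
    and b: "b < NB" and k: "k < K" and e: "e \<le> n" and r: "r < h"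
    and inv: "mem_inv H C (mem \<sigma>)" and gm: "globals_mem t (mem \<sigma>)"
    and C: "\<And>i. i < h \<Longrightarrow> C e b (r * h + i) \<le> K"
    and ha: "\<And>i. i < h \<Longrightarrow> halts V (coins_of k) (memory k (H e b k @ map rc (query_reqs h w c i))) (rc (Query c (h + 1 + w + i)))"
  shows "runs B coin inp (query_loop A) \<sigma> (\<lambda>u \<tau>.
    u + 8 * tt k (H e b k) \<le> 8 * tt k (H e b k @ map rc (query_reqs h w c h)) + h * (regs_bound + 20) + 4 \<and>
    agree 40 \<sigma> \<tau> \<and> outp \<tau> = outp \<sigma> \<and> globals_mem t (mem \<tau>) \<and>
    mem_inv (upd3 H e b k (H e b k @ map rc (query_reqs h w c h)))
      (\<lambda>e' b' x. C e' b' x + (if e' = e \<and> b' = b \<and> r * h \<le> x \<and> x < r * h + h then of_bool (answer k (H e b k) c (x - r * h)) else 0))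
      (mem \<tau>))"
proof -
  let ?H = "\<lambda>i. H e b k @ map rc (query_reqs h w c i)"
  let ?C = "\<lambda>i e' b' x. C e' b' x + (if e' = e \<and> b' = b \<and> r * h \<le> x \<and> x < r * h + i then of_bool (answer k (H e b k) c (x - r * h)) else 0)"
  let ?J = "\<lambda>j \<mu> out. out = outp \<sigma> \<and> globals_mem t \<mu> \<and> mem_inv (upd3 H e b k (?H j)) (?C j) \<mu>"
  let ?\<Phi> = "\<lambda>j. 8 * tt k (?H j) + j * (regs_bound + 20)"
  have "runs B coin inp (query_loop A) \<sigma> (\<lambda>u \<tau>. u + ?\<Phi> 0 \<le> ?\<Phi> (reg \<sigma> 3) + 4 \<and> agree 40 \<sigma> \<tau> \<and>
     ?J (reg \<sigma> 3) (mem \<tau>) (outp \<tau>))"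
    unfolding query_loop_def
  proof (rule runs_For)
    fix j \<tau>
    assume j: "j < reg \<sigma> 3" and ag: "agree 40 \<sigma> \<tau>" and rj: "reg \<tau> 40 = j" and J: "?J j (mem \<tau>) (outp \<tau>)"
    have jh: "j < h" using j gl by (simp add: globals_def)
    have gl': "globals \<tau>" by (rule globals_agree[OF gl ag]) simp
    have cr': "copy_regs e b k \<tau>" by (rule copy_regs_agree[OF cr ag]) simp
    have rr: "reg \<tau> 22 = region (Suc e) b K + r * h" "reg \<tau> 16 = c" using agreeD[OF ag] cnt c by simp_all
    have "r * h + j < r * h + h" using jh by simp
    also have "\<dots> = Suc r * h" by simp
    also have "\<dots> \<le> h * h" using r by (intro mult_le_mono1) simp
    finally have cell: "r * h + j < h * h" .
    have "region (Suc e) b K + W \<le> B" by (rule region_le) (use e b in auto)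
    then have bnd: "region (Suc e) b K + (r * h + j) \<le> B" "h + 1 + w + j \<le> B" "Suc 0 \<le> B" "Suc (C e b (r * h + j)) \<le> B"
      using cell jh size_facts(1,8,11,13) C[OF jh] unfolding n'_def by linarith+
    let ?a = "of_bool (answer k (H e b k) c j) :: nat"
    have Hs: "?H (Suc j) = ?H j @ [rc (Query c (h + 1 + w + j))]" by (simp add: query_reqs_Suc)
    have Cs: "?C (Suc j) = upd3 (?C j) e b (r * h + j) (C e b (r * h + j) + ?a)"
      by (auto simp: upd3_def fun_eq_iff)
    have H1: "upd3 H e b k (?H j) e b k = ?H j" by (simp add: upd3_def)
    let ?\<tau> = "set_reg 46 (h + 1 + w + j) \<tau>"
    let ?call = "(dom_query A, pair_input (reg ?\<tau> 16) (reg ?\<tau> 46))"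
    have call: "?call = rc (Query c (h + 1 + w + j))" using rr by simp
    have H2: "upd3 (upd3 H e b k (?H j)) e b k (?H j @ [?call]) = upd3 H e b k (?H (Suc j))"
      unfolding Hs call by (auto simp: upd3_def fun_eq_iff)
    have T: "tt k (?H (Suc j)) = tt k (?H j) + call_time V (coins_of k) (memory k (?H j)) ?call"
      unfolding Hs tt_snoc call ..
    have "runs B coin inp (send_code (dom_query A)) ?\<tau>
        (\<lambda>u \<tau>'. runs B coin inp (seqs [Arith Equal 42 50 1, Arith Add 43 22 40, Load 44 43, Arith Add 44 44 42, Store 43 44]) \<tau>'
          (\<lambda>u' \<tau>''. (u + u' + 1) + ?\<Phi> j + 4 \<le> ?\<Phi> (Suc j) \<and> agree 42 \<tau> \<tau>'' \<and> ?J (Suc j) (mem \<tau>'') (outp \<tau>'')))"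
    proof (rule runs_mono[OF runs_send[where e = e and b = b and k = k and H = "upd3 H e b k (?H j)" and C = "?C j" and t = t]])
      show "globals ?\<tau>" using gl' by (simp add: globals_set_reg)
      show "copy_regs e b k ?\<tau>" using cr' by (simp add: copy_regs_set_reg)
      show "mem_inv (upd3 H e b k (?H j)) (?C j) (mem ?\<tau>)" "globals_mem t (mem ?\<tau>)" using J by simp_all
      show "halts V (coins_of k) (memory k (upd3 H e b k (?H j) e b k)) ?call"
        using ha[OF jh] unfolding H1 call .
    next
      fix u \<tau>'
      assume *: "u \<le> 8 * call_time V (coins_of k) (memory k (upd3 H e b k (?H j) e b k)) ?call + reg_bound (dom_query A) + 5 \<and>
        agree 47 ?\<tau> \<tau>' \<and> outp \<tau>' = outp ?\<tau> \<and> globals_mem t (mem \<tau>') \<and>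
        mem_inv (upd3 (upd3 H e b k (?H j)) e b k (upd3 H e b k (?H j) e b k @ [?call])) (?C j) (mem \<tau>') \<and>
        reg \<tau>' 50 = call_out V (coins_of k) (memory k (upd3 H e b k (?H j) e b k)) ?call 0"
      have ag': "agree 46 \<tau> \<tau>'" using * by (auto simp: agree_def)
      have gl'': "globals \<tau>'" by (rule globals_agree[OF gl' ag']) simp
      have r22: "reg \<tau>' 22 = region (Suc e) b K + r * h" "reg \<tau>' 40 = j" using agreeD[OF ag'] rr rj by simp_all
      have mi: "mem_inv (upd3 H e b k (?H (Suc j))) (?C j) (mem \<tau>')" using * unfolding H1 H2 by blast
      have old: "mem \<tau>' (region (Suc e) b K + (r * h + j)) = C e b (r * h + j)"
        using mi b cell unfolding mem_inv_def by simp
      have r50: "(if reg \<tau>' 50 = Suc 0 then 1 else 0) = ?a"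
        using * unfolding H1 call by (simp add: answer_def)
      let ?\<mu> = "(mem \<tau>')(region (Suc e) b K + (r * h + j) := C e b (r * h + j) + ?a)"
      have mi': "mem_inv (upd3 H e b k (?H (Suc j))) (?C (Suc j)) ?\<mu>"
        unfolding Cs by (rule mem_inv_store[OF mi b cell])
      have gm': "globals_mem t ?\<mu>" by (rule globals_mem_store) (use * in blast)
      have ob: "of_bool (reg \<tau>' 50 = Suc 0) = ?a"
        using * unfolding H1 call by (simp add: answer_def)
      have aB: "C e b (r * h + j) + ?a \<le> B" "?a \<le> B" using bnd by auto
      have u: "u \<le> 8 * call_time V (coins_of k) (memory k (?H j)) ?call + reg_bound (dom_query A) + 5"
        using * unfolding H1 by blast
      have time: "(u + 6 + 1) + ?\<Phi> j + 4 \<le> ?\<Phi> (Suc j)" using u unfolding T by simp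
      show "runs B coin inp (seqs [Arith Equal 42 50 1, Arith Add 43 22 40, Load 44 43, Arith Add 44 44 42, Store 43 44]) \<tau>'
          (\<lambda>u' \<tau>''. (u + u' + 1) + ?\<Phi> j + 4 \<le> ?\<Phi> (Suc j) \<and> agree 42 \<tau> \<tau>'' \<and> ?J (Suc j) (mem \<tau>'') (outp \<tau>''))"
      proof -
        have "runs B coin inp (seqs [Arith Equal 42 50 1, Arith Add 43 22 40, Load 44 43, Arith Add 44 44 42, Store 43 44]) \<tau>'
          (\<lambda>u' \<tau>''. u' = 6 \<and> mem \<tau>'' = ?\<mu> \<and> outp \<tau>'' = outp \<tau>' \<and> agree 42 \<tau>' \<tau>'')"
          using bnd aB by (simp add: runs_simps r22 globalsD[OF gl''] old ob agree_refl add.assoc)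
        then show ?thesis
        proof (rule runs_mono, elim conjE)
          fix u' :: nat and \<tau>'' :: state assume x: "u' = 6" "mem \<tau>'' = ?\<mu>" "outp \<tau>'' = outp \<tau>'" "agree 42 \<tau>' \<tau>''"
          have "outp \<tau>'' = outp \<sigma>" using x(3) * J by simp
          moreover have "agree 42 \<tau> \<tau>''" using agree_trans[OF agree_mono[OF ag', of 42] x(4)] by simp
          ultimately show "(u + u' + 1) + ?\<Phi> j + 4 \<le> ?\<Phi> (Suc j) \<and> agree 42 \<tau> \<tau>'' \<and> ?J (Suc j) (mem \<tau>'') (outp \<tau>'')"
            using time mi' gm' unfolding x(1,2) by blast
        qed
      qed
    qed (use b k e in auto)
    then show "runs B coin inp (seqs [Arith Add 46 11 40, send_code (dom_query A), Arith Equal 42 50 1,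
        Arith Add 43 22 40, Load 44 43, Arith Add 44 44 42, Store 43 44]) \<tau>
      (\<lambda>u \<tau>'. u + ?\<Phi> j + 4 \<le> ?\<Phi> (Suc j) \<and> agree (40 + 2) \<tau> \<tau>' \<and> ?J (Suc j) (mem \<tau>') (outp \<tau>'))"
      using bnd(2) by (simp only: seqs.simps(2)[of "Arith Add 46 11 40"] seqs.simps(2)[of "send_code (dom_query A)"] runs_Seq runs_Arith
          arith_op.simps rj globalsD[OF gl']) (simp add: add.commute add.left_commute)
  next
    have "?C 0 = C" by (auto simp: fun_eq_iff)
    then show "?J 0 (mem \<sigma>) (outp \<sigma>)" using inv gm by (simp only:) (simp add: query_reqs_def upd3_same)
  qed (use gl size_facts in \<open>simp_all add: globals_def\<close>)
  then show ?thesis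
    by (rule runs_mono) (simp add: globalsD[OF gl] query_reqs_def)
qed

end

lemma set_reg_twice [simp]: "set_reg x u (set_reg x v \<sigma>) = set_reg x u \<sigma>"
  by (simp add: set_reg_def)

lemma epoch_reqs_split:
  assumes "r < k"
  shows "\<exists>ys. epoch_reqs md h w vs k = epoch_reqs md h w vs r @ round_reqs md h w (vs r) r @ ys"
proof -
  have "[0..<k] = [0..<r] @ r # [Suc r..<k]"
    using assms upt_add_eq_append[of 0 r "k - r"] by (simp add: upt_conv_Cons)
  then show ?thesis by (simp add: epoch_reqs_def)
qed

lemma update_reqs_split:
  assumes "j < k" "of_bool (v j) = f"
  shows "\<exists>ys. update_reqs h c v f k = update_reqs h c v f j @ Update c (h + 1 + j) # ys"
proof -
  have "[0..<k] = [0..<j] @ j # [Suc j..<k]"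
    using assms upt_add_eq_append[of 0 j "k - j"] by (simp add: upt_conv_Cons)
  then show ?thesis using assms(2) by (simp add: update_reqs_def)
qed

lemma query_reqs_split:
  assumes "j < k"
  shows "\<exists>ys. query_reqs h w c k = query_reqs h w c j @ Query c (h + 1 + w + j) # ys"
proof -
  have "[0..<k] = [0..<j] @ j # [Suc j..<k]"
    using assms upt_add_eq_append[of 0 j "k - j"] by (simp add: upt_conv_Cons)
  then show ?thesis by (simp add: query_reqs_def)
qed

section \<open>Histories, votes and a complete round\<close>

context omv_run
begin

definition vec :: "nat \<Rightarrow> nat \<Rightarrow> nat \<Rightarrow> nat \<Rightarrow> bool" where
  "vec e b r j \<longleftrightarrow> vector_input n (vs ! (e * h + r)) (b mod nb2 * w + j) = 1"

text \<open>A block at the right border may read past the end of a matrix row into the next one.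
  This is harmless, as \<open>vec\<close> is false in those columns. Rows below the matrix read as
  zero.\<close>

definition block_matrix :: "nat \<Rightarrow> nat \<Rightarrow> nat \<Rightarrow> bool" where
  "block_matrix b i j \<longleftrightarrow> matrix_input n M ((b div nb2 * h + i) * n + (b mod nb2 * w + j) + 1) = 1"

definition pre_call :: "nat \<Rightarrow> call" where
  "pre_call b = (dom_preprocess A, graph_input n' 0 (init_arcs md h w (block_matrix b)))"

definition hist :: "nat \<Rightarrow> nat \<Rightarrow> nat \<Rightarrow> call list" where
  "hist e b d = pre_call b # map rc (epoch_reqs md h w (vec e b) d)"

text \<open>\<open>D b k\<close> is the number of rounds that copy \<open>k\<close> of block
  \<open>b\<close> has finished, counted over all epochs; it depends on \<open>b\<close> and
  \<open>k\<close> because blocks and copies advance one after the other. Truncated subtraction and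
  \<open>min\<close> give \<open>h\<close> rounds for past epochs, a partial number for the current
  epoch and none for later ones.\<close>

definition all_hist :: "(nat \<Rightarrow> nat \<Rightarrow> nat) \<Rightarrow> nat \<Rightarrow> nat \<Rightarrow> nat \<Rightarrow> call list" where
  "all_hist D e b k = hist e b (min h (D b k - e * h))"

text \<open>The index \<open>x\<close> of a vote counter encodes the round \<open>x div h\<close> of
  the epoch and the row \<open>x mod h\<close> of the block.\<close>

definition reply :: "nat \<Rightarrow> nat \<Rightarrow> nat \<Rightarrow> nat \<Rightarrow> bool" where
  "reply e b k x = answer k (hist e b (x div h) @
     map rc (update_reqs h (port md h (x div h)) (vec e b (x div h)) (flag1 md) w)) (port md h (x div h)) (x mod h)"

definition votes :: "(nat \<Rightarrow> nat \<Rightarrow> nat) \<Rightarrow> nat \<Rightarrow> nat \<Rightarrow> nat \<Rightarrow> nat" where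
  "votes D e b x = (\<Sum>k<K. if e * h + x div h < D b k then of_bool (reply e b k x) else 0)"

definition progress_inv :: "(nat \<Rightarrow> nat \<Rightarrow> nat) \<Rightarrow> (nat \<Rightarrow> nat) \<Rightarrow> bool" where
  "progress_inv D \<mu> \<longleftrightarrow> mem_inv (all_hist D) (votes D) \<mu>"

lemma mem_inv_cong:
  assumes "mem_inv H C \<mu>" "\<And>e b k. b < NB \<Longrightarrow> k < K \<Longrightarrow> H e b k = H' e b k"
    "\<And>e b x. b < NB \<Longrightarrow> x < h * h \<Longrightarrow> C e b x = C' e b x"
  shows "mem_inv H' C' \<mu>"
  using assms unfolding mem_inv_def by simp

text \<open>The assumption \<open>halt\<close> speaks of complete epochs; halting of the whole
  sequence includes that each call halts in the memory left by its predecessors.\<close>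

lemma halts_prefix:
  assumes "epoch_reqs md h w (vec e b) h = xs @ q # ys"
  shows "halts V (coins_of k) (memory k (pre_call b # map rc xs)) (rc q)"
proof -
  have "all_halt V (coins_of k) (\<lambda>_. 0) ((pre_call b # map rc xs) @ rc q # map rc ys)"
    using halt[of "coins_of k" "block_matrix b" "vec e b"] assms by (simp add: dom_calls_def pre_call_def)
  then show ?thesis unfolding all_halt_append by (simp add: memory_def)
qed

lemma tt_hist_mono: "d \<le> d' \<Longrightarrow> tt k (hist e b d) \<le> tt k (hist e b d')"
proof -
  assume "d \<le> d'"
  then have "[0..<d'] = [0..<d] @ [d..<d']" using upt_add_eq_append[of 0 d "d' - d"] by simp
  then show ?thesis unfolding hist_def epoch_reqs_def
    by (simp add: total_time_append_ge[of V "coins_of k" "_ # _", simplified])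
qed

lemma block_div_less: "b < NB \<Longrightarrow> b div nb2 \<le> n div h"
  unfolding NB_def using less_mult_imp_div_less[of b "n div h + 1" nb2] by simp

lemma runs_region_code:
  assumes gl: "globals \<sigma>" and r: "reg \<sigma> x = e" "reg \<sigma> y = k" "reg \<sigma> 20 = b"
    and d: "22 \<le> d" "d \<noteq> x" "d \<noteq> y" and le: "region e b k \<le> B"
  shows "runs B coin inp (region_code d x y) \<sigma> (\<lambda>u \<tau>. u = 7 \<and> \<tau> = set_reg d (region e b k) \<sigma>)"
proof -
  have W1: "1 \<le> W" using size_facts(2) by simp
  have 1: "((e * NB + b) * (K + 1) + k + 2) * W \<le> B" using le by (simp add: region_def)
  have 2: "(e * NB + b) * (K + 1) + k + 2 \<le> B"
    by (rule le_trans[OF _ 1]) (use mult_le_mono2[OF W1, of "(e * NB + b) * (K + 1) + k + 2"] in \<open>simp only: mult_1_right\<close>)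
  then have 4: "(e * NB + b) * (K + 1) + k \<le> B" "(e * NB + b) * (K + 1) \<le> B" by (meson add_leD1)+
  have 3: "e * NB + b \<le> B"
    by (rule le_trans[OF _ 4(2)]) (use mult_le_mono2[of 1 "K + 1" "e * NB + b"] in \<open>simp only: mult_1_right le_add2\<close>)
  have 5: "e * NB \<le> B" using 3 by (rule add_leD1)
  show ?thesis unfolding region_code_def
    using 1 2 3 4 5 d by (simp add: runs_simps globalsD[OF gl] r region_def del: mult_Suc mult_Suc_right)
qed

lemma runs_copy_setup:
  assumes gl: "globals \<sigma>" and r: "reg \<sigma> 14 = Suc e" "reg \<sigma> 20 = b" "reg \<sigma> 30 = k"
    and b: "b < NB" and k: "k < K" and e: "e \<le> n"
  shows "runs B coin inp (seqs [region_code 32 14 30, region_code 33 0 30, Arith Mul 34 30 5, Arith Add 35 5 0]) \<sigma>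
     (\<lambda>u \<tau>. u = 17 \<and> agree 32 \<sigma> \<tau> \<and> copy_regs e b k \<tau> \<and> mem \<tau> = mem \<sigma> \<and> outp \<tau> = outp \<sigma>)"
proof -
  have rl: "region (Suc e) b k + W \<le> B" "region 0 b k + W \<le> B" by (rule region_le; use e b k in simp)+
  have "k * W \<le> K * W" using k by (simp add: mult_le_mono)
  then have kW: "k * W \<le> B" "W \<le> B" using size_facts(16) by linarith+
  let ?\<tau> = "set_reg 32 (region (Suc e) b k) \<sigma>"
  have 1: "runs B coin inp (region_code 32 14 30) \<sigma> (\<lambda>u \<tau>. u = 7 \<and> \<tau> = ?\<tau>)"
    by (rule runs_region_code) (use gl r rl in auto)
  have 2: "runs B coin inp (region_code 33 0 30) ?\<tau> (\<lambda>u \<tau>. u = 7 \<and> \<tau> = set_reg 33 (region 0 b k) ?\<tau>)"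
    by (rule runs_region_code) (use gl r rl in \<open>auto simp: globals_set_reg globals_def\<close>)
  have 3: "runs B coin inp (seqs [Arith Mul 34 30 5, Arith Add 35 5 0]) (set_reg 33 (region 0 b k) ?\<tau>)
     (\<lambda>u \<tau>. 14 + u = 17 \<and> agree 32 \<sigma> \<tau> \<and> copy_regs e b k \<tau> \<and> mem \<tau> = mem \<sigma> \<and> outp \<tau> = outp \<sigma>)"
    using kW by (simp add: runs_simps globalsD[OF gl] r copy_regs_def agree_refl)
  show ?thesis
    unfolding seqs.simps(2)[of "region_code _ _ _"] runs_Seq
  proof (rule runs_mono[OF 1], elim conjE, hypsubst, rule runs_mono[OF 2], elim conjE, hypsubst, rule runs_mono[OF 3])
  qed simp
qed

lemma runs_copy_round:
  assumes gl: "globals \<sigma>" and r: "reg \<sigma> 14 = Suc e" "reg \<sigma> 15 = r" "reg \<sigma> 16 = port md h r" "reg \<sigma> 20 = b"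
      "reg \<sigma> 22 = region (Suc e) b K + r * h" "reg \<sigma> 24 = b mod nb2 * w" "reg \<sigma> 30 = k"
    and b: "b < NB" and k: "k < K" and e: "e \<le> n" and rh: "r < h"
    and D: "D b k = e * h + r"
    and inv: "progress_inv D (mem \<sigma>)" and gm: "globals_mem t (mem \<sigma>)"
  shows "runs B coin (vector_input n (vs ! (e * h + r))) (copy_round md A) \<sigma> (\<lambda>u \<tau>.
    u + 8 * tt k (hist e b r) \<le> 8 * tt k (hist e b (Suc r)) + (2 * w + h) * (regs_bound + 20) + 30 \<and>
    agree 32 \<sigma> \<tau> \<and> outp \<tau> = outp \<sigma> \<and> globals_mem t (mem \<tau>) \<and>
    progress_inv (\<lambda>b' k'. if b' = b \<and> k' = k then Suc (e * h + r) else D b' k') (mem \<tau>))"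
proof -
  let ?inp = "vector_input n (vs ! (e * h + r))"
  let ?c = "port md h r" and ?v = "vec e b r"
  let ?U1 = "map rc (update_reqs h ?c ?v (flag1 md) w)" and ?U2 = "map rc (update_reqs h ?c ?v (flag2 md) w)"
  let ?Q = "map rc (query_reqs h w ?c h)"
  let ?h0 = "hist e b r"
  define H0 where "H0 = all_hist D"
  define H1 where "H1 = upd3 H0 e b k (?h0 @ ?U1)"
  define H2 where "H2 = upd3 H0 e b k ((?h0 @ ?U1) @ ?Q)"
  define H3 where "H3 = upd3 H0 e b k (((?h0 @ ?U1) @ ?Q) @ ?U2)"
  define C1 where "C1 = votes D"
  define C2 where "C2 = (\<lambda>e' b' x. C1 e' b' x + (if e' = e \<and> b' = b \<and> r * h \<le> x \<and> x < r * h + h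
    then of_bool (answer k (?h0 @ ?U1) ?c (x - r * h)) else 0))"
  let ?D' = "\<lambda>b' k'. if b' = b \<and> k' = k then Suc (e * h + r) else D b' k'"
  have H0e: "H0 e b k = ?h0" using D rh by (simp add: H0_def all_hist_def)
  have H1e: "H1 e b k = ?h0 @ ?U1" and H2e: "H2 e b k = (?h0 @ ?U1) @ ?Q" by (simp_all add: H1_def H2_def upd3_def)
  have u01: "upd3 H0 e b k (H0 e b k @ ?U1) = H1" by (simp add: H1_def H0e)
  have u12: "upd3 H1 e b k (H1 e b k @ ?Q) = H2" unfolding H1e unfolding H1_def H2_def by (auto simp: upd3_def fun_eq_iff)
  have u23: "upd3 H2 e b k (H2 e b k @ ?U2) = H3" unfolding H2e unfolding H2_def H3_def by (auto simp: upd3_def fun_eq_iff)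
  have hS: "hist e b (Suc r) = ((?h0 @ ?U1) @ ?Q) @ ?U2"
    by (simp add: hist_def epoch_reqs_Suc round_reqs_def)
  obtain ys where ys: "epoch_reqs md h w (vec e b) h = epoch_reqs md h w (vec e b) r @ round_reqs md h w ?v r @ ys"
    using epoch_reqs_split[OF rh] by blast
  have inp: "?inp (b mod nb2 * w + j) = of_bool (?v j)" for j
    by (auto simp: vec_def vector_input_def)
  have f: "flag1 md \<le> 2" "flag2 md \<le> 2" by (simp_all add: flag1_def flag2_def split: mode.splits)
  have ha1: "halts V (coins_of k) (memory k (?h0 @ map rc (update_reqs h ?c ?v (flag1 md) j))) (rc (Update ?c (h + 1 + j)))"
    if j: "j < w" "of_bool (?v j) = flag1 md" for j
  proof -
    obtain zs where zs: "update_reqs h ?c ?v (flag1 md) w = update_reqs h ?c ?v (flag1 md) j @ Update ?c (h + 1 + j) # zs"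
      using update_reqs_split[where v = ?v, OF j] by blast
    have "epoch_reqs md h w (vec e b) h = (epoch_reqs md h w (vec e b) r @ update_reqs h ?c ?v (flag1 md) j) @
        Update ?c (h + 1 + j) # (zs @ query_reqs h w ?c h @ update_reqs h ?c ?v (flag2 md) w @ ys)"
      by (simp add: ys round_reqs_def zs)
    from halts_prefix[OF this] show ?thesis by (simp add: hist_def)
  qed
  have ha2: "halts V (coins_of k) (memory k ((?h0 @ ?U1) @ map rc (query_reqs h w ?c i))) (rc (Query ?c (h + 1 + w + i)))"
    if i: "i < h" for i
  proof -
    obtain zs where zs: "query_reqs h w ?c h = query_reqs h w ?c i @ Query ?c (h + 1 + w + i) # zs"
      using query_reqs_split[OF i] by blast
    have "epoch_reqs md h w (vec e b) h = (epoch_reqs md h w (vec e b) r @ update_reqs h ?c ?v (flag1 md) w @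
        query_reqs h w ?c i) @ Query ?c (h + 1 + w + i) # (zs @ update_reqs h ?c ?v (flag2 md) w @ ys)"
      by (simp add: ys round_reqs_def zs)
    from halts_prefix[OF this] show ?thesis by (simp add: hist_def)
  qed
  have ha3: "halts V (coins_of k) (memory k (((?h0 @ ?U1) @ ?Q) @ map rc (update_reqs h ?c ?v (flag2 md) j))) (rc (Update ?c (h + 1 + j)))"
    if j: "j < w" "of_bool (?v j) = flag2 md" for j
  proof -
    obtain zs where zs: "update_reqs h ?c ?v (flag2 md) w = update_reqs h ?c ?v (flag2 md) j @ Update ?c (h + 1 + j) # zs"
      using update_reqs_split[where v = ?v, OF j] by blast
    have "epoch_reqs md h w (vec e b) h = (epoch_reqs md h w (vec e b) r @ update_reqs h ?c ?v (flag1 md) w @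
        query_reqs h w ?c h @ update_reqs h ?c ?v (flag2 md) j) @ Update ?c (h + 1 + j) # (zs @ ys)"
      by (simp add: ys round_reqs_def zs)
    from halts_prefix[OF this] show ?thesis by (simp add: hist_def)
  qed
  have C1K: "C1 e b (r * h + i) \<le> K" for i
  proof -
    have "C1 e b (r * h + i) \<le> (\<Sum>k<K. 1)" unfolding C1_def votes_def by (rule sum_mono) simp
    then show ?thesis by simp
  qed
  have S1: "runs B coin ?inp (update_loop A (flag1 md)) \<tau> (\<lambda>u \<tau>'.
    u + 8 * tt k ?h0 \<le> 8 * tt k (?h0 @ ?U1) + w * (regs_bound + 20) + 4 \<and>
    agree 40 \<tau> \<tau>' \<and> outp \<tau>' = outp \<tau> \<and> globals_mem t (mem \<tau>') \<and> mem_inv H1 C1 (mem \<tau>'))"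
    if "agree 32 \<sigma> \<tau>" "copy_regs e b k \<tau>" "mem_inv H0 C1 (mem \<tau>)" "globals_mem t (mem \<tau>)" for \<tau>
  proof -
    have r': "reg \<tau> 16 = ?c" "reg \<tau> 24 = b mod nb2 * w" using agreeD[OF that(1)] r by simp_all
    have gl': "globals \<tau>" by (rule globals_agree[OF gl that(1)]) simp
    note runs_update_loop[where H = H0 and f = "flag1 md" and v = ?v and t = t, OF gl' that(2) r' b k e f(1) that(3,4) inp,
      unfolded u01, unfolded H0e]
    from this[OF ha1] show ?thesis .
  qed
  have S2: "runs B coin ?inp (query_loop A) \<tau> (\<lambda>u \<tau>'.
    u + 8 * tt k (?h0 @ ?U1) \<le> 8 * tt k ((?h0 @ ?U1) @ ?Q) + h * (regs_bound + 20) + 4 \<and>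
    agree 40 \<tau> \<tau>' \<and> outp \<tau>' = outp \<tau> \<and> globals_mem t (mem \<tau>') \<and> mem_inv H2 C2 (mem \<tau>'))"
    if "agree 32 \<sigma> \<tau>" "copy_regs e b k \<tau>" "mem_inv H1 C1 (mem \<tau>)" "globals_mem t (mem \<tau>)" for \<tau>
  proof -
    have r': "reg \<tau> 16 = ?c" "reg \<tau> 22 = region (Suc e) b K + r * h" using agreeD[OF that(1)] r by simp_all
    have gl': "globals \<tau>" by (rule globals_agree[OF gl that(1)]) simp
    note runs_query_loop[where H = H1 and t = t and inp = ?inp, OF gl' that(2) r' b k e rh that(3,4) C1K,
      unfolded u12, unfolded H1e]
    from this[OF ha2] show ?thesis unfolding C2_def .
  qed
  have S3: "runs B coin ?inp (update_loop A (flag2 md)) \<tau> (\<lambda>u \<tau>'.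
    u + 8 * tt k ((?h0 @ ?U1) @ ?Q) \<le> 8 * tt k (((?h0 @ ?U1) @ ?Q) @ ?U2) + w * (regs_bound + 20) + 4 \<and>
    agree 40 \<tau> \<tau>' \<and> outp \<tau>' = outp \<tau> \<and> globals_mem t (mem \<tau>') \<and> mem_inv H3 C2 (mem \<tau>'))"
    if "agree 32 \<sigma> \<tau>" "copy_regs e b k \<tau>" "mem_inv H2 C2 (mem \<tau>)" "globals_mem t (mem \<tau>)" for \<tau>
  proof -
    have r': "reg \<tau> 16 = ?c" "reg \<tau> 24 = b mod nb2 * w" using agreeD[OF that(1)] r by simp_all
    have gl': "globals \<tau>" by (rule globals_agree[OF gl that(1)]) simp
    note runs_update_loop[where H = H2 and f = "flag2 md" and v = ?v and t = t, OF gl' that(2) r' b k e f(2) that(3,4) inp,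
      unfolded u23, unfolded H2e]
    from this[OF ha3] show ?thesis .
  qed
  have fin: "progress_inv ?D' \<mu>" if "mem_inv H3 C2 \<mu>" for \<mu>
    unfolding progress_inv_def
  proof (rule mem_inv_cong[OF that])
    fix e' b' k'
    show "H3 e' b' k' = all_hist ?D' e' b' k'"
    proof (cases "b' = b \<and> k' = k")
      case True
      consider "e' = e" | "Suc e' \<le> e" | "Suc e \<le> e'" by linarith
      then show ?thesis
      proof cases
        case 1
        moreover have "min h (Suc (e * h + r) - e * h) = Suc r" using rh by simp
        ultimately show ?thesis using True by (simp add: H3_def upd3_def all_hist_def hS)
      next
        case 2
        then have "Suc e' * h \<le> e * h" by (rule mult_le_mono1)
        then have "min h (e * h + r - e' * h) = h" "min h (Suc (e * h + r) - e' * h) = h" by simp_all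
        then show ?thesis using True 2 D by (simp add: H3_def upd3_def all_hist_def H0_def)
      next
        case 3
        then have "Suc e * h \<le> e' * h" by (rule mult_le_mono1)
        then have "Suc (e * h + r) \<le> e' * h" using rh by simp
        then show ?thesis using True 3 D by (simp add: H3_def upd3_def all_hist_def H0_def)
      qed
    next
      case False
      then show ?thesis by (auto simp: H3_def upd3_def H0_def all_hist_def)
    qed
  next
    fix e' b' x assume x: "x < h * h"
    have xh: "x div h < h" using x by (simp add: less_mult_imp_div_less)
    show "C2 e' b' x = votes ?D' e' b' x"
    proof (cases "b' = b")
      case False
      then show ?thesis by (simp add: C2_def C1_def votes_def)
    next
      case True
      let ?P = "e' = e \<and> r * h \<le> x \<and> x < r * h + h"
      \<comment> \<open>The numbering \<open>e * h + r\<close> of rounds across epochs is injective,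
        so precisely the \<open>h\<close> counters of the current round change.\<close>
      have eqP: "e' * h + x div h = e * h + r \<longleftrightarrow> ?P"
      proof
        assume eq: "e' * h + x div h = e * h + r"
        then have "(e' * h + x div h) div h = (e * h + r) div h" by simp
        then have ee: "e' = e" using mult_add_div_nat[OF xh, of e'] mult_add_div_nat[OF rh, of e] by simp
        then have xr: "x div h = r" using eq by simp
        have "x = x div h * h + x mod h" "x mod h < h" using h_pos by simp_all
        then show ?P using ee unfolding xr by linarith
      next
        assume ?P
        then have "x = r * h + (x - r * h)" "x - r * h < h" by auto
        then have "x div h = r" by (metis mult_add_div_nat)
        then show "e' * h + x div h = e * h + r" using \<open>?P\<close> by simp
      qed
      have xr: "x div h = r \<and> x mod h = x - r * h" if ?P
      proof -
        have "x = r * h + (x - r * h)" "x - r * h < h" using that by auto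
        then show ?thesis by (metis mult_add_div_nat mod_mult_self3 mod_less)
      qed
      have split: "{..<K} = insert k ({..<K} - {k})" using k by auto
      have "votes D' e' b' x = (if e' * h + x div h < D' b' k then of_bool (reply e' b' k x) else 0) +
          (\<Sum>k'\<in>{..<K} - {k}. if e' * h + x div h < D' b' k' then of_bool (reply e' b' k' x) else 0)" for D'
        unfolding votes_def by (subst split, subst sum.insert) auto
      note vt = this
      have rest: "(\<Sum>k'\<in>{..<K} - {k}. if e' * h + x div h < ?D' b' k' then of_bool (reply e' b' k' x) else 0 :: nat) =
          (\<Sum>k'\<in>{..<K} - {k}. if e' * h + x div h < D b' k' then of_bool (reply e' b' k' x) else 0)"
        by (rule sum.cong) auto
      have rep: "reply e' b' k x = answer k (?h0 @ ?U1) ?c (x - r * h)" if ?P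
        using xr[OF that] that True by (simp add: reply_def)
      have "(if e' * h + x div h < Suc (e * h + r) then of_bool (reply e' b' k x) else 0 :: nat) =
         (if e' * h + x div h < e * h + r then of_bool (reply e' b' k x) else 0) +
         (if ?P then of_bool (answer k (?h0 @ ?U1) ?c (x - r * h)) else 0)"
        using eqP rep by (auto simp: less_Suc_eq)
      then show ?thesis
        using True D unfolding C2_def C1_def vt rest by simp
    qed
  qed
  have inv0: "mem_inv H0 C1 (mem \<sigma>)" using inv by (simp add: progress_inv_def H0_def C1_def)
  show ?thesis
    unfolding copy_round_def runs_Seq
  proof (rule runs_mono[OF runs_copy_setup[OF gl r(1) r(4) r(7) b k e]], elim conjE)
    fix u0 :: nat and \<tau>0 :: state assume 0: "u0 = 17" "agree 32 \<sigma> \<tau>0" "copy_regs e b k \<tau>0" "mem \<tau>0 = mem \<sigma>" "outp \<tau>0 = outp \<sigma>"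
    show "runs B coin ?inp (update_loop A (flag1 md)) \<tau>0 (\<lambda>ta \<sigma>'. runs B coin ?inp (query_loop A) \<sigma>' (\<lambda>tb \<sigma>''.
        runs B coin ?inp (update_loop A (flag2 md)) \<sigma>'' (\<lambda>u \<tau>. u0 + (ta + (tb + u)) + 8 * tt k ?h0
          \<le> 8 * tt k (hist e b (Suc r)) + (2 * w + h) * (regs_bound + 20) + 30 \<and>
         agree 32 \<sigma> \<tau> \<and> outp \<tau> = outp \<sigma> \<and> globals_mem t (mem \<tau>) \<and> progress_inv ?D' (mem \<tau>))))"
    proof (rule runs_mono[OF S1[OF 0(2,3)]], goal_cases)
      case 1 show ?case using inv0 0 by simp
    next
      case 2 show ?case using gm 0 by simp
    next
      case (3 u1 \<tau>1)
      have a1: "agree 32 \<sigma> \<tau>1" "copy_regs e b k \<tau>1"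
        using 3 agree_trans[OF 0(2), of 40 \<tau>1] copy_regs_agree[OF 0(3), of 40 \<tau>1] by auto
      show ?case
      proof (rule runs_mono[OF S2[OF a1]], goal_cases)
        case 1 show ?case using 3 by simp
      next
        case 2 show ?case using 3 by simp
      next
        case q: (3 u2 \<tau>2)
        have a2: "agree 32 \<sigma> \<tau>2" "copy_regs e b k \<tau>2"
          using q agree_trans[OF a1(1), of 40 \<tau>2] copy_regs_agree[OF a1(2), of 40 \<tau>2] by auto
        show ?case
        proof (rule runs_mono[OF S3[OF a2]], goal_cases)
          case 1 show ?case using q by simp
        next
          case 2 show ?case using q by simp
        next
          case z: (3 u3 \<tau>3)
          have a3: "agree 32 \<sigma> \<tau>3" using z agree_trans[OF a2(1), of 40 \<tau>3] by auto
          have "(2 * w + h) * (regs_bound + 20) = w * (regs_bound + 20) + h * (regs_bound + 20) + w * (regs_bound + 20)"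
            by (simp add: algebra_simps)
          then have "u0 + (u1 + (u2 + u3)) + 8 * tt k ?h0
            \<le> 8 * tt k (hist e b (Suc r)) + (2 * w + h) * (regs_bound + 20) + 30"
            using 0(1) 3 q z unfolding hS by linarith
          then show ?case using 3 q z 0 a3 fin by simp
        qed
      qed
    qed
  qed
qed

text \<open>The truncated subtraction is exact by \<open>tt_hist_mono\<close>.\<close>

definition cost :: "nat \<Rightarrow> nat \<Rightarrow> nat \<Rightarrow> nat \<Rightarrow> nat" where
  "cost e b r k = tt k (hist e b (Suc r)) - tt k (hist e b r)"

definition tally :: "nat \<Rightarrow> nat \<Rightarrow> nat \<Rightarrow> nat" where
  "tally e b x = (\<Sum>k<K. of_bool (reply e b k x))"

abbreviation loop_cost :: nat where
  "loop_cost \<equiv> K * ((2 * w + h) * (regs_bound + 20) + 34) + h * 20 + 60"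

lemma progress_inv_cong:
  assumes "progress_inv D \<mu>" "\<And>b k. b < NB \<Longrightarrow> k < K \<Longrightarrow> D b k = D' b k"
  shows "progress_inv D' \<mu>"
  using assms(1) unfolding progress_inv_def
  by (rule mem_inv_cong) (use assms(2) in \<open>simp_all add: all_hist_def votes_def\<close>)

lemma runs_block_setup:
  assumes gl: "globals \<sigma>" and r: "reg \<sigma> 14 = Suc e" "reg \<sigma> 15 = r" "reg \<sigma> 20 = b"
    and b: "b < NB" and e: "e \<le> n" and rh: "r < h"
  shows "runs B coin inp (seqs [block_offsets, region_code 22 14 8, Arith Mul 25 15 3, Arith Add 22 22 25]) \<sigma>
    (\<lambda>u \<tau>. u = 15 \<and> agree 22 \<sigma> \<tau> \<and> mem \<tau> = mem \<sigma> \<and> outp \<tau> = outp \<sigma> \<and>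
      reg \<tau> 22 = region (Suc e) b K + r * h \<and> reg \<tau> 23 = b div nb2 * h \<and> reg \<tau> 24 = b mod nb2 * w)"
proof -
  let ?\<tau> = "set_reg 24 (b mod nb2 * w) (set_reg 23 (b div nb2 * h) \<sigma>)"
  have "b div nb2 \<le> n div h" by (rule block_div_less[OF b])
  moreover have "n div h \<le> n" "b mod nb2 \<le> b" by simp_all
  ultimately have bnd: "b div nb2 \<le> B" "b div nb2 * h \<le> B" "b mod nb2 \<le> B" "b mod nb2 * w \<le> B"
    using row_le[OF b] col_le[of b] size_facts(9,10) b by linarith+
  have rhh: "r * h \<le> h * h" using rh by (intro mult_le_mono1) simp
  have "region (Suc e) b K + W \<le> B" by (rule region_le) (use e b in auto)
  then have bnd2: "region (Suc e) b K \<le> B" "region (Suc e) b K + r * h \<le> B" "r * h \<le> B"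
    using rhh size_facts(1) by linarith+
  have 1: "runs B coin inp block_offsets \<sigma> (\<lambda>u \<tau>. u = 5 \<and> \<tau> = ?\<tau>)"
    unfolding block_offsets_def using bnd by (simp add: runs_simps globalsD[OF gl] r)
  have 2: "runs B coin inp (region_code 22 14 8) ?\<tau> (\<lambda>u \<tau>. u = 7 \<and> \<tau> = set_reg 22 (region (Suc e) b K) ?\<tau>)"
    by (rule runs_region_code) (use gl r bnd2 in \<open>auto simp: globals_set_reg globalsD\<close>)
  have 3: "runs B coin inp (seqs [Arith Mul 25 15 3, Arith Add 22 22 25]) (set_reg 22 (region (Suc e) b K) ?\<tau>)
    (\<lambda>u \<tau>. 12 + u = 15 \<and> agree 22 \<sigma> \<tau> \<and> mem \<tau> = mem \<sigma> \<and> outp \<tau> = outp \<sigma> \<and>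
      reg \<tau> 22 = region (Suc e) b K + r * h \<and> reg \<tau> 23 = b div nb2 * h \<and> reg \<tau> 24 = b mod nb2 * w)"
    using bnd2 by (simp add: runs_simps globalsD[OF gl] r agree_refl)
  show ?thesis
    unfolding seqs.simps(2)[of "region_code _ _ _"] seqs.simps(2)[of block_offsets] runs_Seq
  proof (rule runs_mono[OF 1], elim conjE, hypsubst, rule runs_mono[OF 2], elim conjE, hypsubst, rule runs_mono[OF 3])
  qed simp
qed

lemma runs_copies:
  assumes gl: "globals \<sigma>" and r: "reg \<sigma> 14 = Suc e" "reg \<sigma> 15 = r" "reg \<sigma> 16 = port md h r" "reg \<sigma> 20 = b"
      "reg \<sigma> 22 = region (Suc e) b K + r * h" "reg \<sigma> 24 = b mod nb2 * w"
    and b: "b < NB" and e: "e \<le> n" and rh: "r < h"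
    and D: "\<And>k. k < K \<Longrightarrow> D b k = e * h + r"
    and inv: "progress_inv D (mem \<sigma>)" and gm: "globals_mem t (mem \<sigma>)"
  shows "runs B coin (vector_input n (vs ! (e * h + r))) (For 30 8 (copy_round md A)) \<sigma> (\<lambda>u \<tau>.
    u \<le> 8 * (\<Sum>k<K. cost e b r k) + K * ((2 * w + h) * (regs_bound + 20) + 34) + 4 \<and>
    agree 30 \<sigma> \<tau> \<and> outp \<tau> = outp \<sigma> \<and> globals_mem t (mem \<tau>) \<and>
    progress_inv (\<lambda>b' k'. if b' = b then Suc (e * h + r) else D b' k') (mem \<tau>))"
proof -
  let ?D = "\<lambda>k b' k'. if b' = b \<and> k' < k then Suc (e * h + r) else D b' k'"
  let ?J = "\<lambda>k \<mu> out. out = outp \<sigma> \<and> globals_mem t \<mu> \<and> progress_inv (?D k) \<mu>"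
  let ?\<Phi> = "\<lambda>k. 8 * (\<Sum>k'<k. cost e b r k') + k * ((2 * w + h) * (regs_bound + 20) + 34)"
  have "runs B coin (vector_input n (vs ! (e * h + r))) (For 30 8 (copy_round md A)) \<sigma>
     (\<lambda>u \<tau>. u + ?\<Phi> 0 \<le> ?\<Phi> (reg \<sigma> 8) + 4 \<and> agree 30 \<sigma> \<tau> \<and> ?J (reg \<sigma> 8) (mem \<tau>) (outp \<tau>))"
  proof (rule runs_For)
    fix k \<tau>
    assume k: "k < reg \<sigma> 8" and ag: "agree 30 \<sigma> \<tau>" and rk: "reg \<tau> 30 = k" and J: "?J k (mem \<tau>) (outp \<tau>)"
    have kK: "k < K" using k gl by (simp add: globals_def)
    have gl': "globals \<tau>" by (rule globals_agree[OF gl ag]) simp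
    have rr: "reg \<tau> 14 = Suc e" "reg \<tau> 15 = r" "reg \<tau> 16 = port md h r" "reg \<tau> 20 = b"
      "reg \<tau> 22 = region (Suc e) b K + r * h" "reg \<tau> 24 = b mod nb2 * w"
      using agreeD[OF ag] r by simp_all
    have Dk: "?D k b k = e * h + r" using D[OF kK] by simp
    have pi: "progress_inv (?D k) (mem \<tau>)" and gm': "globals_mem t (mem \<tau>)" using J by simp_all
    have DD: "(\<lambda>b' k'. if b' = b \<and> k' = k then Suc (e * h + r) else ?D k b' k') = ?D (Suc k)"
      by (auto simp: fun_eq_iff less_Suc_eq)
    show "runs B coin (vector_input n (vs ! (e * h + r))) (copy_round md A) \<tau>
      (\<lambda>u \<tau>'. u + ?\<Phi> k + 4 \<le> ?\<Phi> (Suc k) \<and> agree (30 + 2) \<tau> \<tau>' \<and> ?J (Suc k) (mem \<tau>') (outp \<tau>'))"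
    proof (rule runs_mono[OF runs_copy_round[where D = "?D k", OF gl' rr rk b kK e rh Dk pi gm']], unfold DD, elim conjE)
      fix u :: nat and \<tau>' :: state
      assume *: "u + 8 * tt k (hist e b r) \<le> 8 * tt k (hist e b (Suc r)) + (2 * w + h) * (regs_bound + 20) + 30"
        "agree 32 \<tau> \<tau>'" "outp \<tau>' = outp \<tau>" "globals_mem t (mem \<tau>')" "progress_inv (?D (Suc k)) (mem \<tau>')"
      have "tt k (hist e b r) \<le> tt k (hist e b (Suc r))" by (rule tt_hist_mono) simp
      then have "u \<le> 8 * cost e b r k + (2 * w + h) * (regs_bound + 20) + 30"
        using *(1) unfolding cost_def by linarith
      moreover have "?\<Phi> (Suc k) = ?\<Phi> k + 8 * cost e b r k + (2 * w + h) * (regs_bound + 20) + 34" by simp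
      ultimately have "u + ?\<Phi> k + 4 \<le> ?\<Phi> (Suc k)" by linarith
      moreover have "outp \<tau>' = outp \<sigma>" using *(3) J by simp
      ultimately show "u + ?\<Phi> k + 4 \<le> ?\<Phi> (Suc k) \<and> agree (30 + 2) \<tau> \<tau>' \<and> ?J (Suc k) (mem \<tau>') (outp \<tau>')"
        using *(2,4,5) by simp
    qed
  next
    show "?J 0 (mem \<sigma>) (outp \<sigma>)" using inv gm by simp
  qed (use gl size_facts in \<open>simp_all add: globals_def\<close>)
  then show ?thesis
  proof (rule runs_mono, unfold globalsD(9)[OF gl], elim conjE)
    fix u :: nat and \<tau> :: state
    assume *: "u + ?\<Phi> 0 \<le> ?\<Phi> K + 4" "agree 30 \<sigma> \<tau>" "outp \<tau> = outp \<sigma>" "globals_mem t (mem \<tau>)" "progress_inv (?D K) (mem \<tau>)"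
    have "progress_inv (\<lambda>b' k'. if b' = b then Suc (e * h + r) else D b' k') (mem \<tau>)"
      by (rule progress_inv_cong[OF *(5)]) simp
    then show "u \<le> 8 * (\<Sum>k<K. cost e b r k) + K * ((2 * w + h) * (regs_bound + 20) + 34) + 4 \<and>
      agree 30 \<sigma> \<tau> \<and> outp \<tau> = outp \<sigma> \<and> globals_mem t (mem \<tau>) \<and>
      progress_inv (\<lambda>b' k'. if b' = b then Suc (e * h + r) else D b' k') (mem \<tau>)"
      using *(1-4) by simp
  qed
qed

lemma runs_outputs:
  assumes gl: "globals \<sigma>" and r: "reg \<sigma> 22 = region (Suc e) b K + r * h" "reg \<sigma> 23 = b div nb2 * h"
    and b: "b < NB" and e: "e \<le> n" and rh: "r < h"
    and inv: "progress_inv D (mem \<sigma>)" and D: "\<And>k. k < K \<Longrightarrow> D b k = Suc (e * h + r)"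
  shows "runs B coin inp (For 30 3 output_code) \<sigma> (\<lambda>u \<tau>.
    u \<le> h * 20 + 4 \<and> agree 30 \<sigma> \<tau> \<and> mem \<tau> = mem \<sigma> \<and>
    outp \<tau> = (\<lambda>x. if \<exists>i<h. x = b div nb2 * h + i \<and> K < 2 * tally e b (r * h + i) then 1 else outp \<sigma> x))"
proof -
  let ?out = "\<lambda>j x. if \<exists>i<j. x = b div nb2 * h + i \<and> K < 2 * tally e b (r * h + i) then 1 else outp \<sigma> x"
  let ?J = "\<lambda>j \<mu> out. \<mu> = mem \<sigma> \<and> out = ?out j"
  have "runs B coin inp (For 30 3 output_code) \<sigma>
     (\<lambda>u \<tau>. u + 0 * 20 \<le> reg \<sigma> 3 * 20 + 4 \<and> agree 30 \<sigma> \<tau> \<and> ?J (reg \<sigma> 3) (mem \<tau>) (outp \<tau>))"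
  proof (rule runs_For[where \<Phi> = "\<lambda>j. j * 20"])
    fix j \<tau>
    assume j: "j < reg \<sigma> 3" and ag: "agree 30 \<sigma> \<tau>" and rj: "reg \<tau> 30 = j" and J: "?J j (mem \<tau>) (outp \<tau>)"
    have jh: "j < h" using j gl by (simp add: globals_def)
    have gl': "globals \<tau>" by (rule globals_agree[OF gl ag]) simp
    have rr: "reg \<tau> 22 = region (Suc e) b K + r * h" "reg \<tau> 23 = b div nb2 * h"
      using agreeD[OF ag] r by simp_all
    have "r * h + j < r * h + h" using jh by simp
    also have "\<dots> = Suc r * h" by simp
    also have "\<dots> \<le> h * h" using rh by (intro mult_le_mono1) simp
    finally have cell: "r * h + j < h * h" .
    have xr: "(r * h + j) div h = r" using jh by (rule mult_add_div_nat)
    have "mem \<sigma> (region (Suc e) b K + (r * h + j)) = votes D e b (r * h + j)"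
      using inv b cell unfolding progress_inv_def mem_inv_def by blast
    also have "\<dots> = tally e b (r * h + j)"
      unfolding votes_def tally_def xr by (rule sum.cong) (simp_all add: D)
    finally have load: "mem \<tau> (region (Suc e) b K + (r * h + j)) = tally e b (r * h + j)" using J by simp
    have tK: "tally e b (r * h + j) \<le> K"
    proof -
      have "tally e b (r * h + j) \<le> (\<Sum>k<K. 1)" unfolding tally_def by (rule sum_mono) simp
      then show ?thesis by simp
    qed
    have "K * 2 \<le> K * W" using size_facts(2) by (intro mult_le_mono2) simp
    then have bnd1: "tally e b (r * h + j) + tally e b (r * h + j) \<le> B" using tK size_facts(16) by linarith
    have "b div nb2 * h + j \<le> n + h" using row_le[OF b] jh by (intro add_mono) simp_all
    also have "\<dots> \<le> (n + h) * n" using mult_le_mono2[OF n, of "n + h"] by (simp only: mult_1_right)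
    also have "\<dots> \<le> B" using bound(2) by (meson add_leD1)
    finally have bnd2: "b div nb2 * h + j \<le> B" .
    have "region (Suc e) b K + W \<le> B" by (rule region_le) (use e b in auto)
    then have bnd3: "region (Suc e) b K + (r * h + j) \<le> B" "Suc 0 \<le> B" using cell size_facts(1,11) by linarith+
    have o1: "?out (Suc j) = (outp \<tau>)(b div nb2 * h + j := 1)" if "K < 2 * tally e b (r * h + j)"
      using J that by (auto simp: fun_eq_iff less_Suc_eq)
    have o2: "?out (Suc j) = outp \<tau>" if "\<not> K < 2 * tally e b (r * h + j)"
      using J that by (auto simp: fun_eq_iff less_Suc_eq)
    have "runs B coin inp output_code \<tau>
      (\<lambda>u \<tau>'. u \<le> 10 \<and> agree 32 \<tau> \<tau>' \<and> mem \<tau>' = mem \<tau> \<and>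
        outp \<tau>' = (if K < 2 * tally e b (r * h + j) then (outp \<tau>)(b div nb2 * h + j := 1) else outp \<tau>))"
      unfolding output_code_def
      using bnd1 bnd2 bnd3
      by (auto simp: runs_simps globalsD[OF gl'] rr rj load agree_refl add.assoc mult_2)
    then show "runs B coin inp output_code \<tau>
      (\<lambda>u \<tau>'. u + j * 20 + 4 \<le> Suc j * 20 \<and> agree (30 + 2) \<tau> \<tau>' \<and> ?J (Suc j) (mem \<tau>') (outp \<tau>'))"
    proof (rule runs_mono, elim conjE)
      fix u :: nat and \<tau>' :: state
      assume *: "u \<le> 10" "agree 32 \<tau> \<tau>'" "mem \<tau>' = mem \<tau>"
        "outp \<tau>' = (if K < 2 * tally e b (r * h + j) then (outp \<tau>)(b div nb2 * h + j := 1) else outp \<tau>)"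
      have "outp \<tau>' = ?out (Suc j)" using *(4) o1 o2 by (cases "K < 2 * tally e b (r * h + j)") auto
      moreover have "mem \<tau>' = mem \<sigma>" using *(3) J by simp
      ultimately show "u + j * 20 + 4 \<le> Suc j * 20 \<and> agree (30 + 2) \<tau> \<tau>' \<and> ?J (Suc j) (mem \<tau>') (outp \<tau>')"
        using *(1,2) by simp
    qed
  qed (use gl size_facts in \<open>simp_all add: globals_def\<close>)
  then show ?thesis unfolding globalsD(4)[OF gl] by (rule runs_mono) simp
qed

lemma runs_block_round:
  assumes gl: "globals \<sigma>" and r: "reg \<sigma> 14 = Suc e" "reg \<sigma> 15 = r" "reg \<sigma> 16 = port md h r" "reg \<sigma> 20 = b"
    and b: "b < NB" and e: "e \<le> n" and rh: "r < h"
    and D: "\<And>k. k < K \<Longrightarrow> D b k = e * h + r"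
    and inv: "progress_inv D (mem \<sigma>)" and gm: "globals_mem t (mem \<sigma>)"
  shows "runs B coin (vector_input n (vs ! (e * h + r))) (block_round md A) \<sigma> (\<lambda>u \<tau>.
    u \<le> 8 * (\<Sum>k<K. cost e b r k) + loop_cost \<and> agree 22 \<sigma> \<tau> \<and> globals_mem t (mem \<tau>) \<and>
    progress_inv (\<lambda>b' k'. if b' = b then Suc (e * h + r) else D b' k') (mem \<tau>) \<and>
    outp \<tau> = (\<lambda>x. if \<exists>i<h. x = b div nb2 * h + i \<and> K < 2 * tally e b (r * h + i) then 1 else outp \<sigma> x))"
  unfolding block_round_def runs_Seq
proof (rule runs_mono[OF runs_block_setup[OF gl r(1,2,4) b e rh]], elim conjE)
  fix u0 :: nat and \<tau>0 :: state
  assume 0: "u0 = 15" "agree 22 \<sigma> \<tau>0" "mem \<tau>0 = mem \<sigma>" "outp \<tau>0 = outp \<sigma>" "reg \<tau>0 22 = region (Suc e) b K + r * h"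
    "reg \<tau>0 23 = b div nb2 * h" "reg \<tau>0 24 = b mod nb2 * w"
  let ?D = "\<lambda>b' k'. if b' = b then Suc (e * h + r) else D b' k'"
  have gl0: "globals \<tau>0" by (rule globals_agree[OF gl 0(2)]) simp
  have r0: "reg \<tau>0 14 = Suc e" "reg \<tau>0 15 = r" "reg \<tau>0 16 = port md h r" "reg \<tau>0 20 = b"
    using agreeD[OF 0(2)] r by simp_all
  have inv0: "progress_inv D (mem \<tau>0)" and gm0: "globals_mem t (mem \<tau>0)" using inv gm 0(3) by simp_all
  show "runs B coin (vector_input n (vs ! (e * h + r))) (For 30 8 (copy_round md A)) \<tau>0
    (\<lambda>ta \<sigma>'. runs B coin (vector_input n (vs ! (e * h + r))) (For 30 3 output_code) \<sigma>'
      (\<lambda>u \<tau>. u0 + (ta + u) \<le> 8 * (\<Sum>k<K. cost e b r k) + loop_cost \<and> agree 22 \<sigma> \<tau> \<and> globals_mem t (mem \<tau>) \<and>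
        progress_inv ?D (mem \<tau>) \<and>
        outp \<tau> = (\<lambda>x. if \<exists>i<h. x = b div nb2 * h + i \<and> K < 2 * tally e b (r * h + i) then 1 else outp \<sigma> x)))"
  proof (rule runs_mono[OF runs_copies[where D = D, OF gl0 r0 0(5,7) b e rh D inv0 gm0]], assumption, elim conjE)
    fix u1 :: nat and \<tau>1 :: state
    assume 1: "u1 \<le> 8 * (\<Sum>k<K. cost e b r k) + K * ((2 * w + h) * (regs_bound + 20) + 34) + 4"
      "agree 30 \<tau>0 \<tau>1" "outp \<tau>1 = outp \<tau>0" "globals_mem t (mem \<tau>1)" "progress_inv ?D (mem \<tau>1)"
    have gl1: "globals \<tau>1" by (rule globals_agree[OF gl0 1(2)]) simp
    have r1: "reg \<tau>1 22 = region (Suc e) b K + r * h" "reg \<tau>1 23 = b div nb2 * h"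
      using agreeD[OF 1(2)] 0 by simp_all
    have ag1: "agree 22 \<sigma> \<tau>1" using agree_trans[OF 0(2) 1(2)] by simp
    show "runs B coin (vector_input n (vs ! (e * h + r))) (For 30 3 output_code) \<tau>1
      (\<lambda>u \<tau>. u0 + (u1 + u) \<le> 8 * (\<Sum>k<K. cost e b r k) + loop_cost \<and> agree 22 \<sigma> \<tau> \<and> globals_mem t (mem \<tau>) \<and>
        progress_inv ?D (mem \<tau>) \<and>
        outp \<tau> = (\<lambda>x. if \<exists>i<h. x = b div nb2 * h + i \<and> K < 2 * tally e b (r * h + i) then 1 else outp \<sigma> x))"
    proof (rule runs_mono[OF runs_outputs[where D = ?D, OF gl1 r1 b e rh 1(5)]], simp, elim conjE)
      fix u2 :: nat and \<tau>2 :: state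
      assume 2: "u2 \<le> h * 20 + 4" "agree 30 \<tau>1 \<tau>2" "mem \<tau>2 = mem \<tau>1"
        "outp \<tau>2 = (\<lambda>x. if \<exists>i<h. x = b div nb2 * h + i \<and> K < 2 * tally e b (r * h + i) then 1 else outp \<tau>1 x)"
      have "agree 22 \<sigma> \<tau>2" using agree_trans[OF ag1 2(2)] by simp
      moreover have "u0 + (u1 + u2) \<le> 8 * (\<Sum>k<K. cost e b r k) + loop_cost" using 0(1) 1(1) 2(1) by linarith
      ultimately show "u0 + (u1 + u2) \<le> 8 * (\<Sum>k<K. cost e b r k) + loop_cost \<and> agree 22 \<sigma> \<tau>2 \<and> globals_mem t (mem \<tau>2) \<and>
        progress_inv ?D (mem \<tau>2) \<and>
        outp \<tau>2 = (\<lambda>x. if \<exists>i<h. x = b div nb2 * h + i \<and> K < 2 * tally e b (r * h + i) then 1 else outp \<sigma> x)"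
        using 1(4,5) unfolding 2(3,4) 1(3) 0(4) by blast
    qed
  qed
qed

lemma runs_setup_code:
  assumes r: "reg \<sigma> 0 = 0" "reg \<sigma> 1 = 1" "reg \<sigma> 2 = n" "reg \<sigma> 10 = g"
  shows "runs B coin inp (setup_code P R ex K) \<sigma>
    (\<lambda>u \<tau>. u = P + R + ex + 15 \<and> globals \<tau> \<and> mem \<tau> = mem \<sigma> \<and> outp \<tau> = outp \<sigma>)"
proof -
  have p: "g ^ P = h" "g ^ R = w" "g ^ ex = W" by (simp_all add: h_def w_def W_def)
  have "1 * nb2 \<le> NB" unfolding NB_def by (intro mult_le_mono1) simp
  then have "nb2 \<le> NB" by (simp only: mult_1)
  moreover have "(n div h + 1) * 1 \<le> NB" unfolding NB_def by (intro mult_le_mono2) (simp add: nb2_def)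
  then have "Suc (n div h) \<le> NB" by (simp only: mult_1_right Suc_eq_plus1)
  ultimately have bnd: "nb2 \<le> B" "Suc (n div h) \<le> B" using size_facts(9) by (meson le_trans)+
  have bnd': "n div w \<le> B" "n div h \<le> B" using size_facts(10) by (meson div_le_dividend le_trans)+
  have bnd2: "h + 1 + w + h \<le> B" "h \<le> B" "w \<le> B" "W \<le> B" "K + 2 \<le> B" "2 \<le> B" "1 \<le> B" "NB \<le> B"
    using size_facts unfolding n'_def by linarith+
  have r1: "reg \<sigma> (Suc 0) = Suc 0" using r(2) by simp
  have nb: "Suc (n div w) = nb2" "Suc (n div h) * nb2 = NB" by (simp_all add: nb2_def NB_def)
  have 1: "runs B coin inp (power_code 3 10 P) \<sigma> (\<lambda>t \<tau>. t = P + 1 \<and> \<tau> = set_reg 3 h \<sigma>)"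
    using runs_power_code[of \<sigma> 10 P B 3 coin inp] bnd2 r g_pos p by simp
  have 2: "runs B coin inp (power_code 4 10 R) (set_reg 3 h \<sigma>) (\<lambda>t \<tau>. t = R + 1 \<and> \<tau> = set_reg 4 w (set_reg 3 h \<sigma>))"
    using runs_power_code[of "set_reg 3 h \<sigma>" 10 R B 4 coin inp] bnd2 r g_pos p by simp
  let ?\<tau> = "set_reg 5 W (set_reg 4 w (set_reg 3 h \<sigma>))"
  have 3: "runs B coin inp (power_code 5 10 ex) (set_reg 4 w (set_reg 3 h \<sigma>)) (\<lambda>t \<tau>. t = ex + 1 \<and> \<tau> = ?\<tau>)"
    using runs_power_code[of "set_reg 4 w (set_reg 3 h \<sigma>)" 10 ex B 5 coin inp] bnd2 r g_pos p by simp
  have 4: "runs B coin inp (seqs [Arith Div 6 2 4, Arith Add 6 6 1, Arith Div 7 2 3, Arith Add 7 7 1, Arith Mul 7 7 6,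
     Const 8 K, Arith Add 13 8 1, Const 17 2, Arith Add 9 3 1, Arith Add 11 9 4, Arith Add 12 11 3]) ?\<tau>
    (\<lambda>u \<tau>. (P + 1) + ((R + 1) + ((ex + 1) + u)) = P + R + ex + 15 \<and> globals \<tau> \<and> mem \<tau> = mem \<sigma> \<and> outp \<tau> = outp \<sigma>)"
    using bnd bnd' bnd2 by (simp add: runs_simps r r1 nb globals_def n'_def del: mult_Suc)
  show ?thesis
    unfolding setup_code_def seqs.simps(2)[of "power_code _ _ _"] runs_Seq
    by (rule runs_mono[OF 1], elim conjE, hypsubst, rule runs_mono[OF 2], elim conjE, hypsubst,
      rule runs_mono[OF 3], elim conjE, hypsubst, rule runs_mono[OF 4]) simp
qed

lemma mem_inv_low: "a < W \<Longrightarrow> mem_inv H C (\<mu>(a := x)) = mem_inv H C \<mu>"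
proof -
  assume a: "a < W"
  have 1: "region e b k + i \<noteq> a" for e b k i using region_ge[of e b k] a by simp
  have 2: "W + i \<noteq> a" for i using a by simp
  have "(\<mu>(a := x)) (region e b k + i) = \<mu> (region e b k + i)" "(\<mu>(a := x)) (W + i) = \<mu> (W + i)" for e b k i
    using 1 2 by simp_all
  then show ?thesis unfolding mem_inv_def overlay_def by (simp only:)
qed

definition round_output :: "nat \<Rightarrow> nat \<Rightarrow> nat" where
  "round_output t x = of_bool (\<exists>b<NB. \<exists>i<h. x = b div nb2 * h + i \<and> K < 2 * tally (t div h) b (t mod h * h + i))"

lemma runs_round_code:
  assumes gm: "globals_mem t \<mu>" and inv: "progress_inv (\<lambda>_ _. t) \<mu>" and t: "t < n"
  shows "runs B coin (vector_input n (vs ! t)) (round_code md A P R ex K) (init_state \<mu>) (\<lambda>u \<tau>.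
    u \<le> 8 * (\<Sum>b<NB. \<Sum>k<K. cost (t div h) b (t mod h) k) + NB * (loop_cost + 4) + (P + R + ex + 40) \<and>
    globals_mem (Suc t) (mem \<tau>) \<and> progress_inv (\<lambda>_ _. Suc t) (mem \<tau>) \<and> outp \<tau> = round_output t)"
proof -
  let ?e = "t div h" and ?r = "t mod h" and ?inp = "vector_input n (vs ! t)"
  have th: "?e * h + ?r = t" by simp
  have rh: "?r < h" using h_pos by simp
  have "?e \<le> t" by simp
  then have e: "?e \<le> n" "Suc ?e \<le> B" "t \<le> B" "Suc t \<le> B" "?e \<le> B" "?r \<le> B" using t size_facts(10) mod_less_eq_dividend[of t h] by linarith+
  have bnd: "Suc 0 \<le> B" "2 \<le> B" "n \<le> B" using size_facts by linarith+
  let ?\<sigma>1 = "set_reg 10 g (set_reg 22 2 (set_reg 2 n (set_reg 1 1 (init_state \<mu>))))"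
  have 1: "runs B coin ?inp (seqs [Const 1 1, Load 2 1, Const 22 2, Load 10 22]) (init_state \<mu>)
      (\<lambda>u \<tau>. u = 5 \<and> \<tau> = ?\<sigma>1)"
    using gm bnd by (simp add: runs_simps globals_mem_def init_state_def)
  have 2: "runs B coin ?inp (setup_code P R ex K) ?\<sigma>1
    (\<lambda>u \<tau>. u = P + R + ex + 15 \<and> globals \<tau> \<and> mem \<tau> = mem ?\<sigma>1 \<and> outp \<tau> = outp ?\<sigma>1)"
    by (rule runs_setup_code) (simp_all add: init_state_def)
  have 3: "runs B coin ?inp (seqs [Load 18 0, Arith Div 14 18 3, Arith Add 14 14 1, Arith Mod 15 18 3, port_code md]) \<sigma>
    (\<lambda>u \<tau>. u \<le> 8 \<and> globals \<tau> \<and> mem \<tau> = mem \<sigma> \<and> outp \<tau> = outp \<sigma> \<and> reg \<tau> 14 = Suc ?e \<and> reg \<tau> 15 = ?r \<and>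
       reg \<tau> 16 = port md h ?r \<and> reg \<tau> 18 = t)"
    if gl: "globals \<sigma>" and m: "mem \<sigma> = \<mu>" for \<sigma>
    using gm e bnd size_facts(14) globals_set_reg gl
    by (cases md) (simp_all add: runs_simps globalsD[OF gl] m globals_mem_def port_code_def port_def, auto simp: globals_def)
  let ?out = "\<lambda>b x. of_bool (\<exists>b'<b. \<exists>i<h. x = b' div nb2 * h + i \<and> K < 2 * tally ?e b' (?r * h + i)) :: nat"
  let ?D = "\<lambda>b b' (k'::nat). if b' < b then Suc t else t"
  let ?J = "\<lambda>b \<mu> out. globals_mem t \<mu> \<and> progress_inv (?D b) \<mu> \<and> out = ?out b"
  let ?\<Phi> = "\<lambda>b. 8 * (\<Sum>b'<b. \<Sum>k<K. cost ?e b' ?r k) + b * (loop_cost + 4)"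
  have 4: "runs B coin ?inp (For 20 7 (block_round md A)) \<sigma>
      (\<lambda>u \<tau>. u + ?\<Phi> 0 \<le> ?\<Phi> (reg \<sigma> 7) + 4 \<and> agree 20 \<sigma> \<tau> \<and> ?J (reg \<sigma> 7) (mem \<tau>) (outp \<tau>))"
    if gl: "globals \<sigma>" and m: "mem \<sigma> = \<mu>" "outp \<sigma> = (\<lambda>_. 0)"
      and r: "reg \<sigma> 14 = Suc ?e" "reg \<sigma> 15 = ?r" "reg \<sigma> 16 = port md h ?r" for \<sigma>
  proof (rule runs_For)
    fix b \<tau>
    assume b: "b < reg \<sigma> 7" and ag: "agree 20 \<sigma> \<tau>" and rb: "reg \<tau> 20 = b" and J: "?J b (mem \<tau>) (outp \<tau>)"
    have bNB: "b < NB" using b gl by (simp add: globals_def)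
    have gl': "globals \<tau>" by (rule globals_agree[OF gl ag]) simp
    have rr: "reg \<tau> 14 = Suc ?e" "reg \<tau> 15 = ?r" "reg \<tau> 16 = port md h ?r"
      using agreeD[OF ag] r by simp_all
    have pi: "progress_inv (?D b) (mem \<tau>)" and gm': "globals_mem t (mem \<tau>)" using J by simp_all
    have Db: "?D b b k = ?e * h + ?r" for k by simp
    have DD: "(\<lambda>b' k'. if b' = b then Suc (?e * h + ?r) else ?D b b' k') = ?D (Suc b)"
      unfolding th by (auto simp: fun_eq_iff less_Suc_eq)
    note step = runs_block_round[where D = "?D b", OF gl' rr rb bNB e(1) rh Db pi gm', unfolded DD, unfolded th]
    show "runs B coin ?inp (block_round md A) \<tau>
      (\<lambda>u \<tau>'. u + ?\<Phi> b + 4 \<le> ?\<Phi> (Suc b) \<and> agree (20 + 2) \<tau> \<tau>' \<and> ?J (Suc b) (mem \<tau>') (outp \<tau>'))"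
    proof (rule runs_mono[OF step], elim conjE)
      fix u :: nat and \<tau>' :: state
      assume *: "u \<le> 8 * (\<Sum>k<K. cost ?e b ?r k) + loop_cost" "agree 22 \<tau> \<tau>'" "globals_mem t (mem \<tau>')"
        "progress_inv (?D (Suc b)) (mem \<tau>')"
        "outp \<tau>' = (\<lambda>x. if \<exists>i<h. x = b div nb2 * h + i \<and> K < 2 * tally ?e b (?r * h + i) then 1 else outp \<tau> x)"
      have "outp \<tau>' = ?out (Suc b)" unfolding *(5) using J by (auto simp: fun_eq_iff less_Suc_eq)
      moreover have "?\<Phi> (Suc b) = ?\<Phi> b + 8 * (\<Sum>k<K. cost ?e b ?r k) + (loop_cost + 4)" by simp
      ultimately show "u + ?\<Phi> b + 4 \<le> ?\<Phi> (Suc b) \<and> agree (20 + 2) \<tau> \<tau>' \<and> ?J (Suc b) (mem \<tau>') (outp \<tau>')"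
        using *(1-4) by simp
    qed
  next
    show "?J 0 (mem \<sigma>) (outp \<sigma>)" using gm inv m by simp
  qed (use gl size_facts in \<open>simp_all add: globals_def\<close>)
  have 5: "runs B coin ?inp (seqs [Arith Add 18 18 1, Store 0 18]) \<sigma>
    (\<lambda>u \<tau>. u = 3 \<and> mem \<tau> = (mem \<sigma>)(0 := Suc t) \<and> outp \<tau> = outp \<sigma>)"
    if "globals \<sigma>" "reg \<sigma> 18 = t" for \<sigma>
    using e by (simp add: runs_simps globalsD[OF that(1)] that(2))
  show ?thesis
    unfolding round_code_def runs_Seq
  proof (rule runs_mono[OF 1], elim conjE, hypsubst, rule runs_mono[OF 2], elim conjE, hypsubst)
    fix \<sigma>2 assume gl2: "globals \<sigma>2" and m2: "mem \<sigma>2 = mem ?\<sigma>1" "outp \<sigma>2 = outp ?\<sigma>1"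
    have m2': "mem \<sigma>2 = \<mu>" "outp \<sigma>2 = (\<lambda>_. 0)" using m2 by (simp_all add: init_state_def)
    show "runs B coin ?inp (seqs [Load 18 0, Arith Div 14 18 3, Arith Add 14 14 1, Arith Mod 15 18 3, port_code md]) \<sigma>2
      (\<lambda>tb \<sigma>'. runs B coin ?inp (For 20 7 (block_round md A)) \<sigma>' (\<lambda>tc \<sigma>''.
        runs B coin ?inp (seqs [Arith Add 18 18 1, Store 0 18]) \<sigma>'' (\<lambda>u \<tau>.
          5 + (P + R + ex + 15 + (tb + (tc + u))) \<le> 8 * (\<Sum>b<NB. \<Sum>k<K. cost ?e b ?r k) + NB * (loop_cost + 4) + (P + R + ex + 40) \<and>
          globals_mem (Suc t) (mem \<tau>) \<and> progress_inv (\<lambda>_ _. Suc t) (mem \<tau>) \<and> outp \<tau> = round_output t)))"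
    proof (rule runs_mono[OF 3[OF gl2 m2'(1)]], elim conjE)
      fix u3 :: nat and \<sigma>3 :: state
      assume s3: "u3 \<le> 8" "globals \<sigma>3" "mem \<sigma>3 = mem \<sigma>2" "outp \<sigma>3 = outp \<sigma>2" "reg \<sigma>3 14 = Suc ?e" "reg \<sigma>3 15 = ?r"
       "reg \<sigma>3 16 = port md h ?r" "reg \<sigma>3 18 = t"
      show "runs B coin ?inp (For 20 7 (block_round md A)) \<sigma>3 (\<lambda>tc \<sigma>''.
        runs B coin ?inp (seqs [Arith Add 18 18 1, Store 0 18]) \<sigma>'' (\<lambda>u \<tau>.
          5 + (P + R + ex + 15 + (u3 + (tc + u))) \<le> 8 * (\<Sum>b<NB. \<Sum>k<K. cost ?e b ?r k) + NB * (loop_cost + 4) + (P + R + ex + 40) \<and>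
          globals_mem (Suc t) (mem \<tau>) \<and> progress_inv (\<lambda>_ _. Suc t) (mem \<tau>) \<and> outp \<tau> = round_output t))"
      proof (rule runs_mono[OF 4[OF s3(2) _ _ s3(5-7)]], goal_cases)
        case 1 show ?case using s3(3) m2' by simp
      next
        case 2 show ?case using s3(4) m2' by simp
      next
        case (3 u4 \<sigma>4)
        have s4: "u4 \<le> ?\<Phi> NB + 4" "agree 20 \<sigma>3 \<sigma>4" "globals_mem t (mem \<sigma>4)" "progress_inv (?D NB) (mem \<sigma>4)" "outp \<sigma>4 = ?out NB"
          using 3 unfolding globalsD(8)[OF s3(2)] by simp_all
        have gl4: "globals \<sigma>4" by (rule globals_agree[OF s3(2) s4(2)]) simp
        have r4: "reg \<sigma>4 18 = t" using agreeD[OF s4(2), of 18] s3(8) by simp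
        have "progress_inv (\<lambda>_ _. Suc t) (mem \<sigma>4)" by (rule progress_inv_cong[OF s4(4)]) simp
        then have pi: "progress_inv (\<lambda>_ _. Suc t) ((mem \<sigma>4)(0 := Suc t))"
          unfolding progress_inv_def using mem_inv_low[of 0] size_facts(2) by simp
        have gm4: "globals_mem (Suc t) ((mem \<sigma>4)(0 := Suc t))" using s4(3) by (simp add: globals_mem_def)
        have out4: "outp \<sigma>4 = round_output t" unfolding s4(5) round_output_def by simp
        show ?case
          by (rule runs_mono[OF 5[OF gl4 r4]]) (use s3(1) s4(1) pi gm4 out4 in auto)
      qed
    qed
  qed
qed

section \<open>Preprocessing of all blocks\<close>

lemma region_outside:
  assumes "(e', b', k') \<noteq> (e, b, k)" "b < NB" "b' < NB" "k \<le> K" "k' \<le> K" "i < W"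
  shows "region e' b' k' + i < region e b k \<or> region e b k + V < region e' b' k' + i"
proof (rule ccontr)
  assume "\<not> ?thesis"
  then obtain i' where "region e' b' k' + i = region e b k + i'" "i' \<le> V"
    by (metis add_le_cancel_left le_Suc_ex not_less)
  then show False using region_eq_iff[of e' b' k' i e b k i'] assms V by auto
qed

lemma memory_Nil: "memory k [] = (\<lambda>_. 0)"
  by (simp add: memory_def)

lemma memory_pre: "memory k [c] = call_mem V (coins_of k) (\<lambda>_. 0) c"
  by (simp add: memory_def)

lemma tt_pre: "tt k [c] = call_time V (coins_of k) (\<lambda>_. 0) c"
  using tt_snoc[of k "[]" c] by (simp add: total_time_Nil memory_Nil)

text \<open>\<open>dn\<close> marks the copies that are already preprocessed; the region of any
  other copy is untouched, since its simulation has to start from zero memory. From block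
  \<open>bg\<close> on the graph region is empty, which fixes the contents of the cells that are
  skipped when \<open>n'\<close> and the ones of the adjacency matrix are written.\<close>

definition pre_inv :: "(nat \<Rightarrow> nat \<Rightarrow> bool) \<Rightarrow> nat \<Rightarrow> (nat \<Rightarrow> nat) \<Rightarrow> bool" where
  "pre_inv dn bg \<mu> \<longleftrightarrow> globals_mem 0 \<mu> \<and>
     (\<forall>b k a. b < NB \<longrightarrow> k < K \<longrightarrow> a \<le> V \<longrightarrow> \<mu> (region 0 b k + a) - 1 = memory k (if dn b k then [pre_call b] else []) a \<and>
        memory k (if dn b k then [pre_call b] else []) a \<le> V \<and> (\<not> dn b k \<longrightarrow> \<mu> (region 0 b k + a) = 0)) \<and>
     (\<forall>e b k i. b < NB \<longrightarrow> k \<le> K \<longrightarrow> i < W \<longrightarrow> \<mu> (region (Suc e) b k + i) = 0) \<and>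
     (\<forall>b i. bg \<le> b \<longrightarrow> b < NB \<longrightarrow> i < W \<longrightarrow> \<mu> (region 0 b K + i) = 0) \<and>
     (\<forall>a\<le>V. \<mu> (W + a) = 0)"

lemma pre_inv_cong:
  assumes "pre_inv dn bg \<mu>" "\<And>b k. b < NB \<Longrightarrow> k < K \<Longrightarrow> dn b k = dn' b k"
  shows "pre_inv dn' bg \<mu>"
  using assms unfolding pre_inv_def by auto

lemma runs_copy_preprocess:
  assumes gl: "globals \<sigma>" and r: "reg \<sigma> 20 = b" "reg \<sigma> 30 = k" "reg \<sigma> 22 = region 0 b K"
    and b: "b < NB" and k: "k < K" and inv: "pre_inv dn bg (mem \<sigma>)" and dn: "\<not> dn b k"
    and graph: "\<And>a. a \<le> V \<Longrightarrow> mem \<sigma> (region 0 b K + a) = snd (pre_call b) a"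
  shows "runs B coin inp (copy_preprocess A) \<sigma> (\<lambda>u \<tau>. u \<le> 8 * tt k [pre_call b] + regs_bound + 20 \<and>
    agree 32 \<sigma> \<tau> \<and> outp \<tau> = outp \<sigma> \<and> pre_inv (\<lambda>b' k'. b' = b \<and> k' = k \<or> dn b' k') bg (mem \<tau>) \<and>
    (\<forall>a\<le>V. mem \<tau> (region 0 b K + a) = snd (pre_call b) a))"
proof -
  let ?E = "init_arcs md h w (block_matrix b)"
  let ?dn = "\<lambda>b' k'. b' = b \<and> k' = k \<or> dn b' k'"
  let ?\<tau> = "set_reg 35 (region 0 b K) (set_reg 34 (k * W) (set_reg 33 (region 0 b k) (set_reg 32 (region 0 b k) \<sigma>)))"
  have rl: "region 0 b k + W \<le> B" "region 0 b K + W \<le> B" by (rule region_le; use b k in simp)+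
  have "k * W \<le> K * W" using k by simp
  then have kW: "k * W + W \<le> B" using size_facts(16) by linarith
  have 1: "runs B coin inp (region_code 32 0 30) \<sigma> (\<lambda>u \<tau>. u = 7 \<and> \<tau> = set_reg 32 (region 0 b k) \<sigma>)"
    by (rule runs_region_code) (use gl r rl in \<open>auto simp: globalsD\<close>)
  have 2: "runs B coin inp (seqs [Arith Add 33 32 0, Arith Mul 34 30 5, Arith Add 35 22 0]) (set_reg 32 (region 0 b k) \<sigma>)
     (\<lambda>u \<tau>. 7 + u = 11 \<and> \<tau> = ?\<tau>)"
    using rl kW by (simp add: runs_simps globalsD[OF gl] r)
  have 12: "runs B coin inp (seqs [region_code 32 0 30, Arith Add 33 32 0, Arith Mul 34 30 5, Arith Add 35 22 0]) \<sigma>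
     (\<lambda>u \<tau>. u = 11 \<and> \<tau> = ?\<tau>)"
    unfolding seqs.simps(2)[of "region_code _ _ _"] runs_Seq
    by (rule runs_mono[OF 1], elim conjE, hypsubst, rule runs_mono[OF 2]) simp
  have ha: "halts V (coins_of k) (\<lambda>_. 0) (dom_preprocess A, graph_input n' 0 ?E)"
    using halt[of "coins_of k" "block_matrix b" "\<lambda>_ _. False"] by (simp add: dom_calls_def)
  have pc: "(dom_preprocess A, graph_input n' 0 ?E) = pre_call b" by (simp add: pre_call_def)
  have z: "mem \<sigma> (region 0 b k + a) = 0" if "a \<le> V" for a
    using inv b k dn that unfolding pre_inv_def by blast
  have zz: "memory k [] a \<le> V" for a by (simp add: memory_Nil)
  have sep: "region 0 b k + V < region 0 b K \<or> region 0 b K + V < region 0 b k"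
  proof -
    have "region 0 b K + 0 < region 0 b k \<or> region 0 b k + V < region 0 b K + 0"
      "region 0 b k + 0 < region 0 b K \<or> region 0 b K + V < region 0 b k + 0"
      by (rule region_outside; use b k size_facts(2) in simp)+
    then show ?thesis by linarith
  qed
  have main: "runs B coin inp (simulate_call (dom_preprocess A)) ?\<tau> (\<lambda>t \<tau>'.
      t \<le> 8 * call_time V (coins_of k) (\<lambda>_. 0) (dom_preprocess A, graph_input n' 0 ?E) + reg_bound (dom_preprocess A) + 1 \<and>
      (\<forall>a\<le>V. overlay (mem \<tau>') (reg ?\<tau> 32) (reg ?\<tau> 33) a = call_mem V (coins_of k) (\<lambda>_. 0) (dom_preprocess A, graph_input n' 0 ?E) a \<and>
        call_mem V (coins_of k) (\<lambda>_. 0) (dom_preprocess A, graph_input n' 0 ?E) a \<le> V) \<and>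
      (\<forall>a. a < reg ?\<tau> 32 \<or> reg ?\<tau> 32 + V < a \<longrightarrow> mem \<tau>' a = mem ?\<tau> a) \<and>
      agree 50 ?\<tau> \<tau>' \<and> outp \<tau>' = outp ?\<tau> \<and> reg \<tau>' 50 = call_out V (coins_of k) (\<lambda>_. 0) (dom_preprocess A, graph_input n' 0 ?E) 0)"
  proof (rule runs_simulate_call[OF ha])
    show "overlay (mem ?\<tau>) (reg ?\<tau> 32) (reg ?\<tau> 33) a = 0" if "a \<le> V" for a
      using z[OF that] by (simp add: overlay_def)
    show "reg ?\<tau> 32 + V < reg ?\<tau> 35 \<or> reg ?\<tau> 35 + V < reg ?\<tau> 32" using sep by simp
    show "mem ?\<tau> (reg ?\<tau> 35 + a) = graph_input n' 0 ?E a" if "a \<le> V" for a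
      using graph[OF that] by (simp add: pre_call_def)
    show "coin (reg ?\<tau> 34 + a) = coins_of k a" if "a \<le> V" for a
      using that by (simp add: coins_of_def)
    show "reg ?\<tau> 32 + V \<le> B" "reg ?\<tau> 33 + V \<le> B" "reg ?\<tau> 34 + V \<le> B" "reg ?\<tau> 35 + V \<le> B" "V + 1 \<le> B"
      using rl kW V(2) size_facts(6) by simp_all
  qed (simp_all add: V(1)[simplified] globalsD[OF gl])
  show ?thesis
    unfolding copy_preprocess_def runs_Seq
  proof (rule runs_mono[OF 12], elim conjE, hypsubst, rule runs_mono[OF main], unfold pc, elim conjE)
    fix u :: nat and \<tau> :: state
    assume t: "u \<le> 8 * call_time V (coins_of k) (\<lambda>_. 0) (pre_call b) + reg_bound (dom_preprocess A) + 1"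
      and new: "\<forall>a\<le>V. overlay (mem \<tau>) (reg ?\<tau> 32) (reg ?\<tau> 33) a = call_mem V (coins_of k) (\<lambda>_. 0) (pre_call b) a \<and>
        call_mem V (coins_of k) (\<lambda>_. 0) (pre_call b) a \<le> V"
      and old: "\<forall>a. a < reg ?\<tau> 32 \<or> reg ?\<tau> 32 + V < a \<longrightarrow> mem \<tau> a = mem ?\<tau> a"
      and rest: "agree 50 ?\<tau> \<tau>" "outp \<tau> = outp ?\<tau>"
    have ag: "agree 32 \<sigma> \<tau>" using rest(1) by (auto simp: agree_def)
    have new': "mem \<tau> (region 0 b k + a) - 1 = memory k [pre_call b] a \<and> memory k [pre_call b] a \<le> V" if "a \<le> V" for a
      using new that unfolding memory_pre by (auto simp: overlay_def)
    have low: "mem \<tau> a = mem \<sigma> a" if "a < 2 * W" for a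
      using old that region_ge[of 0 b k] by simp
    have same: "mem \<tau> (region e' b' k' + i) = mem \<sigma> (region e' b' k' + i)"
      if "(e', b', k') \<noteq> (0, b, k)" "b' < NB" "k' \<le> K" "i < W" for e' b' k' i
    proof -
      have "region e' b' k' + i < region 0 b k \<or> region 0 b k + V < region e' b' k' + i"
        by (rule region_outside) (use that b k in auto)
      then show ?thesis using old by auto
    qed
    have inv1: "mem \<sigma> (region 0 b' k' + a) - 1 = memory k' (if dn b' k' then [pre_call b'] else []) a \<and>
        memory k' (if dn b' k' then [pre_call b'] else []) a \<le> V \<and> (\<not> dn b' k' \<longrightarrow> mem \<sigma> (region 0 b' k' + a) = 0)"
      if "b' < NB" "k' < K" "a \<le> V" for b' k' a
      using inv that unfolding pre_inv_def by blast
    have "pre_inv ?dn bg (mem \<tau>)"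
      unfolding pre_inv_def
    proof (intro conjI allI impI)
      show "globals_mem 0 (mem \<tau>)"
        using inv low size_facts(2) unfolding pre_inv_def globals_mem_def by simp
    next
      fix b' k' a assume *: "b' < NB" "k' < K" "a \<le> V"
      have c: "b' = b \<and> k' = k \<or> (0, b', k') \<noteq> (0 :: nat, b, k)" by auto
      have aW: "a < W" using * V by simp
      show "mem \<tau> (region 0 b' k' + a) - 1 = memory k' (if ?dn b' k' then [pre_call b'] else []) a"
        using c new'[OF *(3)] inv1[OF *] same[of 0 b' k' a] * aW dn by (cases "b' = b \<and> k' = k") auto
      show "memory k' (if ?dn b' k' then [pre_call b'] else []) a \<le> V"
        using c new'[OF *(3)] inv1[OF *] by auto
      show "mem \<tau> (region 0 b' k' + a) = 0" if "\<not> ?dn b' k'"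
        using that inv1[OF *] same[of 0 b' k' a] * aW by auto
    next
      fix e' b' k' i assume "b' < NB" "k' \<le> K" "i < W"
      then show "mem \<tau> (region (Suc e') b' k' + i) = 0"
        using same[of "Suc e'" b' k' i] inv unfolding pre_inv_def by simp
    next
      fix b' i assume "bg \<le> b'" "b' < NB" "i < W"
      then show "mem \<tau> (region 0 b' K + i) = 0"
        using same[of 0 b' K i] inv k unfolding pre_inv_def by simp
    next
      fix a assume "a \<le> V"
      then show "mem \<tau> (W + a) = 0" using low[of "W + a"] V inv unfolding pre_inv_def by simp
    qed
    moreover have "\<forall>a\<le>V. mem \<tau> (region 0 b K + a) = snd (pre_call b) a"
      using same[of 0 b K] b k V graph by simp
    ultimately show "11 + u \<le> 8 * tt k [pre_call b] + regs_bound + 20 \<and> agree 32 \<sigma> \<tau> \<and> outp \<tau> = outp \<sigma> \<and>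
      pre_inv ?dn bg (mem \<tau>) \<and> (\<forall>a\<le>V. mem \<tau> (region 0 b K + a) = snd (pre_call b) a)"
      using t ag rest(2) unfolding tt_pre by simp
  qed
qed

lemma init_arcs_iff:
  assumes "x < n'" "y < n'"
  shows "(x, y) \<in> init_arcs md h w Mb \<longleftrightarrow> (x < h \<and> y = x + 1) \<or> (x = h \<and> \<not> y < h + 1 + w) \<or>
    (md = Decremental \<and> x < h \<and> h < y \<and> y < h + 1 + w) \<or>
    (h < x \<and> x < h + 1 + w \<and> \<not> y < h + 1 + w \<and> Mb (y - (h + 1 + w)) (x - (h + 1)))"
proof -
  have "(\<exists>i j. i < h \<and> j < w \<and> Mb i j \<and> x = h + 1 + j \<and> y = h + 1 + w + i) \<longleftrightarrow>
    (h < x \<and> x < h + 1 + w \<and> \<not> y < h + 1 + w \<and> Mb (y - (h + 1 + w)) (x - (h + 1)))" (is "?l = ?r")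
  proof
    assume ?r
    then have "y - (h + 1 + w) < h \<and> x - (h + 1) < w \<and> Mb (y - (h + 1 + w)) (x - (h + 1)) \<and>
      x = h + 1 + (x - (h + 1)) \<and> y = h + 1 + w + (y - (h + 1 + w))"
      using assms unfolding n'_def by auto
    then show ?l by blast
  qed auto
  then show ?thesis
    using assms unfolding init_arcs_def gadget_arcs_def port_arcs_def n'_def
    by (cases md) auto
qed

lemma runs_cell_code:
  assumes gl: "globals \<sigma>" and r: "reg \<sigma> 30 = a" "reg \<sigma> 22 = G" "reg \<sigma> 23 = b div nb2 * h" "reg \<sigma> 24 = b mod nb2 * w"
    and a: "a < n' * n'" and b: "b < NB" and G: "G + W \<le> B"
  shows "runs B coin (matrix_input n M) (cell_code md) \<sigma> (\<lambda>u \<tau>. u \<le> 50 \<and> agree 32 \<sigma> \<tau> \<and> outp \<tau> = outp \<sigma> \<and>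
    mem \<tau> = (if (a div n', a mod n') \<in> init_arcs md h w (block_matrix b) then (mem \<sigma>)(G + 2 + a := 1) else mem \<sigma>))"
proof -
  define x y where "x = a div n'" and "y = a mod n'"
  have xy: "x < n'" "y < n'" using a by (simp_all add: x_def y_def less_mult_imp_div_less n'_def)
  have "b div nb2 * h \<le> n" "b mod nb2 * w \<le> n" using row_le[OF b] col_le[of b] .
  let ?ad = "(y - (h + 1 + w) + b div nb2 * h) * n + (x - (h + 1) + b mod nb2 * w) + 1"
  have small: "h + 1 + w \<le> B" "Suc x \<le> B" "x \<le> B" "y \<le> B" "Suc (Suc (Suc (Suc 0))) \<le> B"
    using xy size_facts(2,7,13) unfolding n'_def by linarith+
  have row: "(y - (h + 1 + w) + b div nb2 * h) * n \<le> (n + h) * n"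
    using xy(2) row_le[OF b] unfolding n'_def by (intro mult_le_mono1) simp
  have addr: "?ad \<le> B" if "x < h + 1 + w"
  proof -
    have "x - (h + 1) + b mod nb2 * w \<le> w + n" using that col_le[of b] by (intro add_mono) simp_all
    then show ?thesis using row bound(2) by linarith
  qed
  have addr': "y - (h + 1 + w) + b div nb2 * h \<le> B" "(y - (h + 1 + w) + b div nb2 * h) * n \<le> B"
    "x - (h + 1) + b mod nb2 * w \<le> B"  "(y - (h + 1 + w) + b div nb2 * h) * n + (x - (h + 1) + b mod nb2 * w) \<le> B" if "x < h + 1 + w"
  proof -
    have "y - (h + 1 + w) + b div nb2 * h \<le> (y - (h + 1 + w) + b div nb2 * h) * n"
      using mult_le_mono2[OF n, of "y - (h + 1 + w) + b div nb2 * h"] by (simp only: mult_1_right)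
    then show "y - (h + 1 + w) + b div nb2 * h \<le> B" "(y - (h + 1 + w) + b div nb2 * h) * n \<le> B"
      "x - (h + 1) + b mod nb2 * w \<le> B" "(y - (h + 1 + w) + b div nb2 * h) * n + (x - (h + 1) + b mod nb2 * w) \<le> B"
      using addr[OF that] by linarith+
  qed
  define mv where "mv = matrix_input n M ?ad"
  have mv: "mv \<le> Suc 0" by (simp add: mv_def matrix_input_def)
  have bm: "block_matrix b (y - (h + 1 + w)) (x - (h + 1)) \<longleftrightarrow> mv = 1"
    by (simp add: block_matrix_def mv_def add.commute)
  have cell: "G + 2 + a \<le> B" "G + a \<le> B" using G a graph_size by linarith+
  note iff = init_arcs_iff[OF xy, of "block_matrix b", unfolded bm]
  define a0 b0 ro co where "a0 = h + 1 + w" and "b0 = h + 1" and "ro = b div nb2 * h" and "co = b mod nb2 * w"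
  have R: "reg \<sigma> 0 = 0" "reg \<sigma> (Suc 0) = Suc 0" "reg \<sigma> 2 = n" "reg \<sigma> 3 = h" "reg \<sigma> 9 = b0" "reg \<sigma> 11 = a0" "reg \<sigma> 12 = n'"
    "reg \<sigma> 17 = 2" "reg \<sigma> 30 = a" "reg \<sigma> 22 = G" "reg \<sigma> 23 = ro" "reg \<sigma> 24 = co" "a div n' = x" "a mod n' = y"
    using globalsD[OF gl] r by (simp_all add: a0_def b0_def ro_def co_def x_def y_def)
  have mvR: "matrix_input n M (Suc ((y - a0 + ro) * n + (x - b0 + co))) = mv"
    by (simp add: mv_def a0_def b0_def ro_def co_def)
  have bnds: "y - a0 \<le> B" "x - b0 \<le> B" "G + a \<le> B" "Suc (Suc (G + a)) \<le> B" "Suc 0 \<le> B"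
     "Suc (Suc 0) \<le> B" "Suc (Suc (Suc 0)) \<le> B" "Suc (Suc (Suc (Suc 0))) \<le> B" "mv \<le> B" "Suc mv \<le> B"
    using small cell mv by linarith+
  have addrs: "y - a0 + ro \<le> B" "(y - a0 + ro) * n \<le> B" "x - b0 + co \<le> B" "(y - a0 + ro) * n + (x - b0 + co) \<le> B"
    "Suc ((y - a0 + ro) * n + (x - b0 + co)) \<le> B" if "x < a0"
    using addr'[OF that[unfolded a0_def]] addr[OF that[unfolded a0_def]] unfolding a0_def b0_def ro_def co_def by simp_all
  have iff': "(x, y) \<in> init_arcs md h w (block_matrix b) \<longleftrightarrow> (x < h \<and> y = Suc x) \<or> (x = h \<and> \<not> y < a0) \<or>
    (md = Decremental \<and> x < h \<and> h < y \<and> y < a0) \<or> (h < x \<and> x < a0 \<and> \<not> y < a0 \<and> mv = 1)"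
    unfolding iff a0_def by simp
  have ob: "of_bool P \<le> B" for P using bnds(5) by auto
  let ?s = "of_bool (x < h) * of_bool (y = Suc x) + of_bool (x = h) * of_bool (\<not> y < a0) +
    (if md = Decremental then of_bool (x < h) * of_bool (h < y) * of_bool (y < a0) else 0) :: nat"
  let ?t = "of_bool (h < x) * of_bool (x < a0) * of_bool (\<not> y < a0) :: nat"
  have s: "?s \<le> Suc (Suc (Suc 0))" by (auto simp: of_bool_def)
  have ob2: "of_bool P * of_bool Q = (of_bool (P \<and> Q) :: nat)" "of_bool (of_bool P = (0 :: nat)) = (of_bool (\<not> P) :: nat)" for P Q
    by auto
  have tests: "runs B coin (matrix_input n M) (cell_tests md) \<sigma> (\<lambda>u \<tau>. u = 22 \<and> agree 32 \<sigma> \<tau> \<and> outp \<tau> = outp \<sigma> \<and> mem \<tau> = mem \<sigma> \<and>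
    reg \<tau> 32 = x \<and> reg \<tau> 33 = y \<and> reg \<tau> 34 = ?s \<and> reg \<tau> 35 = ?t)"
  proof -
    have le3: "of_bool P + of_bool Q \<le> B" "of_bool P + of_bool Q + of_bool R' \<le> B" for P Q R'
      using bnds(5,6,7) by (auto simp: of_bool_def)
    show ?thesis
      unfolding cell_tests_def using small(2-4) ob
      by (cases md) (simp_all add: runs_simps R agree_refl ob2 le3 del: of_bool_conj)
  qed
  have fin: "runs B coin (matrix_input n M) (seqs [Arith Add 35 22 30, Arith Add 35 35 17, If 34 (Store 35 1) Skip]) \<tau>
     (\<lambda>u \<tau>'. u \<le> 5 \<and> agree 32 \<tau> \<tau>' \<and> outp \<tau>' = outp \<tau> \<and>
       mem \<tau>' = (if reg \<tau> 34 \<noteq> 0 then (mem \<tau>)(G + 2 + a := 1) else mem \<tau>))"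
    if "agree 32 \<sigma> \<tau>" for \<tau>
    using bnds agreeD[OF that] R by (simp add: runs_simps agree_refl)
  have entry: "runs B coin (matrix_input n M) (If 35 (seqs [Arith Sub 37 33 11, Arith Add 37 37 23, Arith Mul 37 37 2, Arith Sub 38 32 9,
       Arith Add 38 38 24, Arith Add 37 37 38, Arith Add 37 37 1, Input 37 37, Arith Add 34 34 37]) Skip) \<tau>
     (\<lambda>u \<tau>'. u \<le> 11 \<and> agree 32 \<sigma> \<tau>' \<and> outp \<tau>' = outp \<tau> \<and> mem \<tau>' = mem \<tau> \<and>
       reg \<tau>' 34 = ?s + (if ?t \<noteq> 0 then mv else 0))"
    if ag: "agree 32 \<sigma> \<tau>" and r: "reg \<tau> 32 = x" "reg \<tau> 33 = y" "reg \<tau> 34 = ?s" "reg \<tau> 35 = ?t" for \<tau>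
  proof (cases "?t = 0")
    case True
    then show ?thesis using r(3,4) ag by (simp only: runs_If) (simp add: runs_Skip)
  next
    case False
    then have xa: "x < a0" by (auto simp: of_bool_def split: if_splits)
    have sm: "?s + mv \<le> B" using s mv bnds(8) by linarith
    obtain s' where s': "s' = ?s" by simp
    have t: "reg \<tau> 35 \<noteq> 0" using False r(4) by simp
    have "runs B coin (matrix_input n M) (If 35 (seqs [Arith Sub 37 33 11, Arith Add 37 37 23, Arith Mul 37 37 2, Arith Sub 38 32 9,
       Arith Add 38 38 24, Arith Add 37 37 38, Arith Add 37 37 1, Input 37 37, Arith Add 34 34 37]) Skip) \<tau>
     (\<lambda>u \<tau>'. u \<le> 11 \<and> agree 32 \<sigma> \<tau>' \<and> outp \<tau>' = outp \<tau> \<and> mem \<tau>' = mem \<tau> \<and> reg \<tau>' 34 = s' + mv)"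
      using bnds addrs[OF xa] agreeD[OF ag] R ag t sm r(1,2) r(3)[folded s'] unfolding s'[symmetric]
      by (simp add: runs_simps mvR)
    then show ?thesis unfolding s' using False by (simp only: if_True simp_thms)
  qed
  \<comment> \<open>Register 34 is only tested for being nonzero, so adding up the cases acts as
    their disjunction.\<close>
  have val: "?s + (if ?t \<noteq> 0 then mv else 0) \<noteq> 0 \<longleftrightarrow> (x, y) \<in> init_arcs md h w (block_matrix b)"
    unfolding iff' using mv by (auto simp: of_bool_def)
  show ?thesis
    unfolding x_def[symmetric] y_def[symmetric] val[symmetric]
    unfolding cell_code_def runs_Seq seqs.simps(2)[of "If _ _ _" "[_, _, _]"]
  proof (rule runs_mono[OF tests], elim conjE)
    fix u1 :: nat and \<tau>1 :: state
    assume 1: "u1 = 22" "agree 32 \<sigma> \<tau>1" "outp \<tau>1 = outp \<sigma>" "mem \<tau>1 = mem \<sigma>"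
      "reg \<tau>1 32 = x" "reg \<tau>1 33 = y" "reg \<tau>1 34 = ?s" "reg \<tau>1 35 = ?t"
    show "runs B coin (matrix_input n M) (If 35 (seqs [Arith Sub 37 33 11, Arith Add 37 37 23, Arith Mul 37 37 2, Arith Sub 38 32 9,
       Arith Add 38 38 24, Arith Add 37 37 38, Arith Add 37 37 1, Input 37 37, Arith Add 34 34 37]) Skip) \<tau>1
      (\<lambda>ta \<sigma>'. runs B coin (matrix_input n M) (seqs [Arith Add 35 22 30, Arith Add 35 35 17, If 34 (Store 35 1) Skip]) \<sigma>'
        (\<lambda>u \<tau>. u1 + (ta + u) \<le> 50 \<and> agree 32 \<sigma> \<tau> \<and> outp \<tau> = outp \<sigma> \<and>
          mem \<tau> = (if ?s + (if ?t \<noteq> 0 then mv else 0) \<noteq> 0 then (mem \<sigma>)(G + 2 + a := 1) else mem \<sigma>)))"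
    proof (rule runs_mono[OF entry[OF 1(2,5-8)]], elim conjE)
      fix u2 :: nat and \<tau>2 :: state
      assume 2: "u2 \<le> 11" "agree 32 \<sigma> \<tau>2" "outp \<tau>2 = outp \<tau>1" "mem \<tau>2 = mem \<tau>1"
        "reg \<tau>2 34 = ?s + (if ?t \<noteq> 0 then mv else 0)"
      show "runs B coin (matrix_input n M) (seqs [Arith Add 35 22 30, Arith Add 35 35 17, If 34 (Store 35 1) Skip]) \<tau>2
        (\<lambda>u \<tau>. u1 + (u2 + u) \<le> 50 \<and> agree 32 \<sigma> \<tau> \<and> outp \<tau> = outp \<sigma> \<and>
          mem \<tau> = (if ?s + (if ?t \<noteq> 0 then mv else 0) \<noteq> 0 then (mem \<sigma>)(G + 2 + a := 1) else mem \<sigma>))"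
        unfolding 2(5)[symmetric]
      proof (rule runs_mono[OF fin[OF 2(2)]], elim conjE)
        fix u3 :: nat and \<tau>3 :: state
        assume 3: "u3 \<le> 5" "agree 32 \<tau>2 \<tau>3" "outp \<tau>3 = outp \<tau>2"
          "mem \<tau>3 = (if reg \<tau>2 34 \<noteq> 0 then (mem \<tau>2)(G + 2 + a := 1) else mem \<tau>2)"
        have "agree 32 \<sigma> \<tau>3" by (rule agree_trans[OF 2(2) 3(2)]) simp
        then show "u1 + (u2 + u3) \<le> 50 \<and> agree 32 \<sigma> \<tau>3 \<and> outp \<tau>3 = outp \<sigma> \<and>
          mem \<tau>3 = (if reg \<tau>2 34 \<noteq> 0 then (mem \<sigma>)(G + 2 + a := 1) else mem \<sigma>)"
          using 1(1,3,4) 2(1,3,4) 3(1,3,4) by simp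
      qed
    qed
  qed
qed

end

text \<open>Calls communicate through memory alone, so an invariant on memory, indexed by the number
  of calls made, governs the whole sequence.\<close>

lemma serve_invariant:
  assumes step: "\<And>t \<mu>. t < length calls \<Longrightarrow> I t \<mu> \<Longrightarrow>
      runs B coin (snd (calls ! t)) (fst (calls ! t)) (init_state \<mu>) (\<lambda>u \<tau>. u \<le> f t \<and> I (Suc t) (mem \<tau>) \<and> outp \<tau> = out t)"
    and init: "I 0 \<mu>"
  shows "\<exists>rs. serve B coin \<mu> calls rs \<and> length rs = length calls \<and> sum_list (map fst rs) \<le> sum f {..<length calls} \<and>
    (\<forall>t<length calls. snd (rs ! t) = out t)"
  using assms
proof (induction calls arbitrary: I f out \<mu>)
  case Nil
  then show ?case by (auto intro: serve.Nil)
next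
  case (Cons call calls)
  obtain c inp where call: "call = (c, inp)" by (cases call)
  have "runs B coin inp c (init_state \<mu>) (\<lambda>u \<tau>. u \<le> f 0 \<and> I (Suc 0) (mem \<tau>) \<and> outp \<tau> = out 0)"
    using Cons.prems(1)[of 0 \<mu>] Cons.prems(2) call by simp
  then obtain u \<tau> where e: "exec B coin inp c (init_state \<mu>) u \<tau>" "u \<le> f 0" "I (Suc 0) (mem \<tau>)" "outp \<tau> = out 0"
    unfolding runs_def by blast
  have "\<exists>rs. serve B coin (mem \<tau>) calls rs \<and> length rs = length calls \<and>
      sum_list (map fst rs) \<le> sum (\<lambda>t. f (Suc t)) {..<length calls} \<and> (\<forall>t<length calls. snd (rs ! t) = out (Suc t))"
  proof (rule Cons.IH[where I = "\<lambda>t. I (Suc t)"])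
    fix t \<mu>' assume "t < length calls" "I (Suc t) \<mu>'"
    then show "runs B coin (snd (calls ! t)) (fst (calls ! t)) (init_state \<mu>')
      (\<lambda>u \<tau>. u \<le> f (Suc t) \<and> I (Suc (Suc t)) (mem \<tau>) \<and> outp \<tau> = out (Suc t))"
      using Cons.prems(1)[of "Suc t" \<mu>'] by simp
  qed (rule e(3))
  then obtain rs where rs: "serve B coin (mem \<tau>) calls rs" "length rs = length calls"
    "sum_list (map fst rs) \<le> sum (\<lambda>t. f (Suc t)) {..<length calls}" "\<forall>t<length calls. snd (rs ! t) = out (Suc t)"
    by blast
  have "serve B coin \<mu> (call # calls) ((u, outp \<tau>) # rs)"
    unfolding call using e(1) rs(1) unfolding init_state_def by (rule serve.Cons)
  moreover have "sum_list (map fst ((u, outp \<tau>) # rs)) \<le> sum f {..<length (call # calls)}"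
    using rs(3) e(2) by (simp add: sum.lessThan_Suc_shift del: sum.lessThan_Suc)
  moreover have "snd (((u, outp \<tau>) # rs) ! t) = out t" if "t < length (call # calls)" for t
    using that rs(4) e(4) by (cases t) auto
  ultimately show ?case using rs(2) by (intro exI[of _ "(u, outp \<tau>) # rs"]) auto
qed

context omv_run
begin

lemma runs_cells:
  assumes gl: "globals \<sigma>" and r: "reg \<sigma> 22 = G" "reg \<sigma> 23 = b div nb2 * h" "reg \<sigma> 24 = b mod nb2 * w" "reg \<sigma> 25 = n' * n'"
    and b: "b < NB" and G: "G + W \<le> B"
  shows "runs B coin (matrix_input n M) (For 30 25 (cell_code md)) \<sigma> (\<lambda>u \<tau>. u \<le> n' * n' * 60 + 4 \<and> agree 30 \<sigma> \<tau> \<and>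
    outp \<tau> = outp \<sigma> \<and> mem \<tau> = (\<lambda>x. if G + 2 \<le> x \<and> x < G + 2 + n' * n' \<and>
      ((x - (G + 2)) div n', (x - (G + 2)) mod n') \<in> init_arcs md h w (block_matrix b) then 1 else mem \<sigma> x))"
proof -
  let ?mem = "\<lambda>a x. if G + 2 \<le> x \<and> x < G + 2 + a \<and>
      ((x - (G + 2)) div n', (x - (G + 2)) mod n') \<in> init_arcs md h w (block_matrix b) then 1 else mem \<sigma> x"
  let ?J = "\<lambda>a \<mu> out. \<mu> = ?mem a \<and> out = outp \<sigma>"
  have "runs B coin (matrix_input n M) (For 30 25 (cell_code md)) \<sigma>
     (\<lambda>u \<tau>. u + 0 * 60 \<le> reg \<sigma> 25 * 60 + 4 \<and> agree 30 \<sigma> \<tau> \<and> ?J (reg \<sigma> 25) (mem \<tau>) (outp \<tau>))"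
  proof (rule runs_For[where \<Phi> = "\<lambda>a. a * 60"])
    fix a \<tau>
    assume a: "a < reg \<sigma> 25" and ag: "agree 30 \<sigma> \<tau>" and ra: "reg \<tau> 30 = a" and J: "?J a (mem \<tau>) (outp \<tau>)"
    have an: "a < n' * n'" using a r by simp
    have gl': "globals \<tau>" by (rule globals_agree[OF gl ag]) simp
    have rr: "reg \<tau> 22 = G" "reg \<tau> 23 = b div nb2 * h" "reg \<tau> 24 = b mod nb2 * w"
      using agreeD[OF ag] r by simp_all
    show "runs B coin (matrix_input n M) (cell_code md) \<tau>
      (\<lambda>u \<tau>'. u + a * 60 + 4 \<le> Suc a * 60 \<and> agree (30 + 2) \<tau> \<tau>' \<and> ?J (Suc a) (mem \<tau>') (outp \<tau>'))"
    proof (rule runs_mono[OF runs_cell_code[OF gl' ra rr an b G]], elim conjE)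
      fix u :: nat and \<tau>' :: state
      assume *: "u \<le> 50" "agree 32 \<tau> \<tau>'" "outp \<tau>' = outp \<tau>"
        "mem \<tau>' = (if (a div n', a mod n') \<in> init_arcs md h w (block_matrix b) then (mem \<tau>)(G + 2 + a := 1) else mem \<tau>)"
      have "mem \<tau>' = ?mem (Suc a)"
      proof
        fix x show "mem \<tau>' x = ?mem (Suc a) x"
          using J unfolding *(4) by (cases "x = G + 2 + a") auto
      qed
      then show "u + a * 60 + 4 \<le> Suc a * 60 \<and> agree (30 + 2) \<tau> \<tau>' \<and> ?J (Suc a) (mem \<tau>') (outp \<tau>')"
        using *(1-3) J by simp
    qed
  next
    show "?J 0 (mem \<sigma>) (outp \<sigma>)" by (auto simp: fun_eq_iff)
  qed (use gl size_facts r in \<open>simp_all add: globals_def\<close>)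
  then show ?thesis unfolding r(4) by (rule runs_mono) simp
qed

abbreviation pre_cost :: nat where
  "pre_cost \<equiv> K * (regs_bound + 24) + n' * n' * 60 + 30"

lemma runs_block_preprocess:
  assumes gl: "globals \<sigma>" and r: "reg \<sigma> 20 = b" and b: "b < NB" and inv: "pre_inv (\<lambda>b' _. b' < b) b (mem \<sigma>)"
  shows "runs B coin (matrix_input n M) (block_preprocess md A) \<sigma> (\<lambda>u \<tau>.
    u \<le> 8 * (\<Sum>k<K. tt k [pre_call b]) + pre_cost \<and> agree 22 \<sigma> \<tau> \<and>
    pre_inv (\<lambda>b' _. b' < Suc b) (Suc b) (mem \<tau>))"
proof -
  let ?G = "region 0 b K"
  let ?E = "init_arcs md h w (block_matrix b)"
  let ?\<tau> = "set_reg 24 (b mod nb2 * w) (set_reg 23 (b div nb2 * h) \<sigma>)"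
  have "b div nb2 \<le> n div h" by (rule block_div_less[OF b])
  moreover have "n div h \<le> n" "b mod nb2 \<le> b" by simp_all
  ultimately have bnd: "b div nb2 \<le> B" "b div nb2 * h \<le> B" "b mod nb2 \<le> B" "b mod nb2 * w \<le> B"
    using row_le[OF b] col_le[of b] size_facts(9,10) b by linarith+
  have G: "?G + W \<le> B" by (rule region_le) (use b in auto)
  then have G': "?G \<le> B" by simp
  have 1: "runs B coin (matrix_input n M) block_offsets \<sigma> (\<lambda>u \<tau>. u = 5 \<and> \<tau> = ?\<tau>)"
    unfolding block_offsets_def using bnd by (simp add: runs_simps globalsD[OF gl] r)
  have 2: "runs B coin (matrix_input n M) (region_code 22 0 8) ?\<tau> (\<lambda>u \<tau>. u = 7 \<and> \<tau> = set_reg 22 ?G ?\<tau>)"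
    by (rule runs_region_code) (use gl r G' in \<open>auto simp: globals_set_reg globalsD\<close>)
  have 3: "runs B coin (matrix_input n M) (seqs [Store 22 12, Arith Mul 25 12 12]) (set_reg 22 ?G ?\<tau>)
    (\<lambda>u \<tau>. 12 + u = 15 \<and> agree 22 \<sigma> \<tau> \<and> globals \<tau> \<and> mem \<tau> = (mem \<sigma>)(?G := n') \<and>
      reg \<tau> 20 = b \<and> reg \<tau> 22 = ?G \<and> reg \<tau> 23 = b div nb2 * h \<and> reg \<tau> 24 = b mod nb2 * w \<and> reg \<tau> 25 = n' * n')"
    using G' size_facts(12) gl by (simp add: runs_simps globalsD[OF gl] r agree_refl globals_set_reg globals_upd)
  have 123: "runs B coin (matrix_input n M) (seqs [block_offsets, region_code 22 0 8, Store 22 12, Arith Mul 25 12 12]) \<sigma>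
    (\<lambda>u \<tau>. u = 15 \<and> agree 22 \<sigma> \<tau> \<and> globals \<tau> \<and> mem \<tau> = (mem \<sigma>)(?G := n') \<and>
      reg \<tau> 20 = b \<and> reg \<tau> 22 = ?G \<and> reg \<tau> 23 = b div nb2 * h \<and> reg \<tau> 24 = b mod nb2 * w \<and> reg \<tau> 25 = n' * n')"
    unfolding seqs.simps(2)[of "region_code _ _ _"] seqs.simps(2)[of block_offsets] runs_Seq
  proof (rule runs_mono[OF 1], elim conjE, hypsubst, rule runs_mono[OF 2], elim conjE, hypsubst, rule runs_mono[OF 3])
  qed simp
  define \<mu> where "\<mu> = (\<lambda>x. if ?G + 2 \<le> x \<and> x < ?G + 2 + n' * n' \<and>
      ((x - (?G + 2)) div n', (x - (?G + 2)) mod n') \<in> ?E then 1 else ((mem \<sigma>)(?G := n')) x)"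
  have zero: "mem \<sigma> (?G + i) = 0" if "i < W" for i
    using inv b that unfolding pre_inv_def by blast
  have graph: "\<mu> (?G + a) = snd (pre_call b) a" if "a \<le> V" for a
  proof -
    consider "a = 0" | "a = 1" | "2 \<le> a" by linarith
    then show ?thesis
    proof cases
      case 1 then show ?thesis by (simp add: \<mu>_def pre_call_def graph_input_def)
    next
      case 2 then show ?thesis using zero[of 1] size_facts(2) by (simp add: \<mu>_def pre_call_def graph_input_def)
    next
      case 3
      then have "?G + a - (?G + 2) = a - 2" by simp
      then show ?thesis using 3 zero[of a] that V(2) by (auto simp: \<mu>_def pre_call_def graph_input_def)
    qed
  qed
  have out: "\<mu> x = mem \<sigma> x" if "x < ?G \<or> ?G + W \<le> x" for x
    using that graph_size size_facts(2) by (auto simp: \<mu>_def)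
  have same: "\<mu> (region e' b' k' + i) = mem \<sigma> (region e' b' k' + i)"
    if "(e', b', k') \<noteq> (0, b, K)" "b' < NB" "k' \<le> K" "i < W" for e' b' k' i
  proof (rule out, rule ccontr)
    assume "\<not> (region e' b' k' + i < ?G \<or> ?G + W \<le> region e' b' k' + i)"
    then obtain i' where "region e' b' k' + i = ?G + i'" "i' < W"
      by (metis add_less_cancel_left le_Suc_ex not_less)
    then show False using region_eq_iff[of e' b' k' i 0 b K i'] that b by auto
  qed
  have low: "\<mu> x = mem \<sigma> x" if "x < 2 * W" for x
    using out[of x] that region_ge[of 0 b K] by simp
  have inv\<mu>: "pre_inv (\<lambda>b' k'. b' < b \<or> b' = b \<and> k' < 0) (Suc b) \<mu>"
    unfolding pre_inv_def
  proof (intro conjI allI impI)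
    show "globals_mem 0 \<mu>"
      using inv low size_facts(2) unfolding pre_inv_def globals_mem_def by simp
  next
    fix b' k' a assume *: "b' < NB" "k' < K" "a \<le> V"
    have s: "\<mu> (region 0 b' k' + a) = mem \<sigma> (region 0 b' k' + a)" using same[of 0 b' k' a] * V by simp
    have i: "mem \<sigma> (region 0 b' k' + a) - 1 = memory k' (if b' < b then [pre_call b'] else []) a \<and>
        memory k' (if b' < b then [pre_call b'] else []) a \<le> V \<and> (\<not> b' < b \<longrightarrow> mem \<sigma> (region 0 b' k' + a) = 0)"
      using inv * unfolding pre_inv_def by blast
    show "\<mu> (region 0 b' k' + a) - 1 = memory k' (if b' < b \<or> b' = b \<and> k' < 0 then [pre_call b'] else []) a"
      "memory k' (if b' < b \<or> b' = b \<and> k' < 0 then [pre_call b'] else []) a \<le> V"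
      using i unfolding s by simp_all
    show "\<mu> (region 0 b' k' + a) = 0" if "\<not> (b' < b \<or> b' = b \<and> k' < 0)"
      using i that unfolding s by simp
  next
    fix e' b' k' i assume "b' < NB" "k' \<le> K" "i < W"
    then show "\<mu> (region (Suc e') b' k' + i) = 0"
      using same[of "Suc e'" b' k' i] inv unfolding pre_inv_def by simp
  next
    fix b' i assume "Suc b \<le> b'" "b' < NB" "i < W"
    then show "\<mu> (region 0 b' K + i) = 0"
      using same[of 0 b' K i] inv unfolding pre_inv_def by simp
  next
    fix a assume "a \<le> V"
    then show "\<mu> (W + a) = 0" using low[of "W + a"] V inv unfolding pre_inv_def by simp
  qed
  let ?dn = "\<lambda>k b' k'. b' < b \<or> b' = b \<and> k' < k"
  let ?J = "\<lambda>k \<nu> out::nat \<Rightarrow> nat. pre_inv (?dn k) (Suc b) \<nu> \<and> (\<forall>a\<le>V. \<nu> (?G + a) = snd (pre_call b) a)"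
  let ?\<Phi> = "\<lambda>k. 8 * (\<Sum>k'<k. tt k' [pre_call b]) + k * (regs_bound + 24)"
  have loop: "runs B coin (matrix_input n M) (For 30 8 (copy_preprocess A)) \<tau>1
     (\<lambda>u \<tau>. u + ?\<Phi> 0 \<le> ?\<Phi> (reg \<tau>1 8) + 4 \<and> agree 30 \<tau>1 \<tau> \<and> ?J (reg \<tau>1 8) (mem \<tau>) (outp \<tau>))"
    if gl1: "globals \<tau>1" and r1: "reg \<tau>1 20 = b" "reg \<tau>1 22 = ?G" and m1: "mem \<tau>1 = \<mu>" for \<tau>1
  proof (rule runs_For)
    fix k \<tau>
    assume k: "k < reg \<tau>1 8" and ag: "agree 30 \<tau>1 \<tau>" and rk: "reg \<tau> 30 = k" and J: "?J k (mem \<tau>) (outp \<tau>)"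
    have kK: "k < K" using k gl1 by (simp add: globals_def)
    have gl': "globals \<tau>" by (rule globals_agree[OF gl1 ag]) simp
    have rr: "reg \<tau> 20 = b" "reg \<tau> 22 = ?G" using agreeD[OF ag] r1 by simp_all
    have pi: "pre_inv (?dn k) (Suc b) (mem \<tau>)" using J by blast
    have nd: "\<not> ?dn k b k" by simp
    have gr: "mem \<tau> (?G + a) = snd (pre_call b) a" if "a \<le> V" for a using J that by blast
    have DD: "(\<lambda>b' k'. b' = b \<and> k' = k \<or> ?dn k b' k') = ?dn (Suc k)" by (auto simp: fun_eq_iff less_Suc_eq)
    show "runs B coin (matrix_input n M) (copy_preprocess A) \<tau>
      (\<lambda>u \<tau>'. u + ?\<Phi> k + 4 \<le> ?\<Phi> (Suc k) \<and> agree (30 + 2) \<tau> \<tau>' \<and> ?J (Suc k) (mem \<tau>') (outp \<tau>'))"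
      by (rule runs_mono[OF runs_copy_preprocess[where dn = "?dn k", OF gl' rr(1) rk rr(2) b kK pi nd gr, unfolded DD]])
        auto
  next
    show "?J 0 (mem \<tau>1) (outp \<tau>1)" using inv\<mu> graph m1 by simp
  qed (use gl1 size_facts in \<open>simp_all add: globals_def\<close>)
  show ?thesis
    unfolding block_preprocess_def runs_Seq
  proof (rule runs_mono[OF 123], elim conjE)
    fix u0 :: nat and \<tau>0 :: state
    assume 0: "u0 = 15" "agree 22 \<sigma> \<tau>0" "globals \<tau>0" "mem \<tau>0 = (mem \<sigma>)(?G := n')" "reg \<tau>0 20 = b" "reg \<tau>0 22 = ?G"
      "reg \<tau>0 23 = b div nb2 * h" "reg \<tau>0 24 = b mod nb2 * w" "reg \<tau>0 25 = n' * n'"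
    show "runs B coin (matrix_input n M) (For 30 25 (cell_code md)) \<tau>0 (\<lambda>ta \<sigma>'.
      runs B coin (matrix_input n M) (For 30 8 (copy_preprocess A)) \<sigma>' (\<lambda>u \<tau>.
        u0 + (ta + u) \<le> 8 * (\<Sum>k<K. tt k [pre_call b]) + pre_cost \<and> agree 22 \<sigma> \<tau> \<and>
        pre_inv (\<lambda>b' _. b' < Suc b) (Suc b) (mem \<tau>)))"
    proof (rule runs_mono[OF runs_cells[OF 0(3,6-9) b G]], elim conjE)
      fix u1 :: nat and \<tau>1 :: state
      assume 1: "u1 \<le> n' * n' * 60 + 4" "agree 30 \<tau>0 \<tau>1" "mem \<tau>1 = (\<lambda>x. if ?G + 2 \<le> x \<and> x < ?G + 2 + n' * n' \<and>
        ((x - (?G + 2)) div n', (x - (?G + 2)) mod n') \<in> ?E then 1 else mem \<tau>0 x)"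
      have m1: "mem \<tau>1 = \<mu>" unfolding 1(3) 0(4) \<mu>_def ..
      have gl1: "globals \<tau>1" by (rule globals_agree[OF 0(3) 1(2)]) simp
      have r1: "reg \<tau>1 20 = b" "reg \<tau>1 22 = ?G" using agreeD[OF 1(2)] 0 by simp_all
      have ag1: "agree 22 \<sigma> \<tau>1" using agree_trans[OF 0(2) 1(2)] by simp
      show "runs B coin (matrix_input n M) (For 30 8 (copy_preprocess A)) \<tau>1 (\<lambda>u \<tau>.
        u0 + (u1 + u) \<le> 8 * (\<Sum>k<K. tt k [pre_call b]) + pre_cost \<and> agree 22 \<sigma> \<tau> \<and>
        pre_inv (\<lambda>b' _. b' < Suc b) (Suc b) (mem \<tau>))"
      proof (rule runs_mono[OF loop[OF gl1 r1 m1]], unfold globalsD(9)[OF gl1], elim conjE)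
        fix u2 :: nat and \<tau>2 :: state
        assume 2: "u2 + ?\<Phi> 0 \<le> ?\<Phi> K + 4" "agree 30 \<tau>1 \<tau>2" "pre_inv (?dn K) (Suc b) (mem \<tau>2)"
        have "agree 22 \<sigma> \<tau>2" using agree_trans[OF ag1 2(2)] by simp
        moreover have "pre_inv (\<lambda>b' _. b' < Suc b) (Suc b) (mem \<tau>2)"
          by (rule pre_inv_cong[OF 2(3)]) auto
        moreover have "u0 + (u1 + u2) \<le> 8 * (\<Sum>k<K. tt k [pre_call b]) + pre_cost" using 0(1) 1(1) 2(1) by simp
        ultimately show "u0 + (u1 + u2) \<le> 8 * (\<Sum>k<K. tt k [pre_call b]) + pre_cost \<and> agree 22 \<sigma> \<tau>2 \<and>
          pre_inv (\<lambda>b' _. b' < Suc b) (Suc b) (mem \<tau>2)" by blast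
      qed
    qed
  qed
qed

text \<open>Before the first round all overlays are untouched. Every epoch therefore sees the base,
  whose history is the preprocessing call alone.\<close>

lemma progress_inv_init:
  assumes "pre_inv (\<lambda>b _. b < NB) NB \<mu>"
  shows "progress_inv (\<lambda>_ _. 0) \<mu>"
  unfolding progress_inv_def mem_inv_def
proof (intro conjI allI impI)
  fix e b k a assume *: "b < NB" "k < K" "a \<le> V"
  have h: "all_hist (\<lambda>_ _. 0) e b k = [pre_call b]" by (simp add: all_hist_def hist_def epoch_reqs_def)
  have i: "\<mu> (region 0 b k + a) - 1 = memory k (if b < NB then [pre_call b] else []) a \<and>
      memory k (if b < NB then [pre_call b] else []) a \<le> V"
    using assms * unfolding pre_inv_def by blast
  have "\<mu> (region (Suc e) b k + a) = 0" using assms * V unfolding pre_inv_def by simp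
  then show "overlay \<mu> (region (Suc e) b k) (region 0 b k) a = memory k (all_hist (\<lambda>_ _. 0) e b k) a"
    "memory k (all_hist (\<lambda>_ _. 0) e b k) a \<le> V"
    using i * unfolding h by (simp_all add: overlay_def)
next
  fix e b i assume "b < NB" "i < h * h"
  then show "\<mu> (region (Suc e) b K + i) = votes (\<lambda>_ _. 0) e b i"
    using assms size_facts(1) unfolding pre_inv_def by (simp add: votes_def)
next
  fix a assume "2 \<le> a" "a \<le> V"
  then show "\<mu> (W + a) = 0" using assms unfolding pre_inv_def by simp
qed

lemma runs_search_code:
  assumes r: "reg \<sigma> 0 = 0" "reg \<sigma> 1 = 1" "reg \<sigma> 2 = n" and m: "mem \<sigma> = (\<lambda>_. 0)(1 := n, 2 := g0)"
  shows "runs B coin inp (search_code Q) \<sigma> (\<lambda>u \<tau>. u \<le> n * (Q + 20) + 4 \<and> agree 20 \<sigma> \<tau> \<and> mem \<tau> = (\<lambda>_. 0)(1 := n, 2 := g))"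
proof -
  let ?J = "\<lambda>j \<mu> out::nat \<Rightarrow> nat. \<mu> = (\<lambda>_. 0)(1 := n, 2 := search g0 Q n j)"
  have "runs B coin inp (search_code Q) \<sigma>
     (\<lambda>u \<tau>. u + 0 * (Q + 20) \<le> reg \<sigma> 2 * (Q + 20) + 4 \<and> agree 20 \<sigma> \<tau> \<and> ?J (reg \<sigma> 2) (mem \<tau>) (outp \<tau>))"
    unfolding search_code_def
  proof (rule runs_For[where \<Phi> = "\<lambda>j. j * (Q + 20)"])
    fix j \<tau>
    assume j: "j < reg \<sigma> 2" and ag: "agree 20 \<sigma> \<tau>" and rj: "reg \<tau> 20 = j" and J: "?J j (mem \<tau>) (outp \<tau>)"
    let ?s = "search g0 Q n j"
    have "?s \<le> g" unfolding g_def by (rule search_mono) (use j r in simp)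
    then have "(?s + 1) ^ Q \<le> (g + 1) ^ Q" by (intro power_mono) simp_all
    then have p: "(?s + 1) ^ Q \<le> B" using bound(3) by linarith
    have rr: "reg \<tau> 0 = 0" "reg \<tau> (Suc 0) = Suc 0" "reg \<tau> 2 = n" using agreeD[OF ag] r by simp_all
    have "g + 1 \<le> (g + 1) ^ Q" using Q by (intro self_le_power) simp_all
    then have gB: "g + 1 \<le> B" using bound(3) by linarith
    have bnd: "Suc ?s \<le> B" "2 \<le> B" "Suc 0 \<le> B" using gB \<open>?s \<le> g\<close> size_facts(2,6) by linarith+
    let ?\<tau>1 = "set_reg 25 (Suc ?s) (set_reg 22 2 \<tau>)"
    have pw: "runs B coin inp (power_code 23 25 Q) ?\<tau>1 (\<lambda>t \<tau>. t = Q + 1 \<and> \<tau> = set_reg 23 (Suc ?s ^ Q) ?\<tau>1)"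
      using runs_power_code[of ?\<tau>1 25 Q B 23 coin inp] p by simp
    have a: "runs B coin inp (seqs [Const 22 2, Load 25 22, Arith Add 25 25 1, power_code 23 25 Q,
      Arith Less 24 2 23, If 24 Skip (Store 22 25)]) \<tau> Z" 
      if z: "runs B coin inp (power_code 23 25 Q) ?\<tau>1 (\<lambda>t \<tau>. runs B coin inp (seqs [Arith Less 24 2 23, If 24 Skip (Store 22 25)]) \<tau> (\<lambda>u. Z (3 + (t + u))))" for Z
      unfolding seqs.simps(2)[of "Const _ _"] seqs.simps(2)[of "Load _ _"] seqs.simps(2)[of "Arith Add _ _ _"]
        seqs.simps(2)[of "power_code _ _ _"] runs_Seq
      using z bnd J by (simp add: runs_Const runs_Load runs_Arith rr numeral_3_eq_3 del: seqs.simps)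
    have b: "runs B coin inp (seqs [Arith Less 24 2 23, If 24 Skip (Store 22 25)]) (set_reg 23 (Suc ?s ^ Q) ?\<tau>1)
      (\<lambda>u \<tau>'. u \<le> 4 \<and> agree 22 \<tau> \<tau>' \<and> ?J (Suc j) (mem \<tau>') (outp \<tau>'))"
      using J bnd by (auto simp: runs_simps rr agree_refl Let_def fun_eq_iff)
    show "runs B coin inp (seqs [Const 22 2, Load 25 22, Arith Add 25 25 1, power_code 23 25 Q,
      Arith Less 24 2 23, If 24 Skip (Store 22 25)]) \<tau>
      (\<lambda>u \<tau>'. u + j * (Q + 20) + 4 \<le> Suc j * (Q + 20) \<and> agree (20 + 2) \<tau> \<tau>' \<and> ?J (Suc j) (mem \<tau>') (outp \<tau>'))"
      by (rule a, rule runs_mono[OF pw], elim conjE, hypsubst, rule runs_mono[OF b]) auto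
  next
    show "?J 0 (mem \<sigma>) (outp \<sigma>)" using m by simp
  qed (use r size_facts in simp_all)
  then show ?thesis unfolding r(3) by (rule runs_mono) (simp add: g_def)
qed

lemma runs_preprocess_code:
  "runs B coin (matrix_input n M) (preprocess_code md A g0 P R Q ex K) (init_state (\<lambda>_. 0)) (\<lambda>u \<tau>.
    u \<le> 8 * (\<Sum>b<NB. \<Sum>k<K. tt k [pre_call b]) + NB * (pre_cost + 4) + n * (Q + 20) + (P + R + ex + 40) \<and>
    globals_mem 0 (mem \<tau>) \<and> progress_inv (\<lambda>_ _. 0) (mem \<tau>))"
proof -
  let ?inp = "matrix_input n M"
  let ?\<sigma>1 = "(set_reg 22 2 (set_reg 10 g0 (set_reg 1 1 (set_reg 2 n (init_state (\<lambda>_. 0))))))\<lparr>mem := (\<lambda>_. 0)(1 := n, 2 := g0)\<rparr>"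
  have bnd: "Suc 0 \<le> B" "2 \<le> B" "n \<le> B" "g0 \<le> B" using size_facts bound(4) by linarith+
  have 1: "runs B coin ?inp (seqs [Input 2 0, Const 1 1, Store 1 2, Const 10 g0, Const 22 2, Store 22 10]) (init_state (\<lambda>_. 0))
      (\<lambda>u \<tau>. u = 7 \<and> globals_mem 0 ((mem \<tau>)(2 := g)) \<and> reg \<tau> 0 = 0 \<and> reg \<tau> 1 = 1 \<and> reg \<tau> 2 = n \<and> mem \<tau> = (\<lambda>_. 0)(1 := n, 2 := g0))"
    using bnd by (simp add: runs_simps matrix_input_def globals_mem_def) (simp add: init_state_def)
  have 3: "runs B coin ?inp (seqs [Const 22 2, Load 10 22]) \<sigma>
    (\<lambda>u \<tau>. u = 3 \<and> reg \<tau> 0 = 0 \<and> reg \<tau> 1 = 1 \<and> reg \<tau> 2 = n \<and> reg \<tau> 10 = g \<and> mem \<tau> = mem \<sigma>)"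
    if "reg \<sigma> 0 = 0" "reg \<sigma> 1 = 1" "reg \<sigma> 2 = n" "mem \<sigma> = (\<lambda>_. 0)(1 := n, 2 := g)" for \<sigma>
    using bnd that by (simp add: runs_simps)
  let ?J = "\<lambda>b \<mu> out::nat \<Rightarrow> nat. pre_inv (\<lambda>b' _. b' < b) b \<mu>"
  let ?\<Phi> = "\<lambda>b. 8 * (\<Sum>b'<b. \<Sum>k<K. tt k [pre_call b']) + b * (pre_cost + 4)"
  have 5: "runs B coin ?inp (For 20 7 (block_preprocess md A)) \<sigma>
      (\<lambda>u \<tau>. u + ?\<Phi> 0 \<le> ?\<Phi> (reg \<sigma> 7) + 4 \<and> agree 20 \<sigma> \<tau> \<and> ?J (reg \<sigma> 7) (mem \<tau>) (outp \<tau>))"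
    if gl: "globals \<sigma>" and m: "mem \<sigma> = (\<lambda>_. 0)(1 := n, 2 := g)" for \<sigma>
  proof (rule runs_For)
    fix b \<tau>
    assume b: "b < reg \<sigma> 7" and ag: "agree 20 \<sigma> \<tau>" and rb: "reg \<tau> 20 = b" and J: "?J b (mem \<tau>) (outp \<tau>)"
    have bNB: "b < NB" using b gl by (simp add: globals_def)
    have gl': "globals \<tau>" by (rule globals_agree[OF gl ag]) simp
    show "runs B coin ?inp (block_preprocess md A) \<tau>
      (\<lambda>u \<tau>'. u + ?\<Phi> b + 4 \<le> ?\<Phi> (Suc b) \<and> agree (20 + 2) \<tau> \<tau>' \<and> ?J (Suc b) (mem \<tau>') (outp \<tau>'))"
      by (rule runs_mono[OF runs_block_preprocess[OF gl' rb bNB J]]) simp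
  next
    have z: "((\<lambda>_. 0)(1 := n, 2 := g)) a = 0" if "2 < a" for a :: nat using that by simp
    have zr: "((\<lambda>_. 0)(1 := n, 2 := g)) (region e b k + i) = 0" for e b k i
      by (rule z) (use region_ge[of e b k] size_facts(2) in linarith)
    have zw: "((\<lambda>_. 0)(1 := n, 2 := g)) (W + a) = 0" for a
      by (rule z) (use size_facts(2) in linarith)
    show "?J 0 (mem \<sigma>) (outp \<sigma>)"
      unfolding m pre_inv_def zr zw globals_mem_def by (simp add: memory_Nil)
  qed (use gl size_facts in \<open>simp_all add: globals_def\<close>)
  show ?thesis
    unfolding preprocess_code_def runs_Seq
  proof (rule runs_mono[OF 1], elim conjE)
    fix u1 :: nat and \<sigma>1 :: state
    assume s1: "u1 = 7" "reg \<sigma>1 0 = 0" "reg \<sigma>1 1 = 1" "reg \<sigma>1 2 = n" "mem \<sigma>1 = (\<lambda>_. 0)(1 := n, 2 := g0)"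
    let ?goal = "\<lambda>u \<tau>. u \<le> 8 * (\<Sum>b<NB. \<Sum>k<K. tt k [pre_call b]) + NB * (pre_cost + 4) + n * (Q + 20) + (P + R + ex + 40) \<and>
      globals_mem 0 (mem \<tau>) \<and> progress_inv (\<lambda>_ _. 0) (mem \<tau>)"
    show "runs B coin ?inp (search_code Q) \<sigma>1 (\<lambda>t2 \<sigma>. runs B coin ?inp (seqs [Const 22 2, Load 10 22]) \<sigma>
      (\<lambda>t3 \<sigma>. runs B coin ?inp (setup_code P R ex K) \<sigma> (\<lambda>t4 \<sigma>. runs B coin ?inp (For 20 7 (block_preprocess md A)) \<sigma>
        (\<lambda>t5. ?goal (u1 + (t2 + (t3 + (t4 + t5))))))))"
    proof (rule runs_mono[OF runs_search_code[OF s1(2-5)]], elim conjE)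
      fix u2 :: nat and \<sigma>2 :: state
      assume s2: "u2 \<le> n * (Q + 20) + 4" "agree 20 \<sigma>1 \<sigma>2" "mem \<sigma>2 = (\<lambda>_. 0)(1 := n, 2 := g)"
      have r2: "reg \<sigma>2 0 = 0" "reg \<sigma>2 1 = 1" "reg \<sigma>2 2 = n" using agreeD[OF s2(2)] s1 by simp_all
      show "runs B coin ?inp (seqs [Const 22 2, Load 10 22]) \<sigma>2
        (\<lambda>t3 \<sigma>. runs B coin ?inp (setup_code P R ex K) \<sigma> (\<lambda>t4 \<sigma>. runs B coin ?inp (For 20 7 (block_preprocess md A)) \<sigma>
          (\<lambda>t5. ?goal (u1 + (u2 + (t3 + (t4 + t5)))))))"
      proof (rule runs_mono[OF 3[OF r2 s2(3)]], elim conjE)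
        fix u3 :: nat and \<sigma>3 :: state
        assume s3: "u3 = 3" "reg \<sigma>3 0 = 0" "reg \<sigma>3 1 = 1" "reg \<sigma>3 2 = n" "reg \<sigma>3 10 = g" "mem \<sigma>3 = mem \<sigma>2"
        show "runs B coin ?inp (setup_code P R ex K) \<sigma>3 (\<lambda>t4 \<sigma>. runs B coin ?inp (For 20 7 (block_preprocess md A)) \<sigma>
          (\<lambda>t5. ?goal (u1 + (u2 + (u3 + (t4 + t5))))))"
        proof (rule runs_mono[OF runs_setup_code[OF s3(2-5)]], elim conjE)
          fix u4 :: nat and \<sigma>4 :: state
          assume s4: "u4 = P + R + ex + 15" "globals \<sigma>4" "mem \<sigma>4 = mem \<sigma>3"
          have m4: "mem \<sigma>4 = (\<lambda>_. 0)(1 := n, 2 := g)" using s4 s3 s2 by simp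
          show "runs B coin ?inp (For 20 7 (block_preprocess md A)) \<sigma>4 (\<lambda>t5. ?goal (u1 + (u2 + (u3 + (u4 + t5)))))"
          proof (rule runs_mono[OF 5[OF s4(2) m4]], unfold globalsD(8)[OF s4(2)], elim conjE)
            fix u5 :: nat and \<sigma>5 :: state
            assume s5: "u5 + ?\<Phi> 0 \<le> ?\<Phi> NB + 4" "pre_inv (\<lambda>b' _. b' < NB) NB (mem \<sigma>5)"
            have "globals_mem 0 (mem \<sigma>5)" using s5(2) unfolding pre_inv_def by blast
            then show "?goal (u1 + (u2 + (u3 + (u4 + u5)))) \<sigma>5"
              using s1(1) s2(1) s3(1) s4(1) s5(1) progress_inv_init[OF s5(2)] by simp
          qed
        qed
      qed
    qed
  qed
qed

section \<open>Total running time\<close>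

lemma sum_cost_epoch: "(\<Sum>r<d. cost e b r k) = tt k (hist e b d) - tt k (hist e b 0)"
proof -
  have "tt k (hist e b 0) + (\<Sum>r<d. cost e b r k) = tt k (hist e b d)"
  proof (induction d)
    case (Suc d)
    then show ?case using tt_hist_mono[of d "Suc d" k e b] by (simp add: cost_def)
  qed simp
  then show ?thesis by simp
qed

text \<open>The last epoch, possibly incomplete, is filled up to \<open>h\<close> rounds. The
  preprocessing call is part of every history, but the differences in \<open>cost\<close> cancel
  it.\<close>

lemma sum_cost_rounds:
  assumes T: "\<And>e. tt k (hist e b h) \<le> T + tt k (hist e b 0)"
  shows "(\<Sum>t<n. cost (t div h) b (t mod h) k) \<le> (n div h + 1) * T"
proof -
  have inj: "inj_on (\<lambda>t. (t div h, t mod h)) {..<n}"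
    by (rule inj_onI) (metis div_mult_mod_eq prod.inject)
  have "(\<Sum>t<n. cost (t div h) b (t mod h) k) = (\<Sum>(e, r)\<in>(\<lambda>t. (t div h, t mod h)) ` {..<n}. cost e b r k)"
    by (subst sum.reindex[OF inj]) simp
  also have "\<dots> \<le> (\<Sum>(e, r)\<in>{..<n div h + 1} \<times> {..<h}. cost e b r k)"
    using h_pos by (intro sum_mono2) (auto simp: less_Suc_eq_le intro!: div_le_mono)
  also have "\<dots> = (\<Sum>e<n div h + 1. \<Sum>r<h. cost e b r k)"
    by (rule sum.cartesian_product[symmetric])
  also have "\<dots> \<le> (\<Sum>e<n div h + 1. T)"
    unfolding sum_cost_epoch by (intro sum_mono) (use T in \<open>simp add: le_diff_conv\<close>)
  finally show ?thesis by simp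
qed

text \<open>The term with \<open>T0\<close> carries no factor for the epochs: this is what rewinding
  the preprocessed memory saves.\<close>

lemma serve_omv:
  assumes len: "length vs = n"
    and T0: "\<And>b k. tt k [pre_call b] \<le> T0"
    and T1: "\<And>e b k. tt k (hist e b h) \<le> T1 + tt k (hist e b 0)"
  shows "\<exists>rs. serve B coin (\<lambda>_. 0) (omv_calls (omv_of_dom md A g0 P R Q ex K) n M vs) rs \<and>
    sum_list (map fst rs) \<le> 8 * (NB * K * T0) + NB * (pre_cost + 4) + n * (Q + 20) + (P + R + ex + 40) +
      8 * (NB * K * ((n div h + 1) * T1)) + n * (NB * (loop_cost + 4) + (P + R + ex + 40)) \<and>
    (\<forall>t<n. snd (rs ! Suc t) = round_output t)"
proof -
  define pt where "pt = 8 * (\<Sum>b<NB. \<Sum>k<K. tt k [pre_call b]) + NB * (pre_cost + 4) + n * (Q + 20) + (P + R + ex + 40)"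
  define rt where "rt = (\<lambda>t. 8 * (\<Sum>b<NB. \<Sum>k<K. cost (t div h) b (t mod h) k) + (NB * (loop_cost + 4) + (P + R + ex + 40)))"
  have "runs B coin (matrix_input n M) (preprocess_code md A g0 P R Q ex K) (init_state (\<lambda>_. 0))
    (\<lambda>u \<tau>. u \<le> pt \<and> globals_mem 0 (mem \<tau>) \<and> progress_inv (\<lambda>_ _. 0) (mem \<tau>))"
    unfolding pt_def by (rule runs_preprocess_code)
  then obtain u \<tau> where p: "exec B coin (matrix_input n M) (preprocess_code md A g0 P R Q ex K) (init_state (\<lambda>_. 0)) u \<tau>"
    "u \<le> pt" "globals_mem 0 (mem \<tau>)" "progress_inv (\<lambda>_ _. 0) (mem \<tau>)"
    unfolding runs_def by blast
  let ?calls = "map (\<lambda>v. (round_code md A P R ex K, vector_input n v)) vs"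
  have "\<exists>rs. serve B coin (mem \<tau>) ?calls rs \<and> length rs = length ?calls \<and>
      sum_list (map fst rs) \<le> sum rt {..<length ?calls} \<and> (\<forall>t<length ?calls. snd (rs ! t) = round_output t)"
  proof (rule serve_invariant[where I = "\<lambda>t \<mu>. globals_mem t \<mu> \<and> progress_inv (\<lambda>_ _. t) \<mu>"])
    fix t \<mu> assume t: "t < length ?calls" "globals_mem t \<mu> \<and> progress_inv (\<lambda>_ _. t) \<mu>"
    then have tn: "t < n" using len by simp
    show "runs B coin (snd (?calls ! t)) (fst (?calls ! t)) (init_state \<mu>)
      (\<lambda>u \<tau>. u \<le> rt t \<and> (globals_mem (Suc t) (mem \<tau>) \<and> progress_inv (\<lambda>_ _. Suc t) (mem \<tau>)) \<and> outp \<tau> = round_output t)"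
      using runs_round_code[OF conjunct1[OF t(2)] conjunct2[OF t(2)] tn] t(1) tn len
      by (simp add: rt_def add.assoc conj_assoc)
  qed (use p in blast)
  then obtain rs where rs: "serve B coin (mem \<tau>) ?calls rs" "sum_list (map fst rs) \<le> sum rt {..<n}"
    "\<forall>t<n. snd (rs ! t) = round_output t" using len by auto
  have s: "serve B coin (\<lambda>_. 0) (omv_calls (omv_of_dom md A g0 P R Q ex K) n M vs) ((u, outp \<tau>) # rs)"
    unfolding omv_calls_def omv_of_dom_def using p(1) rs(1) unfolding init_state_def
    by (simp add: serve.Cons)
  have "(\<Sum>b<NB. \<Sum>k<K. tt k [pre_call b]) \<le> (\<Sum>b<NB. \<Sum>k<K. T0)" by (intro sum_mono T0)
  then have pt: "pt \<le> 8 * (NB * K * T0) + NB * (pre_cost + 4) + n * (Q + 20) + (P + R + ex + 40)"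
    unfolding pt_def by (simp add: mult.assoc)
  have "(\<Sum>t<n. \<Sum>b<NB. \<Sum>k<K. cost (t div h) b (t mod h) k) = (\<Sum>b<NB. \<Sum>t<n. \<Sum>k<K. cost (t div h) b (t mod h) k)"
    by (rule sum.swap)
  also have "\<dots> = (\<Sum>b<NB. \<Sum>k<K. \<Sum>t<n. cost (t div h) b (t mod h) k)"
    by (rule sum.cong[OF refl sum.swap])
  also have "\<dots> \<le> (\<Sum>b<NB. \<Sum>k<K. (n div h + 1) * T1)"
    by (intro sum_mono sum_cost_rounds T1)
  finally have c: "(\<Sum>t<n. \<Sum>b<NB. \<Sum>k<K. cost (t div h) b (t mod h) k) \<le> NB * K * ((n div h + 1) * T1)"
    by (simp add: mult.assoc)
  have "sum (\<lambda>t. 8 * f t + c) {..<n} = 8 * sum f {..<n} + n * c" for f :: "nat \<Rightarrow> nat" and c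
    by (simp add: sum.distrib sum_distrib_left)
  then have "sum rt {..<n} = 8 * (\<Sum>t<n. \<Sum>b<NB. \<Sum>k<K. cost (t div h) b (t mod h) k) + n * (NB * (loop_cost + 4) + (P + R + ex + 40))"
    unfolding rt_def .
  then have "sum_list (map fst ((u, outp \<tau>) # rs)) \<le> 8 * (NB * K * T0) + NB * (pre_cost + 4) + n * (Q + 20) + (P + R + ex + 40) +
      8 * (NB * K * ((n div h + 1) * T1)) + n * (NB * (loop_cost + 4) + (P + R + ex + 40))"
    using rs(2) p(2) pt c unfolding list.map fst_conv sum_list.Cons by linarith
  moreover have "\<forall>t<n. snd (((u, outp \<tau>) # rs) ! Suc t) = round_output t" using rs(3) by simp
  ultimately show ?thesis using s by blast
qed

end

section \<open>Majority votes\<close>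

definition slice :: "nat \<Rightarrow> nat \<Rightarrow> (nat \<Rightarrow> bool) \<Rightarrow> nat \<Rightarrow> nat \<Rightarrow> bool" where
  "slice V W coin k = (\<lambda>a. a \<le> V \<and> coin (k * W + a))"

text \<open>Intersecting with the supports provides the countable sets that
  \<open>measure_pmf_prob_product\<close> asks for.\<close>

lemma prob_pair_pmf_Times:
  "measure_pmf.prob (pair_pmf M N) (A \<times> B) = measure_pmf.prob M A * measure_pmf.prob N B"
proof -
  have "measure_pmf.prob (pair_pmf M N) (A \<times> B) = measure_pmf.prob (pair_pmf M N) ((A \<inter> set_pmf M) \<times> (B \<inter> set_pmf N))"
    by (subst measure_Int_set_pmf[symmetric]) (simp add: Times_Int_Times)
  also have "\<dots> = measure_pmf.prob M (A \<inter> set_pmf M) * measure_pmf.prob N (B \<inter> set_pmf N)"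
    by (intro measure_pmf_prob_product) (auto intro: countable_subset[OF _ countable_set_pmf])
  finally show ?thesis by (simp add: measure_Int_set_pmf)
qed

text \<open>A window of independent fair bits, shifted to zero, is distributed like
  \<open>coins V\<close>; the cut-off in \<open>slice\<close> reproduces the default value
  \<open>False\<close> of \<open>Pi_pmf\<close> outside the window.\<close>

lemma slice_coins:
  assumes "k * W + V \<le> B"
  shows "map_pmf (\<lambda>coin. slice V W coin k) (coins B) = coins V"
proof -
  let ?S = "{k * W..k * W + V}"
  have bij: "bij_betw (\<lambda>a. k * W + a) {..V} ?S"
    by (rule bij_betwI[where g = "\<lambda>x. x - k * W"]) auto
  have "coins V = map_pmf (\<lambda>g. g \<circ> (\<lambda>a. k * W + a)) (Pi_pmf ?S False (\<lambda>_. bernoulli_pmf (1/2)))"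
    unfolding coins_def by (rule Pi_pmf_bij_betw[OF _ bij]) auto
  also have "Pi_pmf ?S False (\<lambda>_. bernoulli_pmf (1/2)) = map_pmf (\<lambda>f x. if x \<in> ?S then f x else False) (coins B)"
    unfolding coins_def by (rule Pi_pmf_subset) (use assms in auto)
  also have "map_pmf (\<lambda>g. g \<circ> (\<lambda>a. k * W + a)) \<dots> = map_pmf (\<lambda>coin. slice V W coin k) (coins B)"
    unfolding map_pmf_comp by (rule map_pmf_cong) (auto simp: slice_def fun_eq_iff)
  finally show ?thesis ..
qed

text \<open>Independence of the slices, which are disjoint because \<open>V < W\<close>. In the
  induction the coins split into the window of the new slice and the rest, and the event becomes a
  product set.\<close>

lemma prob_slices_all:
  assumes "finite Z" "V < W" "\<And>k. k \<in> Z \<Longrightarrow> k * W + V \<le> B"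
  shows "measure_pmf.prob (coins B) {coin. \<forall>k\<in>Z. slice V W coin k \<in> X} = measure_pmf.prob (coins V) X ^ card Z"
  using assms
proof (induction Z rule: finite_induct)
  case empty
  then show ?case by simp
next
  case (insert z Z)
  let ?S = "{z * W..z * W + V}" and ?R = "{..B} - {z * W..z * W + V}"
  let ?p = "\<lambda>_. bernoulli_pmf (1/2)"
  have zB: "z * W + V \<le> B" using insert.prems by simp
  have un: "?S \<union> ?R = {..B}" using zB by auto
  have "coins B = Pi_pmf (?S \<union> ?R) False ?p"
    by (simp only: un coins_def)
  also have "\<dots> = map_pmf (\<lambda>(f, g) x. if x \<in> ?S then f x else g x) (pair_pmf (Pi_pmf ?S False ?p) (Pi_pmf ?R False ?p))"
    by (rule Pi_pmf_union) auto
  finally have c: "coins B = map_pmf (\<lambda>(f, g) x. if x \<in> ?S then f x else g x) (pair_pmf (Pi_pmf ?S False ?p) (Pi_pmf ?R False ?p))" .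
  have out: "k * W + a \<notin> ?S" if "k \<in> Z" "a \<le> V" for k a
  proof
    assume "k * W + a \<in> ?S"
    then obtain a' where a': "k * W + a = z * W + a'" "a' \<le> V" by (metis add_le_cancel_left atLeastAtMost_iff le_Suc_ex)
    have "k = (k * W + a) div W" using that assms(2) by simp
    also have "\<dots> = z" unfolding a'(1) using a'(2) assms(2) by simp
    finally show False using that insert.hyps by simp
  qed
  define mix where "mix = (\<lambda>(f :: nat \<Rightarrow> bool, g) x. if x \<in> ?S then f x else g x)"
  have sz: "slice V W (mix (f, g)) z = slice V W f z" for f g by (auto simp: slice_def fun_eq_iff mix_def)
  have sk: "slice V W (mix (f, g)) k = slice V W g k" if "k \<in> Z" for f g k
    using out[OF that] by (auto simp: slice_def fun_eq_iff mix_def)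
  have vim: "mix -` {coin. (\<forall>k\<in>Z. slice V W coin k \<in> X) \<and> slice V W coin z \<in> Y} =
      {f. slice V W f z \<in> Y} \<times> {g. \<forall>k\<in>Z. slice V W g k \<in> X}" for Y
    using sz sk by auto
  note c = c[folded mix_def]
  have split: "measure_pmf.prob (coins B) {coin. (\<forall>k\<in>Z. slice V W coin k \<in> X) \<and> slice V W coin z \<in> Y} =
     measure_pmf.prob (Pi_pmf ?S False ?p) {f. slice V W f z \<in> Y} * measure_pmf.prob (Pi_pmf ?R False ?p) {g. \<forall>k\<in>Z. slice V W g k \<in> X}" for Y
    unfolding c measure_map_pmf vim by (rule prob_pair_pmf_Times)
  have vz: "mix -` {coin. slice V W coin z \<in> X} = {f. slice V W f z \<in> X} \<times> UNIV"
    using sz by auto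
  have "measure_pmf.prob (Pi_pmf ?S False ?p) {f. slice V W f z \<in> X} = measure_pmf.prob (coins B) {coin. slice V W coin z \<in> X}"
    unfolding c measure_map_pmf vz prob_pair_pmf_Times by simp
  also have "\<dots> = measure_pmf.prob (map_pmf (\<lambda>coin. slice V W coin z) (coins B)) X"
    by (simp add: measure_map_pmf vimage_def)
  also have "\<dots> = measure_pmf.prob (coins V) X" by (simp only: slice_coins[OF zB])
  finally have 1: "measure_pmf.prob (Pi_pmf ?S False ?p) {f. slice V W f z \<in> X} = measure_pmf.prob (coins V) X" .
  \<comment> \<open>With \<open>Y = UNIV\<close> the factor of the new slice is 1, so the remaining
    coins can be replaced by all coins and the induction hypothesis applies.\<close>
  have "measure_pmf.prob (Pi_pmf ?R False ?p) {g. \<forall>k\<in>Z. slice V W g k \<in> X} =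
      measure_pmf.prob (coins B) {coin. \<forall>k\<in>Z. slice V W coin k \<in> X}"
    using split[of UNIV] by simp
  also have "\<dots> = measure_pmf.prob (coins V) X ^ card Z" using insert by simp
  finally have 2: "measure_pmf.prob (Pi_pmf ?R False ?p) {g. \<forall>k\<in>Z. slice V W g k \<in> X} = measure_pmf.prob (coins V) X ^ card Z" .
  have "{coin. \<forall>k\<in>insert z Z. slice V W coin k \<in> X} = {coin. (\<forall>k\<in>Z. slice V W coin k \<in> X) \<and> slice V W coin z \<in> X}" by auto
  then show ?case using split[of X] 1 2 insert.hyps by simp
qed

text \<open>If at least half of the slices are bad, some set of at least \<open>\<kappa>\<close>
  slices is bad as a whole. There are at most \<open>2 ^ K\<close> such sets, and by independence
  each has probability at most \<open>p ^ \<kappa>\<close>. Ties count as bad.\<close>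

lemma prob_bad_majority:
  fixes \<kappa> K :: nat
  assumes "V < W" "\<And>k. k < K \<Longrightarrow> k * W + V \<le> B" "K = 2 * \<kappa>" "measure_pmf.prob (coins V) X \<le> p" "p \<le> 1"
  shows "measure_pmf.prob (coins B) {coin. K \<le> 2 * card {k. k < K \<and> slice V W coin k \<in> X}} \<le> 2 ^ K * p ^ \<kappa>"
proof -
  let ?P = "measure_pmf.prob (coins B)"
  let ?E = "\<lambda>Z. {coin. \<forall>k\<in>Z. slice V W coin k \<in> X}"
  let ?ZZ = "{Z. Z \<subseteq> {..<K} \<and> \<kappa> \<le> card Z}"
  have fin: "finite ?ZZ" by (rule finite_subset[of _ "Pow {..<K}"]) auto
  have p0: "0 \<le> p" using assms(4) measure_nonneg[of "measure_pmf (coins V)" X] by linarith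
  have "?P {coin. K \<le> 2 * card {k. k < K \<and> slice V W coin k \<in> X}} \<le> ?P (\<Union>Z\<in>?ZZ. ?E Z)"
  proof (rule measure_pmf.finite_measure_mono)
    show "{coin. K \<le> 2 * card {k. k < K \<and> slice V W coin k \<in> X}} \<subseteq> (\<Union>Z\<in>?ZZ. ?E Z)"
    proof
      fix coin assume "coin \<in> {coin. K \<le> 2 * card {k. k < K \<and> slice V W coin k \<in> X}}"
      then have "{k. k < K \<and> slice V W coin k \<in> X} \<in> ?ZZ" using assms(3) by auto
      then show "coin \<in> (\<Union>Z\<in>?ZZ. ?E Z)" by blast
    qed
  qed simp
  also have "\<dots> \<le> (\<Sum>Z\<in>?ZZ. ?P (?E Z))"
    by (rule measure_pmf.finite_measure_subadditive_finite[OF fin]) simp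
  also have "\<dots> \<le> (\<Sum>Z\<in>?ZZ. p ^ \<kappa>)"
  proof (rule sum_mono)
    fix Z assume Z: "Z \<in> ?ZZ"
    then have "?P (?E Z) = measure_pmf.prob (coins V) X ^ card Z"
      using assms(1,2) by (intro prob_slices_all) (auto intro: finite_subset)
    also have "\<dots> \<le> p ^ card Z" by (rule power_mono[OF assms(4)]) simp
    also have "\<dots> \<le> p ^ \<kappa>" using Z p0 assms(5) by (intro power_decreasing) auto
    finally show "?P (?E Z) \<le> p ^ \<kappa>" .
  qed
  also have "\<dots> = real (card ?ZZ) * p ^ \<kappa>" by simp
  also have "\<dots> \<le> 2 ^ K * p ^ \<kappa>"
  proof (rule mult_right_mono)
    have "card ?ZZ \<le> card (Pow {..<K})" by (rule card_mono) auto
    then have "card ?ZZ \<le> 2 ^ K" by (simp add: card_Pow)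
    then show "real (card ?ZZ) \<le> 2 ^ K" by (metis of_nat_le_iff of_nat_numeral of_nat_power)
  qed (use p0 in simp)
  finally show ?thesis .
qed

section \<open>Correct replies and the output of a round\<close>

definition query_prefix :: "mode \<Rightarrow> nat \<Rightarrow> nat \<Rightarrow> (nat \<Rightarrow> nat \<Rightarrow> bool) \<Rightarrow> nat \<Rightarrow> nat \<Rightarrow> request list" where
  "query_prefix md h w v r i = epoch_reqs md h w v r @ update_reqs h (port md h r) (v r) (flag1 md) w @
     query_reqs h w (port md h r) i"

definition query_reply :: "mode \<Rightarrow> dom_alg \<Rightarrow> nat \<Rightarrow> nat \<Rightarrow> nat \<Rightarrow> (nat \<Rightarrow> nat \<Rightarrow> bool) \<Rightarrow> (nat \<Rightarrow> nat \<Rightarrow> bool) \<Rightarrow> nat \<Rightarrow> nat \<Rightarrow>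
    (nat \<Rightarrow> bool) \<Rightarrow> nat" where
  "query_reply md A V h w Mb v r i coin =
     (let reqs = query_prefix md h w v r i in
      snd (results V coin (\<lambda>_. 0) (dom_calls A (h + 1 + w + h) 0 (init_arcs md h w Mb)
        (reqs @ [Query (port md h r) (h + 1 + w + i)])) ! Suc (length reqs)) 0)"

context omv_run
begin

lemma coins_of_slice: "coins_of k = slice V W coin k"
  by (simp add: coins_of_def slice_def)

text \<open>Links the vote recorded by the program with a run of the algorithm on its own, about
  which the correctness hypothesis speaks.\<close>

lemma reply_iff:
  assumes "i < h"
  shows "reply e b k (r * h + i) \<longleftrightarrow> query_reply md A V h w (block_matrix b) (vec e b) r i (coins_of k) = 1"
proof -
  have dm: "(r * h + i) div h = r" "(r * h + i) mod h = i" using assms by (simp_all add: mult_add_div_nat)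
  let ?H = "pre_call b # map rc (query_prefix md h w (vec e b) r i)" and ?c = "rc (Query (port md h r) (h + 1 + w + i))"
  have calls: "dom_calls A (h + 1 + w + h) 0 (init_arcs md h w (block_matrix b))
      (query_prefix md h w (vec e b) r i @ [Query (port md h r) (h + 1 + w + i)]) = ?H @ [?c]"
    by (simp add: dom_calls_def pre_call_def n'_def)
  have len: "length (results V (coins_of k) (\<lambda>_. 0) ?H) = Suc (length (query_prefix md h w (vec e b) r i))"
    by (simp add: length_results)
  have "results V (coins_of k) (\<lambda>_. 0) (?H @ [?c]) ! Suc (length (query_prefix md h w (vec e b) r i)) =
      (call_time V (coins_of k) (memory k ?H) ?c, call_out V (coins_of k) (memory k ?H) ?c)"
    unfolding results_append len[symmetric] results.simps(1) results.simps(2)[of _ _ _ _ "[]"] memory_def by (rule nth_append_length)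
  moreover have "hist e b r @ map rc (update_reqs h (port md h r) (vec e b r) (flag1 md) w) @
      map rc (query_reqs h w (port md h r) i) = ?H"
    by (simp add: hist_def query_prefix_def)
  ultimately show ?thesis
    unfolding reply_def dm answer_def query_reply_def Let_def calls append_assoc by simp
qed

text \<open>Any output other than 1 is a negative vote. If \<open>T\<close> is false, all positive
  votes are wrong; if \<open>T\<close> is true, all others are. In both cases a minority of wrong
  replies cannot change the strict majority.\<close>

lemma tally_majority:
  assumes "i < h"
    and good: "2 * card {k. k < K \<and> query_reply md A V h w (block_matrix b) (vec e b) r i (slice V W coin k) \<noteq> of_bool T} < K"
  shows "K < 2 * tally e b (r * h + i) \<longleftrightarrow> T"
proof -
  let ?bad = "{k. k < K \<and> query_reply md A V h w (block_matrix b) (vec e b) r i (slice V W coin k) \<noteq> of_bool T}"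
  let ?yes = "{k. k < K \<and> reply e b k (r * h + i)}"
  have t: "tally e b (r * h + i) = card ?yes"
    unfolding tally_def by (simp add: sum.If_cases of_bool_def Int_def)
  show ?thesis
  proof (cases T)
    case True
    have "{..<K} \<subseteq> ?bad \<union> ?yes" using True reply_iff[OF assms(1)] by (auto simp: coins_of_slice)
    then have "card {..<K} \<le> card (?bad \<union> ?yes)" by (intro card_mono) auto
    also have "\<dots> \<le> card ?bad + card ?yes" by (rule card_Un_le)
    finally show ?thesis using good True t by simp
  next
    case False
    have "?yes \<subseteq> ?bad" using False reply_iff[OF assms(1)] by (auto simp: coins_of_slice)
    then have "card ?yes \<le> card ?bad" by (intro card_mono) auto
    then show ?thesis using good False t by simp
  qed
qed

lemma round_output_correct:
  assumes t: "t < n" and x: "x < n"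
    and good: "\<And>b i. b < NB \<Longrightarrow> i < h \<Longrightarrow>
      2 * card {k. k < K \<and> query_reply md A V h w (block_matrix b) (vec (t div h) b) (t mod h) i (slice V W coin k) \<noteq>
        of_bool (\<exists>j<w. block_matrix b i j \<and> vec (t div h) b (t mod h) j)} < K"
  shows "round_output t x = of_bool (bool_mat_vec n M (vs ! t) x)"
proof -
  let ?e = "t div h" and ?r = "t mod h"
  have tt: "?e * h + ?r = t" by simp
  have "(\<exists>b<NB. \<exists>i<h. x = b div nb2 * h + i \<and> K < 2 * tally ?e b (?r * h + i)) \<longleftrightarrow>
    (\<exists>b<NB. \<exists>i<h. x = b div nb2 * h + i \<and> (\<exists>j<w. block_matrix b i j \<and> vec ?e b ?r j))"
    using tally_majority[OF _ good] by blast
  also have "\<dots> \<longleftrightarrow> bool_mat_vec n M (vs ! t) x"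
  proof
    assume "\<exists>b<NB. \<exists>i<h. x = b div nb2 * h + i \<and> (\<exists>j<w. block_matrix b i j \<and> vec ?e b ?r j)"
    then obtain b i j where bij: "x = b div nb2 * h + i" "block_matrix b i j" "vec ?e b ?r j" by blast
    define y where "y = b mod nb2 * w + j"
    \<comment> \<open>Only \<open>y < n\<close> lets the address decode to row \<open>x\<close> and
      column \<open>y\<close>; it follows from the zero padding of the vector.\<close>
    have y: "y < n" "(vs ! t) y"
      using bij(3) unfolding vec_def tt vector_input_def y_def[symmetric] by (auto simp: of_bool_def split: if_splits)
    have "matrix_input n M (x * n + y + 1) = 1" using bij(1,2) by (simp add: block_matrix_def y_def)
    moreover have "(x * n + y) div n = x" "(x * n + y) mod n = y" using y(1) by (simp_all add: mult_add_div_nat)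
    ultimately have "M x y" by (auto simp: matrix_input_def of_bool_def split: if_splits)
    then show "bool_mat_vec n M (vs ! t) x" using y by (auto simp: bool_mat_vec_def)
  next
    assume "bool_mat_vec n M (vs ! t) x"
    then obtain y where y: "y < n" "M x y" "(vs ! t) y" by (auto simp: bool_mat_vec_def)
    define b where "b = x div h * nb2 + y div w"
    have q: "y div w < nb2" using y(1) unfolding nb2_def by (simp add: div_le_mono less_Suc_eq_le)
    have "x div h \<le> n div h" using x by (simp add: div_le_mono)
    then have "(x div h + 1) * nb2 \<le> NB" unfolding NB_def by (intro mult_le_mono1) simp
    then have bN: "b < NB" using q by (simp add: b_def)
    have bd: "b div nb2 = x div h" "b mod nb2 = y div w" using q by (simp_all add: b_def)
    have wj: "y div w * w + y mod w = y" and hi: "x div h * h + x mod h = x" by simp_all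
    have "x * n + y < Suc x * n" using y(1) by simp
    also have "\<dots> \<le> n * n" using x by (intro mult_le_mono1) simp
    finally have "Suc (x * n + y) \<le> n * n" by simp
    moreover have "(x * n + y) div n = x" "(x * n + y) mod n = y" using y(1) by (simp_all add: mult_add_div_nat)
    ultimately have "matrix_input n M (x * n + y + 1) = 1" using y(2) by (simp add: matrix_input_def)
    then have "block_matrix b (x mod h) (y mod w)" unfolding block_matrix_def bd wj hi .
    moreover have "vec ?e b ?r (y mod w)" unfolding vec_def bd wj tt using y by (simp add: vector_input_def)
    moreover have "x mod h < h" "y mod w < w" using h_pos w_pos by simp_all
    moreover have "x = b div nb2 * h + x mod h" unfolding bd by simp
    ultimately show "\<exists>b<NB. \<exists>i<h. x = b div nb2 * h + i \<and> (\<exists>j<w. block_matrix b i j \<and> vec ?e b ?r j)"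
      using bN by blast
  qed
  finally show ?thesis unfolding round_output_def by simp
qed

end

section \<open>Choice of the parameters\<close>

lemma total_time_split:
  assumes len: "length rs = Suc (length reqs)" and q: "max_query_time_le reqs rs T"
  shows "real (sum_list (map fst rs)) \<le> real (preprocessing_time rs) + real (total_update_time reqs rs) +
    real (length (filter is_query reqs)) * T"
proof -
  let ?N = "length reqs"
  let ?t = "\<lambda>i. fst (rs ! Suc i)"
  have "sum_list (map fst rs) = (\<Sum>i<Suc ?N. fst (rs ! i))"
    by (simp add: sum_list_sum_nth len atLeast0LessThan del: sum.lessThan_Suc)
  also have "\<dots> = fst (rs ! 0) + (\<Sum>i<?N. ?t i)" by (rule sum.lessThan_Suc_shift)
  finally have 1: "sum_list (map fst rs) = preprocessing_time rs + (\<Sum>i<?N. ?t i)"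
    by (simp add: preprocessing_time_def)
  have U: "{..<?N} = {i. i < ?N \<and> is_update (reqs ! i)} \<union> {i. i < ?N \<and> is_query (reqs ! i)}"
    using request.exhaust_disc by auto
  define S where "S = (\<Sum>i | i < ?N \<and> is_query (reqs ! i). ?t i)"
  have 2: "(\<Sum>i<?N. ?t i) = total_update_time reqs rs + S"
    unfolding total_update_time_def S_def by (subst U, subst sum.union_disjoint) (auto dest: request.distinct_disc)
  have "real S \<le> (\<Sum>i | i < ?N \<and> is_query (reqs ! i). T)"
    unfolding S_def of_nat_sum using q by (intro sum_mono) (auto simp: max_query_time_le_def)
  also have "\<dots> = real (length (filter is_query reqs)) * T"
    by (simp only: length_filter_conv_card sum_constant)
  finally show ?thesis using 1 2 by simp
qed

lemma powr_power_nat: "0 < g \<Longrightarrow> real (g ^ P) powr a = real g powr (real P * a)"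
  by (simp add: powr_realpow[symmetric] powr_powr)

text \<open>What the reduction uses about the assumed algorithm, in natural numbers and powers of
  \<open>g\<close>; the real exponents and the asymptotic constants of the hypotheses are absorbed.
  The key is \<open>time\<close>: after preprocessing, an epoch costs at most
  \<open>C * (h * h * w) / g\<close>.\<close>

locale hard_instances =
  fixes md :: mode and A :: dom_alg and m :: "nat \<Rightarrow> nat" and c P R g0 k C :: nat
  assumes R: "1 \<le> R" "R \<le> P" and g0: "16 \<le> g0"
    and edges: "\<And>g h w. g0 \<le> g \<Longrightarrow> h = g ^ P \<Longrightarrow> w = g ^ R \<Longrightarrow> 2 * h + 2 * (h * w) \<le> m (h + 1 + w + h)"
    and halt: "\<And>g h w n' Mb v coin. g0 \<le> g \<Longrightarrow> h = g ^ P \<Longrightarrow> w = g ^ R \<Longrightarrow> n' = h + 1 + w + h \<Longrightarrow>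
      all_halt (word_bound c n') coin (\<lambda>_. 0) (dom_calls A n' 0 (init_arcs md h w Mb) (epoch_reqs md h w v h))"
    and preprocess: "\<And>g h w n' Mb coin. g0 \<le> g \<Longrightarrow> h = g ^ P \<Longrightarrow> w = g ^ R \<Longrightarrow> n' = h + 1 + w + h \<Longrightarrow>
      total_time (word_bound c n') coin (dom_calls A n' 0 (init_arcs md h w Mb) []) \<le> C * g ^ k"
    and time: "\<And>g h w n' Mb v coin. g0 \<le> g \<Longrightarrow> h = g ^ P \<Longrightarrow> w = g ^ R \<Longrightarrow> n' = h + 1 + w + h \<Longrightarrow>
      (total_time (word_bound c n') coin (dom_calls A n' 0 (init_arcs md h w Mb) (epoch_reqs md h w v h)) -
       total_time (word_bound c n') coin (dom_calls A n' 0 (init_arcs md h w Mb) [])) * g \<le> C * (h * h * w)"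
    and correct: "\<And>g h w n' Mb v r i. g0 \<le> g \<Longrightarrow> h = g ^ P \<Longrightarrow> w = g ^ R \<Longrightarrow> n' = h + 1 + w + h \<Longrightarrow> r < h \<Longrightarrow> i < h \<Longrightarrow>
      measure_pmf.prob (coins (word_bound c n'))
        {coin. query_reply md A (word_bound c n') h w Mb v r i coin \<noteq> of_bool (\<exists>j<w. Mb i j \<and> v r j)} \<le> 1 / real n'"

lemma hard_instances_exist:
  assumes \<delta>: "0 < \<delta>" "\<delta> \<le> 1 / 2" and m: "(\<lambda>n. real (m n)) \<in> \<Theta>(\<lambda>n. real n powr (1 / (1 - \<delta>)))"
    and \<epsilon>: "0 < \<epsilon>" and A: "maintains_dominator_tree md m \<delta> \<epsilon> A"
  shows "\<exists>c P R g0 k C. hard_instances md A m c P R g0 k C"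
proof -
  define \<beta> where "\<beta> = 1 / (1 - \<delta>)"
  \<comment> \<open>Shrinking \<epsilon> only weakens the bounds, as their bases are at least 1.
    Staying below \<delta> and 1 keeps the exponents \<open>\<delta> - \<epsilon>'\<close> and
    \<open>1 - \<epsilon>'\<close> positive, so that upper bounds on \<open>m\<close> can be
    inserted.\<close>
  define \<epsilon>' where "\<epsilon>' = min \<epsilon> (\<delta> / 2)"
  have \<epsilon>': "0 < \<epsilon>'" "\<epsilon>' \<le> \<epsilon>" "\<epsilon>' < \<delta>" "\<epsilon>' < 1" using \<delta> \<epsilon> by (auto simp: \<epsilon>'_def)
  have d: "0 < 1 - \<delta>" using \<delta> by simp
  then have "\<beta> * (1 - \<delta>) = 1" by (simp add: \<beta>_def)
  then have "\<beta> * \<delta> = \<beta> - 1" by (simp add: right_diff_distrib)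
  moreover have "1 < \<beta>" unfolding \<beta>_def less_divide_eq_1 using \<delta> d by linarith
  moreover have "\<beta> \<le> 2" unfolding \<beta>_def pos_divide_le_eq[OF d] using \<delta> by simp
  ultimately have \<beta>: "1 < \<beta>" "\<beta> \<le> 2" "\<beta> * \<delta> = \<beta> - 1" by blast+
  from A obtain c k N :: nat and C :: real where A0: "\<forall>n s E reqs. instance_of md n (m n) s E reqs \<longrightarrow>
        (\<forall>coin. \<exists>rs. serve (word_bound c n) coin (\<lambda>_. 0) (dom_calls A n s E reqs) rs \<and>
           (n \<ge> N \<longrightarrow>
              real (preprocessing_time rs) \<le> C * real n ^ k \<and>
              real (total_update_time reqs rs) \<le> C * (real (m n) * real n) powr (1 - \<epsilon>) \<and>
              max_query_time_le reqs rs (C * real (m n) powr (\<delta> - \<epsilon>)))) \<and>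
        (\<forall>i<length reqs. \<forall>x y. reqs ! i = Query x y \<longrightarrow>
           measure_pmf.prob (coins (word_bound c n))
             {coin. \<exists>rs. serve (word_bound c n) coin (\<lambda>_. 0) (dom_calls A n s E reqs) rs \<and>
                snd (rs ! Suc i) 0 =
                  of_bool (dom_tree_parent (nat_graph n (edges_after md E (take i reqs))) s x y)}
             \<ge> 1 - 1 / real n)"
    unfolding maintains_dominator_tree_def by (elim exE) (rule that)
  note A = A0[THEN spec, THEN spec, THEN spec, THEN spec, THEN mp]
  from m obtain cU where cU: "0 < cU" "eventually (\<lambda>n. norm (real (m n)) \<le> cU * norm (real n powr \<beta>)) at_top"
    unfolding \<beta>_def by (auto elim!: landau_o.bigE dest!: bigthetaD1)
  from m obtain cL where cL: "0 < cL" "eventually (\<lambda>n. norm (real (m n)) \<ge> cL * norm (real n powr \<beta>)) at_top"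
    unfolding \<beta>_def by (auto elim!: landau_omega.bigE dest!: bigthetaD2)
  have "eventually (\<lambda>n. real (m n) \<le> cU * real n powr \<beta> \<and> cL * real n powr \<beta> \<le> real (m n)) at_top"
    using eventually_conj[OF cU(2) cL(2)] by simp
  then obtain N1 where N1: "\<And>n. N1 \<le> n \<Longrightarrow> real (m n) \<le> cU * real n powr \<beta>"
      "\<And>n. N1 \<le> n \<Longrightarrow> cL * real n powr \<beta> \<le> real (m n)"
    unfolding eventually_at_top_linorder by blast
  \<comment> \<open>The first term gives \<open>P * \<epsilon>' \<ge> 2\<close>: one factor
    \<open>g\<close> makes up for rounding \<open>R\<close> down, the other remains as gain. The
    second term makes \<open>R\<close> at least 2.\<close>
  obtain P :: nat where P: "max (2 / \<epsilon>') (3 / (\<beta> - 1)) \<le> real P" using real_arch_simple by blast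
  have P\<epsilon>: "2 \<le> real P * \<epsilon>'" using P \<epsilon>' by (simp add: field_simps)
  have P\<beta>: "3 \<le> real P * (\<beta> - 1)" using P \<beta> by (simp add: field_simps)
  \<comment> \<open>The ceiling minus one lies strictly below its argument even at integers. The
    positive difference \<open>\<theta>\<close> lets \<open>g powr \<theta>\<close> outgrow
    \<open>4 / cL\<close>, so that up to \<open>4 * (h * w)\<close> arcs fit into
    \<open>m n'\<close>.\<close>
  define R where "R = nat (\<lceil>real P * (\<beta> - 1)\<rceil> - 1)"
  have "3 \<le> \<lceil>real P * (\<beta> - 1)\<rceil>" using P\<beta> by linarith
  then have Rr: "real R = real_of_int \<lceil>real P * (\<beta> - 1)\<rceil> - 1" by (simp add: R_def)
  have R: "real R < real P * (\<beta> - 1)" "real P * (\<beta> - 1) \<le> real R + 1" "2 \<le> real R"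
    unfolding Rr using P\<beta> by linarith+
  \<comment> \<open>Here \<open>\<delta> \<le> 1 / 2\<close> enters through
    \<open>\<beta> \<le> 2\<close>. It gives \<open>w \<le> h\<close> and thus
    \<open>n' \<le> 4 * h\<close>.\<close>
  have "real P * (\<beta> - 1) \<le> real P * 1" using \<beta> by (intro mult_left_mono) auto
  then have RP: "R \<le> P" using R(1) by simp
  define \<theta> where "\<theta> = real P * (\<beta> - 1) - real R"
  have \<theta>: "0 < \<theta>" using R(1) by (simp add: \<theta>_def)
  have "filterlim (\<lambda>g. real g powr \<theta>) at_top sequentially"
    using \<theta> by real_asymp
  then have "eventually (\<lambda>g. real g powr \<theta> \<ge> 4 / cL) sequentially" by (simp add: filterlim_at_top)
  then obtain N2 where N2: "\<And>g. N2 \<le> g \<Longrightarrow> 4 / cL \<le> real g powr \<theta>"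
    unfolding eventually_at_top_linorder by blast
  \<comment> \<open>As \<open>g \<le> n'\<close>, the summands \<open>N\<close> and
    \<open>N1\<close> put \<open>n'\<close> into the range of the assumed bounds, and
    \<open>N2\<close> does the same for \<open>g powr \<theta>\<close>. The 16 leaves room for
    constant factors when gadget sizes are compared with powers of \<open>g\<close>.\<close>
  define g0 where "g0 = N + N1 + N2 + 16"
  define C1 where "C1 = \<bar>C\<bar> * (cU * 4 powr (1 + \<beta>)) powr (1 - \<epsilon>')"
  define C2 where "C2 = \<bar>C\<bar> * (cU * 4 powr \<beta>) powr (\<delta> - \<epsilon>')"
  define Cn where "Cn = nat \<lceil>C1 + C2\<rceil> + nat \<lceil>\<bar>C\<bar> * 4 ^ k\<rceil>"
  have Cn: "C1 + C2 \<le> real Cn" "\<bar>C\<bar> * 4 ^ k \<le> real Cn"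
    unfolding Cn_def by linarith+
  have base: "g ^ P \<le> n' \<and> n' \<le> 4 * g ^ P \<and> N \<le> n' \<and> N1 \<le> n' \<and> 1 \<le> g \<and> 1 \<le> h \<and> 2 * h + 2 * (h * w) \<le> m n' \<and> 1 \<le> m n'"
    if g: "g0 \<le> g" "h = g ^ P" "w = g ^ R" "n' = h + 1 + w + h" for g h w n'
  proof -
    have g1: "1 \<le> g" "N2 \<le> g" using g(1) by (simp_all add: g0_def)
    have P1: "1 \<le> P" using RP R(3) by linarith
    have hw: "1 \<le> h" "1 \<le> w" "w \<le> h" using g1 g RP by (simp_all add: power_increasing)
    have "g \<le> h" unfolding g(2) using g1 P1 by (intro self_le_power) auto
    then have nn: "h \<le> n'" "n' \<le> 4 * h" "g \<le> n'" using hw unfolding g(4) by linarith+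
    have b: "g ^ P \<le> n'" "n' \<le> 4 * g ^ P" "N \<le> n'" "N1 \<le> n'"
      using nn g(1) unfolding g(2)[symmetric] g0_def by linarith+
    have gp: "0 < real g" using g1 by simp
    have e: "real P * \<beta> = real P + real R + \<theta>" by (simp add: \<theta>_def algebra_simps)
    have "h * 1 \<le> h * w" using hw by (intro mult_le_mono2)
    then have "2 * h + 2 * (h * w) \<le> 4 * (h * w)" by simp
    then have "real (2 * h + 2 * (h * w)) \<le> real (4 * (h * w))" by (simp only: of_nat_le_iff)
    also have "real (4 * (h * w)) = 4 * (real h * real w)" by simp
    also have "real h * real w = real g powr (real P + real R)"
      unfolding g(2,3) using gp by (simp add: powr_realpow powr_add)
    also have "4 * real g powr (real P + real R) \<le> (cL * real g powr \<theta>) * real g powr (real P + real R)"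
      using N2[OF g1(2)] cL(1) by (intro mult_right_mono) (simp_all add: field_simps)
    also have "\<dots> = cL * real g powr (real P * \<beta>)"
      unfolding e by (simp add: powr_add)
    also have "\<dots> = cL * real (g ^ P) powr \<beta>" using g1 by (simp only: powr_power_nat[of g P \<beta>])
    also have "\<dots> \<le> cL * real n' powr \<beta>"
      using b(1) cL(1) \<beta> by (intro mult_left_mono powr_mono2) (simp_all del: of_nat_power)
    also have "\<dots> \<le> real (m n')" by (rule N1(2)[OF b(4)])
    finally have "2 * h + 2 * (h * w) \<le> m n'" unfolding of_nat_le_iff .
    then show ?thesis using b g1 hw by simp
  qed
  have upd: "C * (real (m n') * real n') powr (1 - \<epsilon>) \<le> C1 * real g powr (real (2 * P + R) - 1)"
    and qry: "real (h * h) * (C * real (m n') powr (\<delta> - \<epsilon>)) \<le> C2 * real g powr (real (2 * P + R) - 1)"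
    and pre: "C * real n' ^ k \<le> real Cn * real g ^ (P * k)"
    if g: "g0 \<le> g" "h = g ^ P" "w = g ^ R" "n' = h + 1 + w + h" for g h w n'
  proof -
    note b = base[OF g]
    have g1: "1 \<le> real g" "0 < g" using b by simp_all
    have n1: "1 \<le> real n'" "1 \<le> real (m n')" using b by (simp_all add: g)
    have n4: "real n' \<le> 4 * real (g ^ P)" using b by (metis of_nat_le_iff of_nat_mult of_nat_numeral)
    have n4p: "real n' powr a \<le> 4 powr a * real g powr (real P * a)" if "0 \<le> a" for a
    proof -
      have "real n' powr a \<le> (4 * real (g ^ P)) powr a" using n4 that by (intro powr_mono2) auto
      also have "\<dots> = 4 powr a * real g powr (real P * a)"
        using g1 by (simp add: powr_mult powr_power_nat del: of_nat_power)
      finally show ?thesis .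
    qed
    have mU: "real (m n') \<le> cU * real n' powr \<beta>" using N1(1) b by simp
    have "(real (m n') * real n') powr (1 - \<epsilon>) \<le> (real (m n') * real n') powr (1 - \<epsilon>')"
      using n1 \<epsilon>' mult_mono[OF n1(2) n1(1)] by (intro powr_mono) auto
    also have "\<dots> \<le> (cU * real n' powr (1 + \<beta>)) powr (1 - \<epsilon>')"
    proof (rule powr_mono2)
      have "real (m n') * real n' \<le> (cU * real n' powr \<beta>) * real n'" using mU by (intro mult_right_mono) auto
      then show "real (m n') * real n' \<le> cU * real n' powr (1 + \<beta>)" using n1 by (simp add: powr_add mult.commute mult.left_commute)
    qed (use \<epsilon>' in auto)
    also have "\<dots> \<le> (cU * (4 powr (1 + \<beta>) * real g powr (real P * (1 + \<beta>)))) powr (1 - \<epsilon>')"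
      using n4p[of "1 + \<beta>"] \<beta> cU(1) \<epsilon>' by (intro powr_mono2 mult_left_mono mult_nonneg_nonneg) auto
    also have "\<dots> = (cU * 4 powr (1 + \<beta>)) powr (1 - \<epsilon>') * real g powr (real P * (1 + \<beta>) * (1 - \<epsilon>'))"
      using cU(1) g1 by (simp add: mult.assoc[symmetric] powr_mult powr_powr)
    finally have 1: "\<bar>C\<bar> * (real (m n') * real n') powr (1 - \<epsilon>) \<le> C1 * real g powr (real P * (1 + \<beta>) * (1 - \<epsilon>'))"
      unfolding C1_def mult.assoc by (rule mult_left_mono) simp
    \<comment> \<open>Since \<open>P * (1 + \<beta>) \<le> 2 * P + R + 1\<close>, saving 2 in the
      exponent leaves \<open>2 * P + R - 1\<close>, which stands for
      \<open>h\<^sup>2 * w / g\<close>.\<close>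
    have "2 * 1 \<le> (real P * \<epsilon>') * (1 + \<beta>)" using P\<epsilon> \<beta> by (intro mult_mono) auto
    then have "real P * (1 + \<beta>) * (1 - \<epsilon>') \<le> real (2 * P + R) - 1"
      using R(2) by (simp add: algebra_simps)
    then have 2: "C1 * real g powr (real P * (1 + \<beta>) * (1 - \<epsilon>')) \<le> C1 * real g powr (real (2 * P + R) - 1)"
      unfolding C1_def using g1 by (intro mult_left_mono powr_mono) auto
    have "C * (real (m n') * real n') powr (1 - \<epsilon>) \<le> \<bar>C\<bar> * (real (m n') * real n') powr (1 - \<epsilon>)"
      by (intro mult_right_mono) auto
    then show "C * (real (m n') * real n') powr (1 - \<epsilon>) \<le> C1 * real g powr (real (2 * P + R) - 1)"
      using 1 2 by linarith
    have "real (m n') powr (\<delta> - \<epsilon>) \<le> real (m n') powr (\<delta> - \<epsilon>')"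
      using n1 \<epsilon>' by (intro powr_mono) auto
    also have "\<dots> \<le> (cU * (4 powr \<beta> * real g powr (real P * \<beta>))) powr (\<delta> - \<epsilon>')"
    proof (rule powr_mono2)
      have "cU * real n' powr \<beta> \<le> cU * (4 powr \<beta> * real g powr (real P * \<beta>))"
        using n4p[of \<beta>] \<beta> cU(1) by (intro mult_left_mono) auto
      then show "real (m n') \<le> cU * (4 powr \<beta> * real g powr (real P * \<beta>))" using mU by linarith
    qed (use \<epsilon>' in auto)
    also have "\<dots> = (cU * 4 powr \<beta>) powr (\<delta> - \<epsilon>') * real g powr (real P * \<beta> * (\<delta> - \<epsilon>'))"
      using cU(1) g1 by (simp add: mult.assoc[symmetric] powr_mult powr_powr)
    finally have 3: "\<bar>C\<bar> * real (m n') powr (\<delta> - \<epsilon>) \<le> C2 * real g powr (real P * \<beta> * (\<delta> - \<epsilon>'))"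
      unfolding C2_def mult.assoc by (rule mult_left_mono) simp
    \<comment> \<open>Using \<open>\<beta> * \<delta> = \<beta> - 1\<close>, a query is bounded by a
      constant times \<open>w / g\<close>, so the \<open>h\<^sup>2\<close> queries of an epoch match
      the bound for its updates.\<close>
    have "real P * \<beta> * (\<delta> - \<epsilon>') = real P * (\<beta> - 1) - (real P * \<epsilon>') * \<beta>"
      unfolding \<beta>(3)[symmetric] by (simp add: algebra_simps)
    moreover have "2 * 1 \<le> (real P * \<epsilon>') * \<beta>" using P\<epsilon> \<beta> by (intro mult_mono) auto
    ultimately have "real P * \<beta> * (\<delta> - \<epsilon>') \<le> real R - 1" using R(2) by linarith
    then have "C2 * real g powr (real P * \<beta> * (\<delta> - \<epsilon>')) \<le> C2 * real g powr (real R - 1)"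
      unfolding C2_def using g1 by (intro mult_left_mono powr_mono) auto
    then have 4: "\<bar>C\<bar> * real (m n') powr (\<delta> - \<epsilon>) \<le> C2 * real g powr (real R - 1)" using 3 by linarith
    have "C * real (m n') powr (\<delta> - \<epsilon>) \<le> \<bar>C\<bar> * real (m n') powr (\<delta> - \<epsilon>)"
      by (intro mult_right_mono) auto
    then have "real (h * h) * (C * real (m n') powr (\<delta> - \<epsilon>)) \<le> real (h * h) * (C2 * real g powr (real R - 1))"
      using 4 by (intro mult_left_mono) auto
    also have "\<dots> = C2 * real g powr (real (2 * P + R) - 1)"
    proof -
      have "real (h * h) = real g powr real P * real g powr real P" unfolding g(2) using g1 by (simp add: powr_realpow)
      then have "real (h * h) * real g powr (real R - 1) = real g powr (real P + real P + (real R - 1))"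
        by (simp only: powr_add)
      also have "real P + real P + (real R - 1) = real (2 * P + R) - 1" by simp
      finally show ?thesis by (simp only: mult.left_commute)
    qed
    finally show "real (h * h) * (C * real (m n') powr (\<delta> - \<epsilon>)) \<le> C2 * real g powr (real (2 * P + R) - 1)" .
    have "C * real n' ^ k \<le> \<bar>C\<bar> * (4 * real (g ^ P)) ^ k"
      using n4 by (intro mult_mono power_mono) auto
    also have "\<dots> = (\<bar>C\<bar> * 4 ^ k) * real g ^ (P * k)" by (simp add: power_mult_distrib power_mult)
    also have "\<dots> \<le> real Cn * real g ^ (P * k)" using Cn(2) by (intro mult_right_mono) auto
    finally show "C * real n' ^ k \<le> real Cn * real g ^ (P * k)" .
  qed
  have inst: "instance_of md n' (m n') 0 (init_arcs md h w Mb) reqs"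
    if g: "g0 \<le> g" "h = g ^ P" "w = g ^ R" "n' = h + 1 + w + h" and e: "epoch_reqs md h w v h = reqs @ ys" for g h w n' Mb v reqs ys
    by (rule instance_of_epoch[OF g(4) _ e]) (use base[OF g] in simp)
  have times: "all_halt (word_bound c n') coin (\<lambda>_. 0) (dom_calls A n' 0 (init_arcs md h w Mb) reqs) \<and>
     (let rs = results (word_bound c n') coin (\<lambda>_. 0) (dom_calls A n' 0 (init_arcs md h w Mb) reqs) in
      real (preprocessing_time rs) \<le> C * real n' ^ k \<and>
      real (total_update_time reqs rs) \<le> C * (real (m n') * real n') powr (1 - \<epsilon>) \<and>
      max_query_time_le reqs rs (C * real (m n') powr (\<delta> - \<epsilon>)))"
    if g: "g0 \<le> g" "h = g ^ P" "w = g ^ R" "n' = h + 1 + w + h" and e: "epoch_reqs md h w v h = reqs @ ys" for g h w n' Mb v reqs ys coin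
    using spec[OF conjunct1[OF A[OF inst[OF g e, of Mb]]], of coin] base[OF g] unfolding ex_serve_iff Let_def by simp
  have "hard_instances md A m c P R g0 (P * k) Cn"
  proof (unfold_locales, goal_cases)
    case 1 show ?case using R(3) by simp
  next
    case 2 show ?case by (rule RP)
  next
    case 3 show ?case by (simp add: g0_def)
  next
    case (4 g h w) then show ?case using base[OF 4 refl] by blast
  next
    case (5 g h w n' Mb v coin) then show ?case using times[OF 5(1-4), of v _ "[]" coin Mb] by simp
  next
    case (6 g h w n' Mb coin)
    let ?rs = "results (word_bound c n') coin (\<lambda>_. 0) (dom_calls A n' 0 (init_arcs md h w Mb) [])"
    have "real (preprocessing_time ?rs) \<le> real Cn * real g ^ (P * k)"
      using times[OF 6(1-4), of "\<lambda>_ _. False" "[]" _ coin Mb] pre[OF 6(1-4)] unfolding Let_def by simp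
    then have "real (preprocessing_time ?rs) \<le> real (Cn * g ^ (P * k))" by simp
    then have "preprocessing_time ?rs \<le> Cn * g ^ (P * k)" unfolding of_nat_le_iff .
    then show ?case by (simp add: total_time_def preprocessing_time_def dom_calls_def)
  next
    case (7 g h w n' Mb v coin)
    let ?reqs = "epoch_reqs md h w v h"
    let ?rs = "results (word_bound c n') coin (\<lambda>_. 0) (dom_calls A n' 0 (init_arcs md h w Mb) ?reqs)"
    let ?T = "total_time (word_bound c n') coin (dom_calls A n' 0 (init_arcs md h w Mb) ?reqs)"
    let ?Pre = "total_time (word_bound c n') coin (dom_calls A n' 0 (init_arcs md h w Mb) [])"
    have t: "real (total_update_time ?reqs ?rs) \<le> C * (real (m n') * real n') powr (1 - \<epsilon>)"
      "max_query_time_le ?reqs ?rs (C * real (m n') powr (\<delta> - \<epsilon>))"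
      using times[OF 7(1-4), of v ?reqs "[]" coin Mb] unfolding Let_def by simp_all
    have len: "length ?rs = Suc (length ?reqs)" by (simp add: length_results dom_calls_def)
    have p: "preprocessing_time ?rs = ?Pre" by (simp add: total_time_def preprocessing_time_def dom_calls_def)
    have g1: "0 < real g" using base[OF 7] by simp
    have T0: "?Pre \<le> ?T" using total_time_append_ge[of "word_bound c n'" coin "dom_calls A n' 0 (init_arcs md h w Mb) []"]
      by (simp add: dom_calls_def)
    have "real ?T \<le> real ?Pre + C * (real (m n') * real n') powr (1 - \<epsilon>) + real (h * h) * (C * real (m n') powr (\<delta> - \<epsilon>))"
      using total_time_split[OF len t(2)] t(1) unfolding p length_query_epoch by (simp add: total_time_def)
    also have "\<dots> \<le> real ?Pre + (C1 + C2) * real g powr (real (2 * P + R) - 1)"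
      using upd[OF 7] qry[OF 7] by (simp add: distrib_right)
    also have "\<dots> \<le> real ?Pre + real Cn * real g powr (real (2 * P + R) - 1)"
      using Cn(1) by (intro add_left_mono mult_right_mono) auto
    finally have "real (?T - ?Pre) * real g \<le> (real Cn * real g powr (real (2 * P + R) - 1)) * real g"
      using T0 g1 by (intro mult_right_mono) (auto simp: of_nat_diff)
    also have "\<dots> = real Cn * (real g powr (real (2 * P + R) - 1) * real g powr 1)" using g1 by simp
    also have "\<dots> = real Cn * real g powr (real (2 * P + R))" by (simp only: powr_add[symmetric] diff_add_cancel)
    also have "\<dots> = real (Cn * (h * h * w))"
    proof -
      have "real g powr (real (2 * P + R)) = real g ^ (2 * P + R)" by (rule powr_realpow[OF g1])
      also have "\<dots> = real (h * h * w)" unfolding 7(2,3) by (simp add: power_add mult_2)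
      finally show ?thesis by simp
    qed
    finally have "real ((?T - ?Pre) * g) \<le> real (Cn * (h * h * w))" by simp
    then show ?case unfolding of_nat_le_iff .
  next
    case (8 g h w n' Mb v r i)
    let ?V = "word_bound c n'" and ?q = "Query (port md h r) (h + 1 + w + i)"
    let ?pre = "query_prefix md h w v r i"
    let ?reqs = "?pre @ [?q]"
    have "\<exists>ys. epoch_reqs md h w v h = ?reqs @ ys"
    proof -
      obtain ys where "epoch_reqs md h w v h = epoch_reqs md h w v r @ round_reqs md h w (v r) r @ ys"
        using epoch_reqs_split[OF 8(5)] by blast
      moreover obtain zs where "query_reqs h w (port md h r) h = query_reqs h w (port md h r) i @ ?q # zs"
        using query_reqs_split[OF 8(6)] by blast
      ultimately show ?thesis by (simp add: round_reqs_def query_prefix_def)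
    qed
    then obtain ys where ys: "epoch_reqs md h w v h = ?reqs @ ys" by blast
    let ?good = "{coin. all_halt ?V coin (\<lambda>_. 0) (dom_calls A n' 0 (init_arcs md h w Mb) ?reqs) \<and>
       snd (results ?V coin (\<lambda>_. 0) (dom_calls A n' 0 (init_arcs md h w Mb) ?reqs) ! Suc (length ?pre)) 0 =
         of_bool (dom_tree_parent (nat_graph n' (edges_after md (init_arcs md h w Mb) ?pre)) 0 (port md h r) (h + 1 + w + i))}"
    let ?bad = "{coin. query_reply md A ?V h w Mb v r i coin \<noteq> of_bool (\<exists>j<w. Mb i j \<and> v r j)}"
    have nth: "length ?pre < length ?reqs" "?reqs ! length ?pre = ?q" "take (length ?pre) ?reqs = ?pre" by simp_all
    have good: "1 - 1 / real n' \<le> measure_pmf.prob (coins ?V) ?good"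
      using A[OF inst[OF 8(1-4) ys, of Mb], THEN conjunct2, THEN spec, THEN mp, OF nth(1), THEN spec, THEN spec, THEN mp, OF nth(2)]
      unfolding ex_serve_iff nth(3) .
    have par: "dom_tree_parent (nat_graph n' (edges_after md (init_arcs md h w Mb) ?pre)) 0 (port md h r) (h + 1 + w + i)
        \<longleftrightarrow> (\<exists>j<w. Mb i j \<and> v r j)"
      unfolding query_prefix_def by (rule query_correct[OF 8(4-6)])
    have "?bad \<subseteq> UNIV - ?good"
      unfolding par query_reply_def Let_def 8(4)[symmetric] by blast
    then have "measure_pmf.prob (coins ?V) ?bad \<le> measure_pmf.prob (coins ?V) (UNIV - ?good)"
      by (intro measure_pmf.finite_measure_mono) auto
    also have "\<dots> = 1 - measure_pmf.prob (coins ?V) ?good"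
      using measure_pmf.prob_compl[of ?good "coins ?V"] by simp
    finally show ?case using good by simp
  qed
  then show ?thesis by blast
qed

section \<open>Result of the search and polynomial word bounds\<close>

lemma search_upper:
  assumes "1 \<le> Q"
  shows "n < (search g0 Q n n + 1) ^ Q"
proof -
  \<comment> \<open>Either the search has stopped, or it has moved in every step; after
    \<open>n\<close> steps the second alternative alone makes the value large enough.\<close>
  have "n < (search g0 Q n j + 1) ^ Q \<or> search g0 Q n j = g0 + j" for j
    by (induction j) (auto simp: Let_def)
  then consider "n < (search g0 Q n n + 1) ^ Q" | "search g0 Q n n = g0 + n" by blast
  then show ?thesis
  proof cases
    case 2
    have "n < search g0 Q n n + 1" using 2 by simp
    also have "\<dots> \<le> (search g0 Q n n + 1) ^ Q" using assms by (intro self_le_power) auto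
    finally show ?thesis .
  qed
qed

text \<open>Once \<open>g0 ^ Q \<le> n\<close>, both alternatives yield
  \<open>g ^ Q \<le> n\<close>.\<close>

lemma search_lower: "search g0 Q n j = g0 \<or> search g0 Q n j ^ Q \<le> n"
  by (induction j) (auto simp: Let_def)

lemma search_ge: "g0 \<le> search g0 Q n j"
  by (induction j) (auto simp: Let_def)

lemma search_le: "search g0 Q n j \<le> g0 + j"
  by (induction j) (auto simp: Let_def)

text \<open>Closure under sums, products and powers yields the exponent of the outer word bound from
  the shape of a term alone.\<close>

definition poly_bounded :: "(nat \<Rightarrow> nat) \<Rightarrow> bool" where
  "poly_bounded f \<longleftrightarrow> (\<exists>c. \<forall>n. f n \<le> word_bound c n)"

lemma poly_bounded_const: "poly_bounded (\<lambda>_. a)"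
proof -
  have "a \<le> word_bound a n" for n
  proof -
    have "a \<le> 2 ^ a" by simp
    also have "\<dots> \<le> (n + 2) ^ a" by (intro power_mono) auto
    finally show ?thesis by (simp add: word_bound_def)
  qed
  then show ?thesis unfolding poly_bounded_def by blast
qed

lemma poly_bounded_id: "poly_bounded (\<lambda>n. n)"
  unfolding poly_bounded_def word_bound_def by (rule exI[of _ 1]) simp

lemma poly_bounded_mult: "poly_bounded f \<Longrightarrow> poly_bounded f' \<Longrightarrow> poly_bounded (\<lambda>n. f n * f' n)"
  unfolding poly_bounded_def word_bound_def by (metis mult_le_mono power_add)

lemma poly_bounded_add:
  assumes "poly_bounded f" "poly_bounded f'"
  shows "poly_bounded (\<lambda>n. f n + f' n)"
proof -
  obtain a b where ab: "\<And>n. f n \<le> (n + 2) ^ a" "\<And>n. f' n \<le> (n + 2) ^ b"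
    using assms unfolding poly_bounded_def word_bound_def by blast
  have "f n + f' n \<le> (n + 2) ^ (a + b + 1)" for n
  proof -
    have "f n \<le> (n + 2) ^ (a + b)" "f' n \<le> (n + 2) ^ (a + b)"
      by (rule le_trans[OF ab(1)] le_trans[OF ab(2)], rule power_increasing, simp, simp)+
    then have "f n + f' n \<le> 2 * (n + 2) ^ (a + b)" by simp
    also have "\<dots> \<le> (n + 2) * (n + 2) ^ (a + b)" by (intro mult_le_mono1) simp
    finally show ?thesis by simp
  qed
  then show ?thesis unfolding poly_bounded_def word_bound_def by blast
qed

lemma poly_bounded_power: "poly_bounded f \<Longrightarrow> poly_bounded (\<lambda>n. f n ^ a)"
  by (induction a) (auto intro: poly_bounded_const poly_bounded_mult)

text \<open>\<open>Q\<close> is so large that \<open>g ^ Q \<le> n\<close> absorbs the preprocessing time and the setup of the gadgets. A union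
  bound over at most \<open>n' ^ (4 * Q + 2) / n\<close> answers, each wrong with probability at most
  \<open>2 ^ K / n' ^ (2 * lam)\<close>, determines \<open>lam\<close>. The assumption \<open>word\<close> replaces \<open>g\<close> by its bound \<open>g0 + n\<close>, so
  that its left-hand side is a polynomial in \<open>n\<close>.\<close>

locale reduction = hard_instances +
  fixes Q lam K ex n B g h w W nb2 NB n' V :: nat
  defines "Q \<equiv> k + 2 * P + R + 2" and "lam \<equiv> 4 * Q + 2" and "K \<equiv> 4 * lam" and "ex \<equiv> (P + 1) * c + 2 * P + 3"
    and "g \<equiv> search g0 Q n n" and "h \<equiv> g ^ P" and "w \<equiv> g ^ R" and "W \<equiv> g ^ ex"
    and "nb2 \<equiv> n div w + 1" and "NB \<equiv> (n div h + 1) * nb2" and "n' \<equiv> h + 1 + w + h" and "V \<equiv> word_bound c n'"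
  assumes n: "1 \<le> n"
    and word: "(((n + 1) * ((n + 1) * (n + 1)) + (n + 1) * (n + 1)) * (K + 1) + K + 2) * (g0 + n) ^ ex +
      (g0 + n) ^ ex + ((n + (g0 + n) ^ P) * n + n + (g0 + n) ^ R + 1) + (g0 + n + 1) ^ Q + g0 \<le> B"
begin

section \<open>Bounds for the parameters, the time and the error\<close>

lemma g: "g0 \<le> g" "16 \<le> g" "g \<le> g0 + n" "n < (g + 1) ^ Q" "g0 ^ Q \<le> n \<Longrightarrow> g ^ Q \<le> n"
  using search_ge[of g0 Q n n] g0 search_le[of g0 Q n n] search_upper[of Q n g0] search_lower[of g0 Q n n]
  unfolding g_def by (auto simp: Q_def)

lemma hw: "1 \<le> h" "1 \<le> w" "w \<le> h" "g \<le> w" "g \<le> h" "n' \<le> 4 * h" "g + 1 \<le> n'" "h \<le> n'"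
proof -
  show 1: "1 \<le> h" "1 \<le> w" "w \<le> h" "g \<le> w"
    using g(2) R unfolding h_def w_def by (auto intro: power_increasing self_le_power)
  then show "g \<le> h" "n' \<le> 4 * h" "g + 1 \<le> n'" "h \<le> n'" unfolding n'_def by linarith+
qed

lemma NB_le: "NB \<le> (n + 1) * (n + 1)" "NB \<le> 4 * (n * n)"
proof -
  show 1: "NB \<le> (n + 1) * (n + 1)" unfolding NB_def nb2_def by (intro mult_le_mono) simp_all
  have "(n + 1) * (n + 1) \<le> (2 * n) * (2 * n)" using n by (intro mult_le_mono) simp_all
  then show "NB \<le> 4 * (n * n)" using 1 by simp
qed

text \<open>The value of \<open>ex\<close> serves two demands on \<open>W = g ^ ex\<close>. As
  \<open>n' + 2 \<le> g ^ (P + 1)\<close>, the word bound \<open>V\<close> is at most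
  \<open>g ^ ((P + 1) * c)\<close>, and the graph input fits into \<open>g ^ (2 * (P + 1))\<close>
  cells; \<open>ex\<close> exceeds both exponents.\<close>

lemma run: "omv_run md A V g0 P R Q ex K n B"
proof -
  have n2: "n' + 2 \<le> g ^ (P + 1)"
  proof -
    have "n' + 2 \<le> 16 * h" using hw by linarith
    also have "\<dots> \<le> g * h" using g by (intro mult_le_mono1)
    finally show ?thesis by (simp add: h_def)
  qed
  have "V \<le> (g ^ (P + 1)) ^ c" unfolding V_def word_bound_def using n2 by (intro power_mono) auto
  also have "\<dots> < W" unfolding W_def ex_def power_mult[symmetric] using g(2) by (intro power_strict_increasing) auto
  finally have V: "V < W" .
  have "n' * n' + 2 \<le> (n' + 2) * (n' + 2)" by simp
  also have "\<dots> \<le> g ^ (P + 1) * g ^ (P + 1)" by (intro mult_le_mono n2)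
  also have "\<dots> \<le> W" unfolding W_def ex_def power_add[symmetric] using g(2) by (intro power_increasing) auto
  finally have gs: "n' * n' + 2 \<le> W" .
  have b: "(((n + 1) * NB + NB) * (K + 1) + K + 2) * W + W \<le>
      (((n + 1) * ((n + 1) * (n + 1)) + (n + 1) * (n + 1)) * (K + 1) + K + 2) * (g0 + n) ^ ex + (g0 + n) ^ ex"
    "(n + h) * n + n + w + 1 \<le> (n + (g0 + n) ^ P) * n + n + (g0 + n) ^ R + 1"
    "(g + 1) ^ Q \<le> (g0 + n + 1) ^ Q"
    unfolding W_def h_def w_def by (intro add_mono mult_le_mono power_mono NB_le(1) g(3) order_refl zero_le)+
  show ?thesis
    unfolding omv_run_def g_def[symmetric] h_def[symmetric] w_def[symmetric] W_def[symmetric] nb2_def[symmetric]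
      NB_def[symmetric] n'_def[symmetric]
  proof (intro conjI allI)
    show "1 \<le> g0" using g0 by simp
    show "1 \<le> Q" "1 \<le> K" "1 \<le> V" by (simp_all add: Q_def K_def lam_def V_def word_bound_def Suc_le_eq)
    show "1 \<le> n" "V < W" "n' * n' + 2 \<le> W" by (rule n V gs)+
    show "(((n + 1) * NB + NB) * (K + 1) + K + 2) * W + W \<le> B" "(n + h) * n + n + w + 1 \<le> B" "(g + 1) ^ Q \<le> B" "g0 \<le> B"
      using b word by linarith+
  next
    fix coin' Mb v
    show "all_halt V coin' (\<lambda>_. 0) (dom_calls A n' 0 (init_arcs md h w Mb) (epoch_reqs md h w v h))"
      unfolding V_def by (rule halt[OF g(1)]) (simp_all add: h_def w_def n'_def)
  qed
qed

text \<open>The coefficients of the estimates in \<open>time_bound\<close>: 96 is 32 from the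
  preprocessing plus 64 from the epochs, and the last summand occurs twice, for the setup before the
  blocks in the preprocessing and in the rounds.\<close>

definition time_const :: nat where
  "time_const =
     (let r = reg_bound (dom_preprocess A) + reg_bound (dom_update A) + reg_bound (dom_query A) in
      96 * (K * C) + 64 * (K * (r + 24) + 94) + (Q + 20) + 4 * (K * (3 * (r + 20) + 34) + 84) + 2 * (P + R + ex + 40))"

text \<open>Each summand times \<open>g\<close> is compared with \<open>n ^ 3\<close>. The main one
  is \<open>t5\<close>: the \<open>NB\<close> blocks satisfy
  \<open>NB * (h * w) \<le> 4 * n\<^sup>2\<close>, there are at most \<open>2 * n / h\<close>
  epochs, and an epoch costs at most \<open>C * h\<^sup>2 * w / g\<close>. The costs of
  preprocessing and of writing the graphs are absorbed by \<open>g ^ Q \<le> n\<close>.\<close>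

lemma time_bound:
  assumes big: "g ^ Q \<le> n" and T1: "T1 * g \<le> C * (h * h * w)"
    and r: "r = reg_bound (dom_preprocess A) + reg_bound (dom_update A) + reg_bound (dom_query A)"
  shows "(8 * (NB * K * (C * g ^ k)) + NB * (K * (r + 24) + n' * n' * 60 + 30 + 4) + n * (Q + 20) + (P + R + ex + 40) +
      8 * (NB * K * ((n div h + 1) * T1)) +
      n * (NB * (K * ((2 * w + h) * (r + 20) + 34) + h * 20 + 60 + 4) + (P + R + ex + 40))) * g \<le> time_const * n ^ 3"
proof -
  have pw: "g ^ a \<le> n" if "a \<le> Q" for a
    using big power_increasing[OF that, of g] g(2) by linarith
  have gn: "g \<le> n" using pw[of 1] by (simp add: Q_def)
  have kn: "g ^ k * g \<le> n" using pw[of "k + 1"] by (simp add: Q_def mult.commute)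
  have hhn: "h * h * g \<le> n" using pw[of "P + P + 1"] by (simp add: Q_def h_def power_add mult.commute)
  have hn: "h \<le> n" "w \<le> n" unfolding h_def w_def by (intro pw; simp add: Q_def)+
  have dh: "(n div h + 1) * h \<le> 2 * n" "(n div w + 1) * w \<le> 2 * n"
    unfolding add_mult_distrib using hn div_times_less_eq_dividend[of n h] div_times_less_eq_dividend[of n w] by linarith+
  have n3: "n * n * n = n ^ 3" by (simp add: power3_eq_cube)
  have "NB * (h * w) = ((n div h + 1) * h) * ((n div w + 1) * w)" by (simp only: NB_def nb2_def ac_simps)
  also have "\<dots> \<le> (2 * n) * (2 * n)" by (intro mult_le_mono dh)
  finally have NBhw: "NB * (h * w) \<le> 4 * (n * n)" by simp
  have n2: "n * n \<le> n ^ 3" "n \<le> n ^ 3"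
    using power_increasing[of 2 3 n] power_increasing[of 1 3 n] n by (simp_all add: power2_eq_square)
  have t1: "8 * (NB * K * (C * g ^ k)) * g \<le> 32 * (K * C) * n ^ 3"
  proof -
    have "8 * (NB * K * (C * g ^ k)) * g = 8 * (K * C) * (NB * (g ^ k * g))" by (simp only: ac_simps)
    also have "\<dots> \<le> 8 * (K * C) * (4 * (n * n) * n)" by (intro mult_le_mono order_refl NB_le(2) kn)
    finally show ?thesis by (simp add: n3[symmetric] ac_simps)
  qed
  have t2: "NB * (K * (r + 24) + n' * n' * 60 + 30 + 4) * g \<le> 64 * (K * (r + 24) + 94) * n ^ 3"
  proof -
    have nn: "n' * n' \<le> 16 * (h * h)" using mult_le_mono[OF hw(6) hw(6)] by simp
    have "1 * 1 \<le> h * h" by (intro mult_le_mono hw)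
    then have "K * (r + 24) * 1 \<le> K * (r + 24) * (h * h)" by (intro mult_le_mono order_refl) simp
    then have "K * (r + 24) + n' * n' * 60 + 30 + 4 \<le> 16 * (K * (r + 24) * (h * h)) + 16 * 94 * (h * h)"
      using nn \<open>1 * 1 \<le> h * h\<close> by linarith
    also have "\<dots> = 16 * (K * (r + 24) + 94) * (h * h)" by (simp add: algebra_simps)
    finally have "NB * (K * (r + 24) + n' * n' * 60 + 30 + 4) * g \<le> 4 * (n * n) * (16 * (K * (r + 24) + 94) * (h * h)) * g"
      by (intro mult_le_mono NB_le order_refl)
    also have "\<dots> = 64 * (K * (r + 24) + 94) * (n * n * (h * h * g))" by (simp add: ac_simps)
    also have "\<dots> \<le> 64 * (K * (r + 24) + 94) * (n * n * n)" by (intro mult_le_mono order_refl hhn)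
    finally show ?thesis by (simp only: n3)
  qed
  have t3: "n * (Q + 20) * g \<le> (Q + 20) * n ^ 3"
  proof -
    have "n * (Q + 20) * g \<le> n * (Q + 20) * n" by (intro mult_le_mono order_refl gn)
    also have "\<dots> = (Q + 20) * (n * n)" by (simp only: ac_simps)
    also have "\<dots> \<le> (Q + 20) * n ^ 3" by (intro mult_le_mono order_refl n2)
    finally show ?thesis .
  qed
  have t4: "(P + R + ex + 40) * g \<le> (P + R + ex + 40) * n ^ 3"
    using gn n2 by (intro mult_le_mono order_refl) linarith
  have t5: "8 * (NB * K * ((n div h + 1) * T1)) * g \<le> 64 * (K * C) * n ^ 3"
  proof -
    have "8 * (NB * K * ((n div h + 1) * T1)) * g = 8 * K * (NB * (n div h + 1)) * (T1 * g)" by (simp only: ac_simps)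
    also have "\<dots> \<le> 8 * K * (NB * (n div h + 1)) * (C * (h * h * w))" by (intro mult_le_mono order_refl T1)
    also have "\<dots> = 8 * (K * C) * ((NB * (h * w)) * ((n div h + 1) * h))" by (simp only: ac_simps)
    also have "\<dots> \<le> 8 * (K * C) * (4 * (n * n) * (2 * n))" by (intro mult_le_mono order_refl NBhw dh)
    finally show ?thesis by (simp add: n3[symmetric] ac_simps)
  qed
  \<comment> \<open>Scanning the vector and the rows costs \<open>O(h)\<close> per block and round.
    The factor \<open>g\<close> is covered by \<open>g \<le> w\<close>, which comes from
    \<open>1 \<le> R\<close>.\<close>
  have t6: "n * (NB * (K * ((2 * w + h) * (r + 20) + 34) + h * 20 + 60 + 4)) * g \<le> 4 * (K * (3 * (r + 20) + 34) + 84) * n ^ 3"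
  proof -
    have "K * ((2 * w + h) * (r + 20) + 34) \<le> K * ((3 * h) * (r + 20) + 34 * h)"
      using hw by (intro mult_le_mono add_le_mono order_refl) simp_all
    also have "\<dots> = K * (3 * (r + 20) + 34) * h" by (simp add: algebra_simps)
    finally have "K * ((2 * w + h) * (r + 20) + 34) + h * 20 + 60 + 4 \<le> K * (3 * (r + 20) + 34) * h + 84 * h"
      using hw(1) by linarith
    also have "\<dots> = (K * (3 * (r + 20) + 34) + 84) * h" by (simp only: add_mult_distrib)
    finally have "n * (NB * (K * ((2 * w + h) * (r + 20) + 34) + h * 20 + 60 + 4)) * g \<le>
        n * (NB * ((K * (3 * (r + 20) + 34) + 84) * h)) * w"
      by (intro mult_le_mono order_refl hw(4))
    also have "\<dots> = (K * (3 * (r + 20) + 34) + 84) * (n * (NB * (h * w)))" by (simp only: ac_simps)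
    also have "\<dots> \<le> (K * (3 * (r + 20) + 34) + 84) * (n * (4 * (n * n)))" by (intro mult_le_mono order_refl NBhw)
    finally show ?thesis by (simp add: n3[symmetric] ac_simps)
  qed
  have t7: "n * (P + R + ex + 40) * g \<le> (P + R + ex + 40) * n ^ 3"
  proof -
    have "n * (P + R + ex + 40) * g \<le> n * (P + R + ex + 40) * n" by (intro mult_le_mono order_refl gn)
    also have "\<dots> = (P + R + ex + 40) * (n * n)" by (simp only: ac_simps)
    also have "\<dots> \<le> (P + R + ex + 40) * n ^ 3" by (intro mult_le_mono order_refl n2)
    finally show ?thesis .
  qed
  have "time_const * n ^ 3 = 32 * (K * C) * n ^ 3 + 64 * (K * (r + 24) + 94) * n ^ 3 + (Q + 20) * n ^ 3 +
      (P + R + ex + 40) * n ^ 3 + 64 * (K * C) * n ^ 3 + 4 * (K * (3 * (r + 20) + 34) + 84) * n ^ 3 + (P + R + ex + 40) * n ^ 3"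
    unfolding time_const_def r[symmetric] Let_def by (simp only: add_mult_distrib[symmetric]) simp
  then show ?thesis
    using add_le_mono[OF add_le_mono[OF add_le_mono[OF add_le_mono[OF add_le_mono[OF add_le_mono[OF t1 t2] t3] t4] t5] t6] t7]
    by (simp only: add_mult_distrib add_mult_distrib2 add.assoc)
qed

text \<open>Holds for every outcome of the coins. That wrong replies are in the minority is left as
  a premise, whose probability is estimated in \<open>prob_correct\<close>.\<close>

lemma serve_correct:
  fixes coin :: "nat \<Rightarrow> bool" and M :: "nat \<Rightarrow> nat \<Rightarrow> bool" and vs :: "(nat \<Rightarrow> bool) list"
  defines "Mb \<equiv> \<lambda>b i j. matrix_input n M ((b div nb2 * h + i) * n + (b mod nb2 * w + j) + 1) = 1"
    and "v \<equiv> \<lambda>e b r j. vector_input n (vs ! (e * h + r)) (b mod nb2 * w + j) = 1"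
  assumes len: "length vs = n"
  shows "\<exists>rs. serve B coin (\<lambda>_. 0) (omv_calls (omv_of_dom md A g0 P R Q ex K) n M vs) rs \<and>
    (g0 ^ Q \<le> n \<longrightarrow> sum_list (map fst rs) * g \<le> time_const * n ^ 3) \<and>
    ((\<forall>t b i. t < n \<longrightarrow> b < NB \<longrightarrow> i < h \<longrightarrow> 2 * card {k. k < K \<and> slice V W coin k \<in> {coin.
        query_reply md A V h w (Mb b) (v (t div h) b) (t mod h) i coin \<noteq> of_bool (\<exists>j<w. Mb b i j \<and> v (t div h) b (t mod h) j)}} < K) \<longrightarrow>
      omv_correct n M vs rs)"
proof -
  interpret r: omv_run md A V g0 P R Q ex K n B coin M vs g h w W nb2 NB n' "\<lambda>e b k. ((e * NB + b) * (K + 1) + k + 2) * W"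
    by (rule run g_def h_def w_def W_def nb2_def NB_def n'_def reflexive)+
  have bm: "r.block_matrix = Mb" "r.vec = v" by (intro ext; simp add: r.block_matrix_def r.vec_def Mb_def v_def)+
  have dc: "r.pre_call b # map (request_call A) reqs = dom_calls A n' 0 (init_arcs md h w (r.block_matrix b)) reqs" for b reqs
    by (simp add: r.pre_call_def dom_calls_def)
  have pre: "[r.pre_call b] = dom_calls A n' 0 (init_arcs md h w (r.block_matrix b)) []" for b
    using dc[of b "[]"] by simp
  have T0: "r.tt k' [r.pre_call b] \<le> C * g ^ k" for b k'
    unfolding pre V_def by (rule preprocess[OF g(1)]) (simp_all add: h_def w_def n'_def)
  \<comment> \<open>The time of an epoch is a natural number, so \<open>time\<close> bounds it by
    this rounded quotient.\<close>
  define T1 where "T1 = C * (h * h * w) div g"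
  have T1: "r.tt k' (r.hist e b h) \<le> T1 + r.tt k' (r.hist e b 0)" for e b k'
  proof -
    have h0: "r.hist e b 0 = dom_calls A n' 0 (init_arcs md h w (r.block_matrix b)) []"
      by (simp add: r.hist_def pre epoch_reqs_def)
    have "(r.tt k' (r.hist e b h) - r.tt k' (r.hist e b 0)) * g \<le> C * (h * h * w)"
      unfolding h0 unfolding r.hist_def dc V_def by (rule time[OF g(1)]) (simp_all add: h_def w_def n'_def)
    then have "r.tt k' (r.hist e b h) - r.tt k' (r.hist e b 0) \<le> T1"
      unfolding T1_def using g(2) by (simp add: less_eq_div_iff_mult_less_eq)
    then show ?thesis by simp
  qed
  have "T1 * g \<le> C * (h * h * w)" unfolding T1_def by (rule div_times_less_eq_dividend)
  note tb = time_bound[OF g(5) this refl]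
  obtain rs where rs: "serve B coin (\<lambda>_. 0) (omv_calls (omv_of_dom md A g0 P R Q ex K) n M vs) rs"
    "sum_list (map fst rs) \<le> 8 * (NB * K * (C * g ^ k)) + NB * (r.pre_cost + 4) + n * (Q + 20) + (P + R + ex + 40) +
        8 * (NB * K * ((n div h + 1) * T1)) + n * (NB * (r.loop_cost + 4) + (P + R + ex + 40))"
    "\<And>t. t < n \<Longrightarrow> snd (rs ! Suc t) = r.round_output t"
    using r.serve_omv[OF len T0 T1] by blast
  have "sum_list (map fst rs) * g \<le> time_const * n ^ 3" if "g0 ^ Q \<le> n"
    using le_trans[OF mult_le_mono1[OF rs(2), of g] tb[OF that]] .
  moreover have "omv_correct n M vs rs"
    if "\<forall>t b i. t < n \<longrightarrow> b < NB \<longrightarrow> i < h \<longrightarrow> 2 * card {k. k < K \<and> slice V W coin k \<in> {coin.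
        query_reply md A V h w (Mb b) (v (t div h) b) (t mod h) i coin \<noteq> of_bool (\<exists>j<w. Mb b i j \<and> v (t div h) b (t mod h) j)}} < K"
    unfolding omv_correct_def
  proof (intro allI impI)
    fix t x assume tx: "t < n" "x < n"
    show "snd (rs ! Suc t) x = of_bool (bool_mat_vec n M (vs ! t) x)"
      unfolding rs(3)[OF tx(1)]
      by (rule r.round_output_correct[OF tx]) (use that tx in \<open>simp add: bm\<close>)
  qed
  ultimately show ?thesis using rs(1) by blast
qed

text \<open>With \<open>n \<le> n' ^ Q\<close>, the four factors \<open>n\<close> contribute the
  exponent \<open>4 * Q\<close>, the constant 4 and \<open>h\<close> contribute 1 each, and
  \<open>2 ^ K = 16 ^ lam\<close> contributes at most \<open>lam\<close>. The choice
  \<open>lam = 4 * Q + 2\<close> makes the sum \<open>2 * lam\<close>.\<close>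

lemma union_bound: "n * (NB * h) * 2 ^ K * n \<le> n' ^ (2 * lam)"
proof -
  have n'4: "16 \<le> n'" using hw g by linarith
  have "(g + 1) ^ Q \<le> n' ^ Q" by (intro power_mono hw) simp
  then have nQ: "n \<le> n' ^ Q" using g(4) by linarith
  have "(2::nat) ^ K = 16 ^ lam" unfolding K_def power_mult by simp
  also have "\<dots> \<le> n' ^ lam" by (intro power_mono n'4) simp
  finally have 2: "2 ^ K \<le> n' ^ lam" .
  have "n * (NB * h) * 2 ^ K * n \<le> n * (4 * (n * n) * n') * n' ^ lam * n"
    by (intro mult_le_mono order_refl NB_le 2 hw)
  also have "\<dots> = 4 * (n * n * n * n) * n' * n' ^ lam" by (simp only: ac_simps)
  also have "\<dots> \<le> n' * (n' ^ Q * n' ^ Q * n' ^ Q * n' ^ Q) * n' * n' ^ lam"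
    using n'4 by (intro mult_le_mono order_refl nQ) simp
  also have "\<dots> = n' ^ (1 + (Q + Q + Q + Q) + 1 + lam)" by (simp only: power_add power_one_right)
  also have "1 + (Q + Q + Q + Q) + 1 + lam = 2 * lam" by (simp add: lam_def)
  finally show ?thesis .
qed

text \<open>A union bound over rounds, blocks and rows. A majority among \<open>K = 4 * lam\<close>
  copies fails with probability at most \<open>2 ^ K / n' ^ (2 * lam)\<close>, so
  \<open>union_bound\<close> leaves a total of at most \<open>1 / n\<close>.\<close>

lemma prob_correct:
  fixes M :: "nat \<Rightarrow> nat \<Rightarrow> bool" and vs :: "(nat \<Rightarrow> bool) list"
  assumes len: "length vs = n"
  shows "1 - 1 / real n \<le> measure_pmf.prob (coins B)
    {coin. \<exists>rs. serve B coin (\<lambda>_. 0) (omv_calls (omv_of_dom md A g0 P R Q ex K) n M vs) rs \<and> omv_correct n M vs rs}"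
proof -
  define Mb where "Mb = (\<lambda>b i j. matrix_input n M ((b div nb2 * h + i) * n + (b mod nb2 * w + j) + 1) = 1)"
  define v where "v = (\<lambda>e b r j. vector_input n (vs ! (e * h + r)) (b mod nb2 * w + j) = 1)"
  define X where "X = (\<lambda>(t, b, i). {coin. query_reply md A V h w (Mb b) (v (t div h) b) (t mod h) i coin \<noteq>
     of_bool (\<exists>j<w. Mb b i j \<and> v (t div h) b (t mod h) j)})"
  define bad where "bad = (\<lambda>x. {coin. K \<le> 2 * card {k. k < K \<and> slice V W coin k \<in> X x}})"
  define I where "I = {..<n} \<times> {..<NB} \<times> {..<h}"
  let ?good = "{coin. \<exists>rs. serve B coin (\<lambda>_. 0) (omv_calls (omv_of_dom md A g0 P R Q ex K) n M vs) rs \<and> omv_correct n M vs rs}"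
  let ?p = "measure_pmf.prob (coins B)"
  have n'0: "0 < n'" by (simp add: n'_def)
  have VW: "V < W" and KB: "K * W + W \<le> B"
    using run omv_run.size_facts(16)[OF run, folded g_def, folded W_def]
    unfolding omv_run_def g_def[symmetric] W_def[symmetric] by blast+
  have fin: "finite I" by (simp add: I_def)
  have pb: "?p (bad x) \<le> 2 ^ K * (1 / real n') ^ (2 * lam)" if x: "x \<in> I" for x
  proof -
    obtain t b i where xx: "x = (t, b, i)" "i < h" using x by (auto simp: I_def)
    have "measure_pmf.prob (coins V) (X x) \<le> 1 / real n'"
      unfolding X_def xx(1) prod.case V_def
      using hw(1) xx(2) by (intro correct[OF g(1) h_def[THEN meta_eq_to_obj_eq] w_def[THEN meta_eq_to_obj_eq]
        n'_def[THEN meta_eq_to_obj_eq]]) simp_all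
    moreover have "k' * W + V \<le> B" if "k' < K" for k'
    proof -
      have "(k' + 1) * W \<le> K * W" using that by (intro mult_le_mono1) simp
      then show ?thesis using VW KB by simp
    qed
    ultimately show ?thesis
      unfolding bad_def using n'0 by (intro prob_bad_majority VW) (simp_all add: K_def)
  qed
  have "UNIV - ?good \<subseteq> (\<Union>x\<in>I. bad x)"
  proof
    fix coin assume c: "coin \<in> UNIV - ?good"
    show "coin \<in> (\<Union>x\<in>I. bad x)"
    proof (rule ccontr)
      assume nb: "coin \<notin> (\<Union>x\<in>I. bad x)"
      have "2 * card {k. k < K \<and> slice V W coin k \<in> X (t, b, i)} < K" if "t < n" "b < NB" "i < h" for t b i
      proof -
        have "(t, b, i) \<in> I" using that by (simp add: I_def)
        then show ?thesis using nb unfolding bad_def by force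
      qed
      then have "\<exists>rs. serve B coin (\<lambda>_. 0) (omv_calls (omv_of_dom md A g0 P R Q ex K) n M vs) rs \<and> omv_correct n M vs rs"
        using serve_correct[OF len, of coin M] unfolding X_def prod.case Mb_def v_def by blast
      then show False using c by simp
    qed
  qed
  then have "?p (UNIV - ?good) \<le> ?p (\<Union>x\<in>I. bad x)" by (intro measure_pmf.finite_measure_mono) auto
  also have "\<dots> \<le> (\<Sum>x\<in>I. ?p (bad x))" by (rule measure_pmf.finite_measure_subadditive_finite[OF fin]) simp
  also have "\<dots> \<le> (\<Sum>x\<in>I. 2 ^ K * (1 / real n') ^ (2 * lam))" by (rule sum_mono[OF pb])
  also have "\<dots> = real (n * (NB * h) * 2 ^ K) / real n' ^ (2 * lam)" by (simp add: I_def power_one_over)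
  also have "\<dots> \<le> 1 / real n"
  proof -
    have "real (n * (NB * h) * 2 ^ K) * real n \<le> real n' ^ (2 * lam)"
      unfolding of_nat_mult[symmetric] of_nat_power[symmetric] of_nat_le_iff by (rule union_bound)
    then show ?thesis using n n'0 by (simp add: field_simps)
  qed
  finally have "?p (UNIV - ?good) \<le> 1 / real n" .
  moreover have "?p (UNIV - ?good) = 1 - ?p ?good"
    using measure_pmf.prob_compl[of ?good "coins B"] by simp
  ultimately show ?thesis by linarith
qed

text \<open>The gain \<open>g\<close> is turned into a power of \<open>n\<close>: as
  \<open>n < (g + 1) ^ Q \<le> (2 * g) ^ Q\<close>, it is at least half of
  \<open>n powr (1 / Q)\<close>.\<close>

lemma time_powr:
  assumes big: "g0 ^ Q \<le> n" and T: "T * g \<le> time_const * n ^ 3"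
  shows "real T \<le> (2 * real time_const) * real n powr (3 - 1 / real Q)"
proof -
  have Q0: "0 < Q" by (simp add: Q_def)
  have g1: "0 < real g" using g(2) by simp
  have n0: "0 < real n" using n by simp
  have "(g + 1) ^ Q \<le> (2 * g) ^ Q" using g(2) by (intro power_mono) auto
  then have "n \<le> (2 * g) ^ Q" using g(4) by linarith
  then have "real n \<le> real ((2 * g) ^ Q)" by (simp only: of_nat_le_iff)
  then have "real n powr (1 / real Q) \<le> real ((2 * g) ^ Q) powr (1 / real Q)"
    by (intro powr_mono2) auto
  also have "\<dots> = 2 * real g" using g(2) Q0 by (subst powr_power_nat) simp_all
  finally have 1: "real n powr (1 / real Q) \<le> 2 * real g" .
  have "real (T * g) \<le> real (time_const * n ^ 3)" using T by (simp only: of_nat_le_iff)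
  then have 2: "real T * real g \<le> real time_const * real n ^ 3" by simp
  have "real T * real n powr (1 / real Q) \<le> real T * (2 * real g)" by (intro mult_left_mono 1) simp
  also have "\<dots> \<le> (2 * real time_const) * real n ^ 3" using 2 by simp
  also have "\<dots> = (2 * real time_const) * real n powr 3" using n0 by simp
  finally have 3: "real T * real n powr (1 / real Q) \<le> (2 * real time_const) * real n powr 3" .
  have "real n powr (3 - 1 / real Q) = real n powr 3 / real n powr (1 / real Q)" by (rule powr_diff)
  then show ?thesis using 3 n0 by (simp add: pos_le_divide_eq)
qed

end

text \<open>The constants in the program and the exponent \<open>c'\<close> are chosen before
  \<open>n\<close>, so a single program serves all sizes; the locale \<open>reduction\<close> is
  then applied for each \<open>n\<close> separately.\<close>

lemma (in hard_instances) solves_OMv_exists: "\<exists>\<epsilon>>0. \<exists>A'. solves_OMv \<epsilon> A'"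
proof -
  define Q where "Q = k + 2 * P + R + 2"
  define K where "K = 4 * (4 * Q + 2)"
  define ex where "ex = (P + 1) * c + 2 * P + 3"
  obtain c' where c': "\<And>n. (((n + 1) * ((n + 1) * (n + 1)) + (n + 1) * (n + 1)) * (K + 1) + K + 2) * (g0 + n) ^ ex +
      (g0 + n) ^ ex + ((n + (g0 + n) ^ P) * n + n + (g0 + n) ^ R + 1) + (g0 + n + 1) ^ Q + g0 \<le> word_bound c' n"
  proof -
    have "poly_bounded (\<lambda>n. (((n + 1) * ((n + 1) * (n + 1)) + (n + 1) * (n + 1)) * (K + 1) + K + 2) * (g0 + n) ^ ex +
      (g0 + n) ^ ex + ((n + (g0 + n) ^ P) * n + n + (g0 + n) ^ R + 1) + (g0 + n + 1) ^ Q + g0)"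
      by (intro poly_bounded_add poly_bounded_mult poly_bounded_power poly_bounded_const poly_bounded_id)
    then show ?thesis unfolding poly_bounded_def using that by blast
  qed
  have red: "reduction md A m c P R g0 k C n (word_bound c' n)" if "1 \<le> n" for n
    using hard_instances_axioms that c'[of n] unfolding reduction_def reduction_axioms_def Q_def K_def ex_def by simp
  have "solves_OMv (1 / real Q) (omv_of_dom md A g0 P R Q ex K)"
    unfolding solves_OMv_def
  proof (rule exI[of _ c'], rule exI[of _ "g0 ^ Q"], rule exI[of _ "2 * real (reduction.time_const A c P R k C)"], intro allI impI conjI)
    fix n M and vs :: "(nat \<Rightarrow> bool) list" and coin assume n: "1 \<le> n" and len: "length vs = n"
    note s = reduction.serve_correct[OF red[OF n] len, folded Q_def, folded K_def ex_def, of coin M]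
    note t = reduction.time_powr[OF red[OF n], folded Q_def, folded K_def ex_def]
    show "\<exists>rs. serve (word_bound c' n) coin (\<lambda>_. 0) (omv_calls (omv_of_dom md A g0 P R Q ex K) n M vs) rs \<and>
      (n \<ge> g0 ^ Q \<longrightarrow> real (sum_list (map fst rs)) \<le> (2 * real (reduction.time_const A c P R k C)) * real n powr (3 - 1 / real Q))"
      using s t by blast
  next
    fix n M and vs :: "(nat \<Rightarrow> bool) list" assume n: "1 \<le> n" and len: "length vs = n"
    show "1 - 1 / real n \<le> measure_pmf.prob (coins (word_bound c' n)) {coin. \<exists>rs. serve (word_bound c' n) coin (\<lambda>_. 0)
        (omv_calls (omv_of_dom md A g0 P R Q ex K) n M vs) rs \<and> omv_correct n M vs rs}"
      using reduction.prob_correct[OF red[OF n] len, folded Q_def, folded K_def ex_def] .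
  qed
  moreover have "0 < 1 / real Q" by (simp add: Q_def)
  ultimately show ?thesis by blast
qed

theorem theorem5:
  fixes \<delta> :: real and m :: "nat \<Rightarrow> nat"
  assumes "0 < \<delta>" and "\<delta> \<le> 1 / 2"
    and "(\<lambda>n. real (m n)) \<in> \<Theta>(\<lambda>n. real n powr (1 / (1 - \<delta>)))"
    and "OMv_conjecture"
  shows "\<not> (\<exists>\<epsilon>>0. \<exists>A. maintains_dominator_tree Decremental m \<delta> \<epsilon> A) \<and>
         \<not> (\<exists>\<epsilon>>0. \<exists>A. maintains_dominator_tree Incremental m \<delta> \<epsilon> A)"
proof -
  have "\<not> maintains_dominator_tree md m \<delta> \<epsilon> A" if \<epsilon>: "0 < \<epsilon>" for md \<epsilon> A
  proof
    assume "maintains_dominator_tree md m \<delta> \<epsilon> A"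
    then obtain c P R g0 k C where "hard_instances md A m c P R g0 k C"
      using hard_instances_exist[OF assms(1-3) \<epsilon>] by blast
    then show False
      using hard_instances.solves_OMv_exists assms(4) unfolding OMv_conjecture_def by blast
  qed
  then show ?thesis by blast
qed

end
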